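(* Let $\{X_n\}$ be the perturbed random walk on $\mathbb{Z}^\nu$ described in the context (with $a(x)=-a(-x)$ for all $x\in\mathbb{Z}^\nu$). Let $x\in\mathbb{Z}^\nu$ and $P_n(x):=\mathbb{P}(X_n=x\mid X_0=0)$. Then for any $\nu\geq 1$, $$P_n(0)=\frac{1}{(2\pi n)^{\nu/2}|B|}+o\left(\frac{1}{n^{\nu/2}}\right),$$ while for $x\neq 0$ the following holds. (i) If $\nu=1$, then $$P_n(x)=\frac{e^{-\frac{x^2}{2\sigma^2 n}}}{\sqrt{2\pi\sigma^2 n}}\left(1+\frac{d}{\sigma^2}\operatorname{sign}(x)\right)+\frac{\psi_{1}(x)}{\sqrt n}+o\left(\frac{1}{\sqrt n}\right),$$ where $\psi_1$ is an odd function with $\sup_{|x|}|\psi_1(x)|\le C$ and $|\psi_1(x)|\le C\frac{n^{\varepsilon}}{|x|}$ for all $\varepsilon>0$. (ii) If $\nu=2$, then $$P_n(x)=\frac{e^{-\frac{(x,B^{-1}x)}{2n}}}{2\pi |B| n}+\frac{\psi_{2}(x)}{n}+o\left(\frac{1}{n}\right),$$ where $\psi_2(x)$ is a bounded odd function such that $|\psi_2(x)|\le \frac{C}{|x|}$. (iii) If $\nu\ge 3$, then $$P_n(x)=\frac{e^{-\frac{(x,B^{-1}x)}{2n}}}{(2\pi n)^{\nu/2}|B|}+\frac{(q_a\ast G_\nu)(x)}{n^{\nu/2}}+o\left(\frac{1}{n^{\nu/2}}\right),$$ where $G_\nu$ is the $\nu$-dimensional Green function.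
   Context: Setting. Let $\{\xi_n\}_{n\in\mathbb{N}}$ be symmetric i.i.d. random variables with values in $\mathbb{Z}^\nu$ (so $\mathbb{P}(\xi_1=x)=\mathbb{P}(\xi_1=-x)$), with $\mathbb{E}[\xi_1]=0$, positive definite covariance matrix $B_{ij}:=\mathbb{E}[\xi_{1,i}\xi_{1,j}]$, and $\mathbb{E}[\xi_{1,1}^{\alpha_1}\cdots\xi_{1,\nu}^{\alpha_\nu}]<\infty$ for all multi-indices $\alpha\in\mathbb{N}_0^\nu$ with $|\alpha|=\alpha_1+\dots+\alpha_\nu=4$; here $\xi_{1,i}$ is the $i$-th component of $\xi_1$. The random walk $S_n$ with increments $\xi_n$ and initial condition $S_0=x_0\in\mathbb{Z}^\nu$ is assumed aperiodic and irreducible. For $\nu=1$, $\sigma^2=B$ is the variance of $\xi_1$. Notation: $|B|:=\sqrt{\det B}$. Let $\{\eta_n\}_{n\in\mathbb{N}}$ be another sequence of i.i.d. random variables in $\mathbb{Z}^\nu$ such that the matrix $(\mathbb{E}[\eta_{1,i}\eta_{1,j}])_{i,j=1,\dots,\nu}$ is positive definite, $\mathbb{E}[\eta_1]=:d\neq 0$, and $\mathbb{E}[\eta_{1,1}^{\alpha_1}\cdots\eta_{1,\nu}^{\alpha_\nu}]<\infty$ for all $|\alpha|=3$. Put $p(x):=\mathbb{P}(\xi_1=x)$, $q(x):=\mathbb{P}(\eta_1=x)$, $a(x):=q(x)-p(x)$. The process $X_n=X_{n-1}+\xi_n+(\eta_n-\xi_n)\delta_{X_{n-1},0}$, $X_0=x_0\in\mathbb{Z}^\nu$,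 is the Markov chain on $\mathbb{Z}^\nu$ with transition probabilities $$\mathbb{P}(X_n=x\mid X_{n-1}=y)=p(x-y)+\delta_{y,0}\,a(x),$$ where $\delta$ is the Kronecker delta; it is assumed aperiodic and irreducible. Standing antisymmetry assumption: $a(x)=-a(-x)$ for all $x\in\mathbb{Z}^\nu$. Hence $a=q_a$ and $p=q_s$, where $q_a(x)=\frac{q(x)-q(-x)}{2}$ and $q_s(x)=\frac{q(x)+q(-x)}{2}$ are the antisymmetric and symmetric parts of $q$. Convolution: $(f\ast g)(x)=\sum_{y\in\mathbb{Z}^\nu}f(y)g(x-y)$. With $\widehat{p}(\lambda)=\sum_{x\in\mathbb{Z}^\nu}p(x)e^{i\lambda\cdot x}$, the Green function for $\nu\ge3$ is that of the unperturbed walk: $G_\nu(x)=\int_{[-\pi,\pi]^\nu}\frac{e^{-ix\cdot\lambda}}{1-\widehat{p}(\lambda)}\frac{d^\nu\lambda}{(2\pi)^\nu}$. $o(1/n^{r})$ denotes a quantity approaching zero faster than $n^{-r}$ uniformly in $x\in\mathbb{Z}^\nu$. $C$ denotes an absolute constant which may change from line to line. $(\cdot,\cdot)$ is the Euclidean inner product.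
   Formalization: In (iii) the printed correction term (q_a∗G_ν)(x)/n^{ν/2} is false in general (off by a constant factor); the formal statement proves it with the correct normalization (q_a∗G_ν)(x)/((2πn)^{ν/2}|B|). *)

theory Defs
  imports "HOL-Probability.Probability"
begin

text \<open>The lattice \<open>\<int>\<^sup>\<nu>\<close> is the type \<^typ>\<open>int ^ 'n\<close> with \<open>\<nu> = CARD('n)\<close>.\<close>

definition real_vec :: "int ^ 'n \<Rightarrow> real ^ 'n" where
  "real_vec x = (\<chi> i. real_of_int (x $ i))"


subsection \<open>Laws and moments of lattice-valued random variables\<close>

definition law :: "'w measure \<Rightarrow> ('w \<Rightarrow> 'a) \<Rightarrow> 'a \<Rightarrow> real" where
  "law M X x = measure M {\<omega> \<in> space M. X \<omega> = x}"

definition mean_vec :: "'w measure \<Rightarrow> ('w \<Rightarrow> int ^ 'n) \<Rightarrow> real ^ 'n" where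
  "mean_vec M X = (\<chi> i. \<integral>\<omega>. real_of_int (X \<omega> $ i) \<partial>M)"

definition second_moment_matrix :: "'w measure \<Rightarrow> ('w \<Rightarrow> int ^ 'n) \<Rightarrow> real ^ 'n ^ 'n" where
  "second_moment_matrix M X =
     (\<chi> i j. \<integral>\<omega>. real_of_int (X \<omega> $ i) * real_of_int (X \<omega> $ j) \<partial>M)"

text \<open>Finiteness of a mixed moment means absolute integrability of the monomial. The pure powers
  are among the monomials, so finite moments of order \<open>k\<close> imply all lower ones on a
  probability space.\<close>

definition finite_moments :: "'w measure \<Rightarrow> ('w \<Rightarrow> int ^ 'n) \<Rightarrow> nat \<Rightarrow> bool" where
  "finite_moments M X k \<longleftrightarrow>
     (\<forall>\<alpha> :: 'n \<Rightarrow> nat. (\<Sum>i\<in>UNIV. \<alpha> i) = k \<longrightarrow>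
        integrable M (\<lambda>\<omega>. \<Prod>i\<in>UNIV. real_of_int (X \<omega> $ i) ^ \<alpha> i))"

definition positive_definite :: "real ^ 'n ^ 'n \<Rightarrow> bool" where
  "positive_definite A \<longleftrightarrow> transpose A = A \<and> (\<forall>v. v \<noteq> 0 \<longrightarrow> v \<bullet> (A *v v) > 0)"

definition identically_distributed :: "'w measure \<Rightarrow> (nat \<Rightarrow> 'w \<Rightarrow> 'a) \<Rightarrow> nat set \<Rightarrow> bool" where
  "identically_distributed M X I \<longleftrightarrow>
     (\<forall>m\<in>I. \<forall>n\<in>I. distr M (count_space UNIV) (X m) = distr M (count_space UNIV) (X n))"


subsection \<open>The two walks\<close>

text \<open>Both walks take the starting point as first argument and the time as second argument;
  the increments used are those with index \<open>1, 2, \<dots>\<close>. For \<open>perturbed_walk\<close> to be Markov with transition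
  probabilities \<open>p(x - y) + \<delta>\<^bsub>y,0\<^esub> a(x)\<close>, the pairs \<open>(\<xi>\<^sub>n, \<eta>\<^sub>n)\<close> have to be independent over \<open>n\<close>; the
  dependence between \<open>\<xi>\<^sub>n\<close> and \<open>\<eta>\<^sub>n\<close> is irrelevant.\<close>

definition free_walk ::
  "(nat \<Rightarrow> 'w \<Rightarrow> int ^ 'n) \<Rightarrow> int ^ 'n \<Rightarrow> nat \<Rightarrow> 'w \<Rightarrow> int ^ 'n" where
  "free_walk \<xi> x0 n \<omega> = x0 + (\<Sum>k\<in>{1..n}. \<xi> k \<omega>)"

primrec perturbed_walk ::
  "(nat \<Rightarrow> 'w \<Rightarrow> int ^ 'n) \<Rightarrow> (nat \<Rightarrow> 'w \<Rightarrow> int ^ 'n) \<Rightarrow> int ^ 'n \<Rightarrow> nat \<Rightarrow> 'w \<Rightarrow> int ^ 'n" where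
  "perturbed_walk \<xi> \<eta> x0 0 \<omega> = x0"
| "perturbed_walk \<xi> \<eta> x0 (Suc n) \<omega> = perturbed_walk \<xi> \<eta> x0 n \<omega> + \<xi> (Suc n) \<omega>
     + (if perturbed_walk \<xi> \<eta> x0 n \<omega> = 0 then \<eta> (Suc n) \<omega> - \<xi> (Suc n) \<omega> else 0)"

text \<open>For a chain given as a family \<open>Z\<close> of processes indexed by the deterministic starting point,
  conditioning on the initial state \<open>y\<close> amounts to choosing the process \<open>Z y\<close>.\<close>

definition n_step_prob ::
  "'w measure \<Rightarrow> ('a \<Rightarrow> nat \<Rightarrow> 'w \<Rightarrow> 'a) \<Rightarrow> nat \<Rightarrow> 'a \<Rightarrow> 'a \<Rightarrow> real" where
  "n_step_prob M Z n y x = law M (Z y n) x"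

definition irreducible_chain :: "'w measure \<Rightarrow> ('a \<Rightarrow> nat \<Rightarrow> 'w \<Rightarrow> 'a) \<Rightarrow> bool" where
  "irreducible_chain M Z \<longleftrightarrow> (\<forall>y x. \<exists>n. n_step_prob M Z n y x > 0)"

definition aperiodic_chain :: "'w measure \<Rightarrow> ('a \<Rightarrow> nat \<Rightarrow> 'w \<Rightarrow> 'a) \<Rightarrow> bool" where
  "aperiodic_chain M Z \<longleftrightarrow> (\<forall>y. Gcd {n. n \<ge> 1 \<and> n_step_prob M Z n y y > 0} = 1)"


subsection \<open>Convolution and Green function\<close>

definition antisym_part :: "(int ^ 'n \<Rightarrow> real) \<Rightarrow> int ^ 'n \<Rightarrow> real" where
  "antisym_part q x = (q x - q (- x)) / 2"

definition lattice_conv :: "(int ^ 'n \<Rightarrow> real) \<Rightarrow> (int ^ 'n \<Rightarrow> real) \<Rightarrow> int ^ 'n \<Rightarrow> real" where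
  "lattice_conv f g x = (\<Sum>\<^sub>\<infinity>y. f y * g (x - y))"

definition char_fun :: "(int ^ 'n \<Rightarrow> real) \<Rightarrow> real ^ 'n \<Rightarrow> complex" where
  "char_fun p l = (\<Sum>\<^sub>\<infinity>x. complex_of_real (p x) * exp (\<i> * complex_of_real (l \<bullet> real_vec x)))"

text \<open>For symmetric \<open>p\<close> the integral is real, so taking the real part only changes the type.
  With this normalisation \<open>G = \<Sum>\<^sub>m p\<^sub>m\<close>, where \<open>p\<^sub>m\<close> is the law of the free walk from \<open>0\<close> after \<open>m\<close> steps.
  Since \<open>P\<^sub>n = p\<^sub>n + (\<Sum>k<n. p\<^sub>k(0) (q\<^sub>a * p\<^bsub>n-1-k\<^esub>))\<close>, the odd part of \<open>P\<^sub>n(x)\<close> is to leading order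
  \<open>p\<^sub>n(0) (q\<^sub>a * G)(x)\<close>. The convolution therefore enters multiplied by the leading term
  \<open>1 / ((2 \<pi> n)\<^bsup>\<nu>/2\<^esup> |B|)\<close> of \<open>p\<^sub>n(0)\<close>, not by \<open>n\<^bsup>-\<nu>/2\<^esup>\<close> alone.\<close>

definition green_function :: "(int ^ 'n \<Rightarrow> real) \<Rightarrow> int ^ 'n \<Rightarrow> real" where
  "green_function p x = Re (set_lebesgue_integral lborel (cbox (\<chi> i. - pi) (\<chi> i. pi))
     (\<lambda>l :: real ^ 'n. exp (- (\<i> * complex_of_real (real_vec x \<bullet> l))) / (1 - char_fun p l)))
     / (2 * pi) ^ CARD('n)"


subsection \<open>Error terms\<close>

text \<open>\<open>R n x = o(n\<^sup>-\<^sup>r)\<close> as \<open>n \<rightarrow> \<infinity>\<close>, uniformly in \<open>x \<in> A\<close>.\<close>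

definition uniform_smallo :: "'a set \<Rightarrow> (nat \<Rightarrow> 'a \<Rightarrow> real) \<Rightarrow> real \<Rightarrow> bool" where
  "uniform_smallo A R r \<longleftrightarrow>
     uniform_limit A (\<lambda>n x. real n powr r * R n x) (\<lambda>_. 0) sequentially"

definition odd_fun :: "('a :: group_add \<Rightarrow> real) \<Rightarrow> bool" where
  "odd_fun f \<longleftrightarrow> (\<forall>x. f (- x) = - f x)"

end

theory Submission
  imports Defs "HOL-Real_Asymp.Real_Asymp"
begin

text \<open>Write \<open>p\<^sub>m\<close> for the law of the unperturbed walk after \<open>m\<close> steps and \<open>a = q - p\<close>. Conditioning on
  the position at time \<open>n\<close> gives \<open>P\<^bsub>n+1\<^esub> = p * P\<^sub>n + P\<^sub>n(0) a\<close>. As \<open>a\<close> is odd and \<open>p\<close> even, the sum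
  \<open>D\<^sub>n = (\<Sum>m<n. p\<^bsub>n-1-m\<^esub>(0) (a * p\<^sub>m))\<close> is odd and hence vanishes at the origin, so the perturbation does not
  change the return probabilities and \<open>P\<^sub>n = p\<^sub>n + D\<^sub>n\<close> solves the recursion
  (\<open>perturbed_recursion_solution\<close>). It remains to expand \<open>p\<^sub>n\<close> and \<open>D\<^sub>n\<close>.

  For \<open>p\<^sub>n\<close> this is the uniform local limit theorem (\<open>local_limit\<close>). Aperiodicity and irreducibility give
  \<open>\<bar>char_fun p l\<bar> \<le> exp (- c \<bar>l\<bar>\<^sup>2)\<close> on the whole torus, and dominated convergence in the Fourier inversion
  formula does the rest.

  For \<open>D\<^sub>n\<close> the basic estimate is \<open>conv_pw_bound\<close>: if the Fourier series of \<open>f\<close> vanishes to order \<open>k\<close> at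
  the origin, then \<open>f * p\<^sub>m = O(m\<^bsup>-(\<nu>+k)/2\<^esup>)\<close> uniformly. Since \<open>n\<^bsup>\<nu>/2\<^esup> p\<^bsub>n-1-m\<^esub>(0)\<close> tends to
  \<open>limit_const\<close>, one expects \<open>n\<^bsup>\<nu>/2\<^esup> D\<^sub>n(x)\<close> to tend to \<open>limit_const\<close> times \<open>(\<Sum>m. (a * p\<^sub>m)(x))\<close>, and
  \<open>uniform_limit_weighted_sum\<close> proves this whenever \<open>(\<nu>+k)/2 > 1\<close> and the late terms are negligible. An odd
  \<open>a\<close> has \<open>k = 1\<close>, which suffices for \<open>\<nu> \<ge> 2\<close>. For \<open>\<nu> \<ge> 3\<close> the series is \<open>a\<close> convolved with the Green
  function \<open>(\<Sum>m. p\<^sub>m)\<close>. For \<open>\<nu> = 2\<close> its decay follows from the additional bound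
  \<open>\<bar>x\<bar>\<^sup>2 (a * p\<^sub>m)(x) = O(m\<^bsup>-1/2\<^esup>)\<close>.

  For \<open>\<nu> = 1\<close> the order \<open>k = 1\<close> is not enough, and indeed \<open>D\<^sub>n\<close> contributes to the Gaussian term. Let
  \<open>sg\<close> be the sign. The drift \<open>crossing = sg - p * sg\<close> has mean \<open>\<sigma>\<^sup>2\<close>, so \<open>a - (d / \<sigma>\<^sup>2) crossing\<close> has mean
  \<open>0\<close>, its Fourier series vanishes to order \<open>3\<close>, and it produces \<open>\<psi>\<^sub>1\<close>. For \<open>crossing\<close> itself the
  drift sum is \<open>sg p\<^sub>n\<close> up to \<open>o(n\<^bsup>-1/2\<^esup>)\<close> (\<open>crossing_error_limit\<close>), which produces the factor
  \<open>1 + (d / \<sigma>\<^sup>2) sg\<close>.\<close>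

no_notation Infinite_Set_Sum.abs_summable_on (infix \<open>abs'_summable'_on\<close> 50)

section \<open>Summable functions on the lattice\<close>

lemma summable_on_real_comparison:
  fixes f :: "'a \<Rightarrow> real"
  assumes "g summable_on A" "\<And>x. x \<in> A \<Longrightarrow> \<bar>f x\<bar> \<le> g x"
  shows "f summable_on A"
  using Infinite_Sum.abs_summable_on_comparison_test'[OF assms(1), of f] assms(2)
  by (metis real_norm_def summable_on_iff_abs_summable_on_real)

lemma summable_on_real_abs: "(f :: 'a \<Rightarrow> real) summable_on A \<Longrightarrow> (\<lambda>x. \<bar>f x\<bar>) summable_on A"
  by (metis (lifting) real_norm_def summable_on_cong summable_on_iff_abs_summable_on_real)

lemma summable_on_mult_bounded:
  fixes F :: "'a \<Rightarrow> 'b :: {real_normed_field, banach}" and f :: "'a \<Rightarrow> real"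
  assumes "f summable_on A" "\<And>x. norm (F x) \<le> C"
  shows "(\<lambda>x. of_real (f x) * F x) abs_summable_on A"
proof (rule Infinite_Sum.abs_summable_on_comparison_test')
  show "(\<lambda>x. C * \<bar>f x\<bar>) summable_on A"
    by (intro summable_on_cmult_right summable_on_real_abs assms)
  show "norm (of_real (f x) * F x) \<le> C * \<bar>f x\<bar>" for x
    using assms(2)[of x] by (simp add: norm_mult mult.commute[of C] mult_left_mono)
qed

lemma summable_on_product_of_summable:
  fixes f :: "'a \<Rightarrow> real" and g :: "'b \<Rightarrow> real"
  assumes "f summable_on UNIV" "g summable_on UNIV"
  shows "(\<lambda>(y, z). f y * g z) summable_on UNIV"
proof -
  have "(\<lambda>(y, z). f y * g z) abs_summable_on UNIV \<times> UNIV"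
    unfolding Infinite_Sum.abs_summable_on_Sigma_iff
    using assms by (auto simp: abs_mult infsum_cmult_right' intro!: summable_on_cmult_left summable_on_cmult_right summable_on_real_abs)
  then show ?thesis
    using abs_summable_summable by fastforce
qed

text \<open>The shear \<open>(y, z) \<mapsto> (y + z, y)\<close> of the index set turns a product of two summable
  functions into the summands of their convolution; every property of the convolution below
  is read off from this rearrangement.\<close>

lemma lattice_conv_summable_pairs:
  fixes f g :: "int ^ 'n \<Rightarrow> real"
  assumes "f summable_on UNIV" "g summable_on UNIV"
  shows "(\<lambda>(x, y). f y * g (x - y)) summable_on UNIV"
proof -
  have bij: "bij_betw (\<lambda>(x :: int ^ 'n, y). (y, x - y)) UNIV UNIV"
    by (rule bij_betw_byWitness[where f' = "\<lambda>(y, z). (y + z, y)"]) auto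
  show ?thesis
    using summable_on_reindex_bij_betw[OF bij, of "\<lambda>(y, z). f y * g z"]
      summable_on_product_of_summable[OF assms]
    by (simp add: case_prod_unfold)
qed

lemma lattice_conv_summand:
  fixes f g :: "int ^ 'n \<Rightarrow> real"
  assumes "f summable_on UNIV" "g summable_on UNIV"
  shows "(\<lambda>y. f y * g (x - y)) summable_on UNIV"
proof -
  have "(\<lambda>(x, y). f y * g (x - y)) abs_summable_on UNIV \<times> UNIV"
    using iffD1[OF summable_on_iff_abs_summable_on_real lattice_conv_summable_pairs[OF assms]] by simp
  then have "(\<lambda>y. f y * g (x - y)) abs_summable_on UNIV"
    unfolding Infinite_Sum.abs_summable_on_Sigma_iff by simp
  then show ?thesis by (rule abs_summable_summable)
qed

lemma lattice_conv_summable: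
  fixes f g :: "int ^ 'n \<Rightarrow> real"
  assumes "f summable_on UNIV" "g summable_on UNIV"
  shows "lattice_conv f g summable_on UNIV"
  unfolding lattice_conv_def
  using summable_on_Sigma_banach[of "\<lambda>x y. f y * g (x - y)" UNIV "\<lambda>_. UNIV"] lattice_conv_summable_pairs[OF assms]
  by simp

lemma infsum_of_real_banach: "(\<Sum>\<^sub>\<infinity>x\<in>A. (of_real (f x) :: 'b :: {real_normed_field, banach})) = of_real (\<Sum>\<^sub>\<infinity>x\<in>A. f x)"
  if "f summable_on A"
  using has_sum_of_real[OF has_sum_infsum[OF that]] by (rule infsumI)

text \<open>For a character \<open>F\<close> the right-hand side factorizes.\<close>

lemma infsum_lattice_conv_mult:
  fixes f g :: "int ^ 'n \<Rightarrow> real" and F :: "int ^ 'n \<Rightarrow> complex"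
  assumes "f summable_on UNIV" "g summable_on UNIV" "\<And>x. norm (F x) \<le> C"
  shows "(\<Sum>\<^sub>\<infinity>x. of_real (lattice_conv f g x) * F x)
    = (\<Sum>\<^sub>\<infinity>y. \<Sum>\<^sub>\<infinity>z. of_real (f y * g z) * F (y + z))"
proof -
  have bij: "bij_betw (\<lambda>(x :: int ^ 'n, y). (y, x - y)) UNIV UNIV"
    by (rule bij_betw_byWitness[where f' = "\<lambda>(y, z). (y + z, y)"]) auto
  have s1: "(\<lambda>p. of_real ((case p of (x, y) \<Rightarrow> f y * g (x - y))) * F (fst p)) abs_summable_on UNIV"
    by (rule summable_on_mult_bounded[OF lattice_conv_summable_pairs[OF assms(1,2)]]) (rule assms)
  have s2: "(\<lambda>p. of_real ((case p of (y, z) \<Rightarrow> f y * g z)) * F (fst p + snd p)) abs_summable_on UNIV"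
    by (rule summable_on_mult_bounded[OF summable_on_product_of_summable[OF assms(1,2)]]) (rule assms)
  have "(\<Sum>\<^sub>\<infinity>x. of_real (lattice_conv f g x) * F x)
     = (\<Sum>\<^sub>\<infinity>x. \<Sum>\<^sub>\<infinity>y. of_real (f y * g (x - y)) * F x)"
    unfolding lattice_conv_def
    by (simp only: infsum_cmult_left' infsum_of_real_banach[OF lattice_conv_summand[OF assms(1,2)]])
  also have "\<dots> = (\<Sum>\<^sub>\<infinity>p. of_real ((case p of (x, y) \<Rightarrow> f y * g (x - y))) * F (fst p))"
    using infsum_Sigma_banach[of "\<lambda>p. of_real ((case p of (x, y) \<Rightarrow> f y * g (x - y))) * F (fst p)" UNIV "\<lambda>_. UNIV"]
      s1[THEN abs_summable_summable] by simp
  also have "\<dots> = (\<Sum>\<^sub>\<infinity>p. of_real ((case p of (y, z) \<Rightarrow> f y * g z)) * F (fst p + snd p))"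
    using infsum_reindex_bij_betw[OF bij, of "\<lambda>p. of_real ((case p of (y, z) \<Rightarrow> f y * g z)) * F (fst p + snd p)"]
    by (simp add: case_prod_unfold)
  also have "\<dots> = (\<Sum>\<^sub>\<infinity>y. \<Sum>\<^sub>\<infinity>z. of_real (f y * g z) * F (y + z))"
    using infsum_Sigma_banach[of "\<lambda>p. of_real ((case p of (y, z) \<Rightarrow> f y * g z)) * F (fst p + snd p)" UNIV "\<lambda>_. UNIV"]
      s2[THEN abs_summable_summable] by simp
  finally show ?thesis .
qed

lemma real_vec_simps [simp]:
  "real_vec 0 = 0" "real_vec (x + y) = real_vec x + real_vec y" "real_vec (x - y) = real_vec x - real_vec y"
  "real_vec (- x) = - real_vec x" "real_vec x $ i = real_of_int (x $ i)"
  by (simp_all add: real_vec_def vec_eq_iff)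

lemma infsum_of_finite_sum:
  fixes f :: "'a \<Rightarrow> 'b \<Rightarrow> 'c :: {topological_comm_monoid_add, t2_space}"
  assumes "finite I" "\<And>i. i \<in> I \<Longrightarrow> f i summable_on A"
  shows "(\<Sum>i\<in>I. infsum (f i) A) = (\<Sum>\<^sub>\<infinity>x\<in>A. \<Sum>i\<in>I. f i x)"
    and "(\<lambda>x. \<Sum>i\<in>I. f i x) summable_on A"
proof -
  have "(\<Sum>i\<in>I. infsum (f i) A) = (\<Sum>\<^sub>\<infinity>x\<in>A. \<Sum>i\<in>I. f i x) \<and> (\<lambda>x. \<Sum>i\<in>I. f i x) summable_on A"
    using assms
    by (induction I rule: finite_induct) (auto simp: infsum_add summable_on_add)
  then show "(\<Sum>i\<in>I. infsum (f i) A) = (\<Sum>\<^sub>\<infinity>x\<in>A. \<Sum>i\<in>I. f i x)"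
    "(\<lambda>x. \<Sum>i\<in>I. f i x) summable_on A" by auto
qed

lemma infsum_difference:
  fixes f g :: "'a \<Rightarrow> 'b :: real_normed_vector"
  assumes f: "f summable_on A" and g: "g summable_on A"
  shows "(\<Sum>\<^sub>\<infinity>x\<in>A. f x - g x) = infsum f A - infsum g A" "(\<lambda>x. f x - g x) summable_on A"
proof -
  have "((\<lambda>x. f x + - 1 *\<^sub>R g x) has_sum (infsum f A + - 1 *\<^sub>R infsum g A)) A"
    by (intro has_sum_add has_sum_infsum f has_sum_scaleR g)
  then show "(\<Sum>\<^sub>\<infinity>x\<in>A. f x - g x) = infsum f A - infsum g A" "(\<lambda>x. f x - g x) summable_on A"
    by (auto simp: infsumI summable_on_def)
qed

section \<open>Fourier series of summable functions\<close>

lemma char_fun_cis: "char_fun f l = (\<Sum>\<^sub>\<infinity>x. of_real (f x) * cis (l \<bullet> real_vec x))"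
  by (simp add: char_fun_def cis_conv_exp)

lemma char_fun_summable:
  fixes f :: "int ^ 'n \<Rightarrow> real"
  assumes "f summable_on UNIV"
  shows "(\<lambda>x. of_real (f x) * cis (l \<bullet> real_vec x)) abs_summable_on UNIV"
  by (rule summable_on_mult_bounded[where C = 1]) (use assms in auto)

lemma char_fun_conv:
  fixes f g :: "int ^ 'n \<Rightarrow> real"
  assumes "f summable_on UNIV" "g summable_on UNIV"
  shows "char_fun (lattice_conv f g) l = char_fun f l * char_fun g l"
proof -
  have "char_fun (lattice_conv f g) l
    = (\<Sum>\<^sub>\<infinity>y. \<Sum>\<^sub>\<infinity>z. of_real (f y * g z) * cis (l \<bullet> real_vec (y + z)))"
    unfolding char_fun_cis by (rule infsum_lattice_conv_mult[where C = 1]) (use assms in auto)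
  also have "\<dots> = (\<Sum>\<^sub>\<infinity>y. \<Sum>\<^sub>\<infinity>z. (of_real (f y) * cis (l \<bullet> real_vec y)) * (of_real (g z) * cis (l \<bullet> real_vec z)))"
    by (intro infsum_cong) (simp add: inner_add_right cis_mult[symmetric])
  also have "\<dots> = char_fun f l * char_fun g l"
    unfolding char_fun_cis by (simp add: infsum_cmult_right' infsum_cmult_left')
  finally show ?thesis .
qed

lemma char_fun_bound:
  fixes f :: "int ^ 'n \<Rightarrow> real"
  assumes "f summable_on UNIV"
  shows "norm (char_fun f l) \<le> (\<Sum>\<^sub>\<infinity>x. \<bar>f x\<bar>)"
  using norm_infsum_bound[OF char_fun_summable[OF assms, of l]]
  by (simp add: char_fun_cis norm_mult)

lemma char_fun_add:
  fixes f g :: "int ^ 'n \<Rightarrow> real"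
  assumes "f summable_on UNIV" "g summable_on UNIV"
  shows "char_fun (\<lambda>x. f x + g x) l = char_fun f l + char_fun g l"
  unfolding char_fun_cis using infsum_add[OF char_fun_summable[OF assms(1), THEN abs_summable_summable]
      char_fun_summable[OF assms(2), THEN abs_summable_summable]]
  by (simp add: algebra_simps)

lemma char_fun_cmult:
  fixes f :: "int ^ 'n \<Rightarrow> real"
  shows "char_fun (\<lambda>x. c * f x) l = of_real c * char_fun f l"
  unfolding char_fun_cis by (simp add: infsum_cmult_right' mult.assoc)

text \<open>Fubini for a series of integrals. It justifies termwise integration of Fourier series and the
  decomposition of expectations over the values of a discrete random variable.\<close>

lemma integral_infsum:
  fixes F :: "'a \<Rightarrow> 'b :: countable \<Rightarrow> complex"
  assumes "sigma_finite_measure M"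
  assumes int: "\<And>x. integrable M (\<lambda>l. F l x)"
  assumes sum: "\<And>l. F l abs_summable_on UNIV"
  assumes sint: "(\<lambda>x. \<integral>l. norm (F l x) \<partial>M) summable_on UNIV"
  shows "(\<integral>l. (\<Sum>\<^sub>\<infinity>x. F l x) \<partial>M) = (\<Sum>\<^sub>\<infinity>x. \<integral>l. F l x \<partial>M)"
    and "integrable M (\<lambda>l. \<Sum>\<^sub>\<infinity>x. F l x)"
proof -
  interpret C: sigma_finite_measure "count_space (UNIV :: 'b set)"
    by (rule sigma_finite_measure_count_space)
  interpret M: sigma_finite_measure M by fact
  interpret P: pair_sigma_finite "count_space (UNIV :: 'b set)" M ..
  have inf: "infsum f UNIV = integral\<^sup>L (count_space UNIV) f \<and> integrable (count_space UNIV) f"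
    if "f abs_summable_on UNIV" for f :: "'b \<Rightarrow> complex"
    using that infsetsum_infsum[of f UNIV] abs_summable_equivalent[of f UNIV]
    unfolding Infinite_Set_Sum.abs_summable_on_def infsetsum_def
      by (simp add: Infinite_Set_Sum.abs_summable_on_def set_integrable_def set_lebesgue_integral_def)
  have sint': "(\<lambda>x. \<integral>l. F l x \<partial>M) abs_summable_on UNIV"
    by (rule Infinite_Sum.abs_summable_on_comparison_test'[OF sint]) (rule integral_norm_bound)
  have [measurable]: "(\<lambda>l. F l x) \<in> borel_measurable M" for x
    using int by auto
  have meas: "case_prod (\<lambda>x l. F l x) \<in> borel_measurable (count_space UNIV \<Otimes>\<^sub>M M)"
    by (rule measurable_pair_measure_countable1) auto
  have "integrable (count_space UNIV \<Otimes>\<^sub>M M) (case_prod (\<lambda>x l. F l x))"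
  proof (rule P.Fubini_integrable[OF meas])
    have "(\<lambda>x. complex_of_real (\<integral>l. norm (F l x) \<partial>M)) abs_summable_on (UNIV :: 'b set)"
      by (rule Infinite_Sum.abs_summable_on_comparison_test'[OF sint]) simp
    from inf[OF this] have "integrable (count_space UNIV) (\<lambda>x. complex_of_real (\<integral>l. norm (F l x) \<partial>M))"
      by simp
    then show "integrable (count_space UNIV) (\<lambda>x. \<integral>y. norm (case (x, y) of (x, l) \<Rightarrow> F l x) \<partial>M)"
      by (simp add: complex_of_real_integrable_eq)
    show "AE x in count_space UNIV. integrable M (\<lambda>y. case (x, y) of (x, l) \<Rightarrow> F l x)"
      by (simp add: int)
  qed
  from P.Fubini_integral[OF this] P.integrable_snd[OF this]
  show "(\<integral>l. (\<Sum>\<^sub>\<infinity>x. F l x) \<partial>M) = (\<Sum>\<^sub>\<infinity>x. \<integral>l. F l x \<partial>M)" "integrable M (\<lambda>l. \<Sum>\<^sub>\<infinity>x. F l x)"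
    using inf[OF sint'] inf[OF sum] by simp_all
qed

lemma
  fixes f :: "'n :: finite \<Rightarrow> real \<Rightarrow> 'b :: {real_normed_field,banach,second_countable_topology}"
  assumes int: "\<And>i. integrable lborel (f i)"
  shows integral_lborel_vec_prod:
      "(\<integral>x. (\<Prod>i\<in>UNIV. f i ((x :: real ^ 'n) $ i)) \<partial>lborel) = (\<Prod>i\<in>UNIV. \<integral>t. f i t \<partial>lborel)"
    and integrable_lborel_vec_prod:
      "integrable lborel (\<lambda>x :: real ^ 'n. \<Prod>i\<in>UNIV. f i (x $ i))"
proof -
  interpret product_sigma_finite "\<lambda>_ :: real ^ 'n. lborel :: real measure" ..
  have [measurable]: "f i \<in> borel_measurable borel" for i
    using int[of i] by auto
  have Basis: "(Basis :: (real ^ 'n) set) = (\<lambda>i. axis i 1) ` UNIV"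
    by (auto simp: Basis_vec_def)
  have inj: "inj (\<lambda>i. axis i 1 :: real ^ 'n)"
    by (auto simp: inj_on_def axis_eq_axis)
  define ix where "ix = inv (\<lambda>i. axis i 1 :: real ^ 'n)"
  have ix: "ix (axis i 1) = i" for i
    unfolding ix_def by (rule inv_f_f[OF inj])
  have comp: "(\<Sum>b\<in>Basis. F b *\<^sub>R b) $ i = F (axis i 1)" for F :: "real ^ 'n \<Rightarrow> real" and i
  proof -
    have "(\<Sum>b\<in>Basis. F b *\<^sub>R b) $ i = (\<Sum>b\<in>Basis. F b *\<^sub>R b) \<bullet> axis i 1"
      by (simp add: inner_axis)
    also have "\<dots> = F (axis i 1)" by simp
    finally show ?thesis .
  qed
  have eq: "(\<Prod>i\<in>UNIV. f i ((\<Sum>b\<in>Basis. F b *\<^sub>R b) $ i)) = (\<Prod>b\<in>Basis. f (ix b) (F b))" for F :: "real ^ 'n \<Rightarrow> real"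
    unfolding comp unfolding Basis using inj by (simp add: prod.reindex ix)
  have meas: "(\<lambda>F. \<Sum>b\<in>Basis. F b *\<^sub>R b) \<in> (\<Pi>\<^sub>M b\<in>(Basis :: (real ^ 'n) set). lborel) \<rightarrow>\<^sub>M borel"
    by measurable
  have I: "integrable (\<Pi>\<^sub>M b\<in>Basis. lborel) (\<lambda>F. \<Prod>b\<in>(Basis :: (real ^ 'n) set). f (ix b) (F b))"
    by (rule product_integrable_prod) (use int in auto)
  have m2: "(\<lambda>x :: real ^ 'n. \<Prod>i\<in>UNIV. f i (x $ i)) \<in> borel_measurable borel"
    by measurable
  show "integrable lborel (\<lambda>x :: real ^ 'n. \<Prod>i\<in>UNIV. f i (x $ i))"
    unfolding lborel_eq[where 'a = "real ^ 'n"]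
    by (subst integrable_distr_eq[OF meas m2], unfold eq, rule I)
  have "(\<integral>x. (\<Prod>i\<in>UNIV. f i ((x :: real ^ 'n) $ i)) \<partial>lborel) = (\<integral>F. (\<Prod>b\<in>(Basis :: (real ^ 'n) set). f (ix b) (F b)) \<partial>(\<Pi>\<^sub>M b\<in>Basis. lborel))"
    unfolding lborel_eq[where 'a = "real ^ 'n"]
    by (subst integral_distr[OF meas m2], unfold eq, rule refl)
  also have "\<dots> = (\<Prod>b\<in>(Basis :: (real ^ 'n) set). \<integral>t. f (ix b) t \<partial>lborel)"
    by (rule product_integral_prod) (use int in auto)
  also have "\<dots> = (\<Prod>i\<in>UNIV. \<integral>t. f i t \<partial>lborel)"
    unfolding Basis using inj by (simp add: prod.reindex ix)
  finally show "(\<integral>x. (\<Prod>i\<in>UNIV. f i ((x :: real ^ 'n) $ i)) \<partial>lborel) = (\<Prod>i\<in>UNIV. \<integral>t. f i t \<partial>lborel)" .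
qed

abbreviation torus :: "(real ^ 'n) set" where
  "torus \<equiv> cbox (\<chi> i. - pi) (\<chi> i. pi)"

lemma mem_torus: "l \<in> torus \<longleftrightarrow> (\<forall>i. \<bar>l $ i\<bar> \<le> pi)"
  by (auto simp: mem_box_cart abs_le_iff minus_le_iff)

lemma indicator_torus: "indicator torus (l :: real ^ 'n) = (\<Prod>i\<in>UNIV. indicator {-pi..pi} (l $ i) :: 'b :: comm_semiring_1)"
proof (cases "l \<in> torus")
  case True
  then show ?thesis by (auto simp: mem_box_cart indicator_def intro!: prod.neutral[symmetric])
next
  case False
  then obtain i where "l $ i \<notin> {-pi..pi}" by (auto simp: mem_box_cart)
  then have "indicator {-pi..pi} (l $ i) = (0 :: 'b)" by simp
  then have "(\<Prod>i\<in>UNIV. indicator {-pi..pi} (l $ i) :: 'b) = 0"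
    by (intro prod_zero) auto
  with False show ?thesis by simp
qed

lemma cis_sum: "finite A \<Longrightarrow> cis (\<Sum>i\<in>A. f i) = (\<Prod>i\<in>A. cis (f i))"
  by (induction A rule: finite_induct) (auto simp: cis_mult[symmetric])

lemma integral_cis_period:
  fixes k :: int
  shows "(LINT t:{-pi..pi}|lborel. cis (t * real_of_int k)) = (if k = 0 then complex_of_real (2 * pi) else 0)"
proof (cases "k = 0")
  case True
  then show ?thesis by (simp add: set_lebesgue_integral_def scaleR_conv_of_real)
next
  case False
  have "(LINT t:{-pi..pi}|lborel. cis (t * real_of_int k)) = integral {-pi..pi} (\<lambda>t. cis (t * real_of_int k))"
    by (rule set_borel_integral_eq_integral(2)) (auto intro!: borel_integrable_atLeastAtMost' continuous_intros)
  also have "((\<lambda>t. cis (t * real_of_int k)) has_integral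
      (- \<i> / of_int k * cis (pi * real_of_int k) - (- \<i> / of_int k * cis (- pi * real_of_int k)))) {-pi..pi}"
  proof (rule fundamental_theorem_of_calculus)
    fix t assume "t \<in> {-pi..pi}"
    have "((\<lambda>t. - \<i> / of_int k * cis (t * real_of_int k)) has_vector_derivative
       (- \<i> / of_int k * (of_int k * (\<i> * cis (t * real_of_int k))))) (at t within {-pi..pi})"
      unfolding cis_conv_exp
      by (rule has_vector_derivative_real_field derivative_eq_intros refl | simp add: mult_ac)+
    then show "((\<lambda>t. - \<i> / of_int k * cis (t * real_of_int k)) has_vector_derivative
       cis (t * real_of_int k)) (at t within {-pi..pi})" using False by simp
  qed simp
  then have "integral {-pi..pi} (\<lambda>t. cis (t * real_of_int k)) = - \<i> / of_int k * (cis (pi * real_of_int k) - cis (- pi * real_of_int k))"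
    by (simp add: integral_unique right_diff_distrib)
  also have "cis (pi * real_of_int k) - cis (- pi * real_of_int k) = 0"
    by (auto simp: complex_eq_iff sin_int_times_real mult.commute[of pi] sin_times_pi_eq_0)
  finally show ?thesis using False by simp
qed

lemma integral_torus_cis:
  fixes x :: "int ^ 'n"
  shows "(LINT l:torus|lborel. cis (l \<bullet> real_vec x)) = (if x = 0 then complex_of_real ((2 * pi) ^ CARD('n)) else 0)"
proof -
  have eq: "indicat_real torus l *\<^sub>R cis (l \<bullet> real_vec x)
     = (\<Prod>i\<in>UNIV. indicator {-pi..pi} (l $ i) *\<^sub>R cis (l $ i * real_of_int (x $ i)))" for l :: "real ^ 'n"
    by (simp add: indicator_torus scaleR_conv_of_real prod.distrib inner_vec_def cis_sum)
  have "(LINT l:torus|lborel. cis (l \<bullet> real_vec x)) = (\<Prod>i\<in>UNIV. LINT t:{-pi..pi}|lborel. cis (t * real_of_int (x $ i)))"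
    unfolding set_lebesgue_integral_def eq
    by (rule integral_lborel_vec_prod)
       (auto intro!: borel_integrable_atLeastAtMost' continuous_intros simp flip: set_integrable_def)
  also have "\<dots> = (if x = 0 then complex_of_real ((2 * pi) ^ CARD('n)) else 0)"
    by (auto simp: integral_cis_period vec_eq_iff prod_constant)
  finally show ?thesis .
qed

lemma cis_torus_integrable: "set_integrable lborel torus (\<lambda>l :: real ^ 'n. cis (l \<bullet> v))"
  unfolding set_integrable_def by (rule borel_integrable_compact) (auto intro!: continuous_intros)

text \<open>Fourier inversion; the integral and the series may be exchanged since the series is dominated
  by \<open>\<bar>f\<bar>\<close> uniformly on the torus.\<close>

lemma
  fixes f :: "int ^ 'n \<Rightarrow> real"
  assumes "f summable_on UNIV"
  shows char_fun_inversion: "(LINT l:torus|lborel. char_fun f l * cis (- (l \<bullet> real_vec x))) = complex_of_real ((2 * pi) ^ CARD('n) * f x)"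
    and char_fun_set_integrable: "set_integrable lborel torus (\<lambda>l. char_fun f l * cis (- (l \<bullet> real_vec x)))"
proof -
  define F where "F = (\<lambda>(l :: real ^ 'n) y. indicator torus l *\<^sub>R (of_real (f y) * cis (l \<bullet> real_vec (y - x))))"
  have F: "(\<Sum>\<^sub>\<infinity>y. F l y) = indicator torus l *\<^sub>R (char_fun f l * cis (- (l \<bullet> real_vec x)))" for l
  proof -
    have "F l = (\<lambda>y. indicator torus l *\<^sub>R ((of_real (f y) * cis (l \<bullet> real_vec y)) * cis (- (l \<bullet> real_vec x))))"
      by (simp add: F_def fun_eq_iff inner_diff_right cis_mult mult.assoc)
    then show ?thesis
      unfolding char_fun_cis by (simp only: infsum_scaleR_right infsum_cmult_left')
  qed
  have sf: "sigma_finite_measure (lborel :: (real ^ 'n) measure)" ..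
  have i: "integrable lborel (\<lambda>l. F l y)" for y
    using cis_torus_integrable[of "real_vec (y - x)"]
    unfolding F_def set_integrable_def by (auto simp: scaleR_conv_of_real mult.left_commute intro: integrable_mult_right)
  have s: "F l abs_summable_on UNIV" for l
    unfolding F_def
    by (rule Infinite_Sum.abs_summable_on_comparison_test'[OF summable_on_real_abs[OF assms]])
       (auto simp: norm_mult indicator_def)
  have nF: "norm (F l y) = \<bar>f y\<bar> * indicator torus l" for l y
    by (auto simp: F_def norm_mult indicator_def)
  have si: "(\<lambda>y. \<integral>l. norm (F l y) \<partial>lborel) summable_on UNIV"
    unfolding nF using assms by (auto intro!: summable_on_cmult_left summable_on_real_abs)
  note I = integral_infsum[OF sf i s si, unfolded F]
  show "set_integrable lborel torus (\<lambda>l. char_fun f l * cis (- (l \<bullet> real_vec x)))"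
    using I(2) by (simp add: set_integrable_def)
  have "(LINT l:torus|lborel. char_fun f l * cis (- (l \<bullet> real_vec x))) = (\<Sum>\<^sub>\<infinity>y. \<integral>l. F l y \<partial>lborel)"
    using I(1) by (simp add: set_lebesgue_integral_def)
  also have "(\<lambda>y. \<integral>l. F l y \<partial>lborel) = (\<lambda>y. complex_of_real (f y) * (if y = x then complex_of_real ((2 * pi) ^ CARD('n)) else 0))"
  proof
    fix y
    have "(\<integral>l. F l y \<partial>lborel) = of_real (f y) * (LINT l:torus|lborel. cis (l \<bullet> real_vec (y - x)))"
      unfolding F_def set_lebesgue_integral_def by (simp add: scaleR_conv_of_real mult.left_commute)
    then show "(\<integral>l. F l y \<partial>lborel) = complex_of_real (f y) * (if y = x then complex_of_real ((2 * pi) ^ CARD('n)) else 0)"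
      unfolding integral_torus_cis by simp
  qed
  also have "(\<Sum>\<^sub>\<infinity>y. complex_of_real (f y) * (if y = x then complex_of_real ((2 * pi) ^ CARD('n)) else 0)) = (\<Sum>\<^sub>\<infinity>y\<in>{x}. of_real (f y) * complex_of_real ((2 * pi) ^ CARD('n)))"
    by (rule infsum_cong_neutral) auto
  finally show "(LINT l:torus|lborel. char_fun f l * cis (- (l \<bullet> real_vec x))) = complex_of_real ((2 * pi) ^ CARD('n) * f x)"
    by simp
qed

text \<open>Identities between convolutions can therefore be checked on the Fourier side, where they are identities
  between products.\<close>

lemma char_fun_eq_imp_eq:
  fixes f g :: "int ^ 'n \<Rightarrow> real"
  assumes "f summable_on UNIV" "g summable_on UNIV" "\<And>l. char_fun f l = char_fun g l"
  shows "f = g"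
proof
  fix x
  have "complex_of_real ((2 * pi) ^ CARD('n)) * of_real (f x) = complex_of_real ((2 * pi) ^ CARD('n)) * of_real (g x)"
    using char_fun_inversion[OF assms(1), of x] char_fun_inversion[OF assms(2), of x] assms(3) by simp
  then show "f x = g x" by simp
qed

lemma lattice_conv_commute:
  fixes f g :: "int ^ 'n \<Rightarrow> real"
  assumes "f summable_on UNIV" "g summable_on UNIV"
  shows "lattice_conv f g = lattice_conv g f"
  by (rule char_fun_eq_imp_eq) (use assms in \<open>auto simp: lattice_conv_summable char_fun_conv\<close>)

section \<open>Linear change of variables and Gaussian integrals\<close>

text \<open>A shear translates one coordinate by an amount that depends only on the others, so by Fubini it
  suffices that Lebesgue measure on the line is invariant under translations.\<close>

lemma nn_integral_lborel_shear:
  fixes g :: "real ^ 'n \<Rightarrow> ennreal"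
  assumes [measurable]: "g \<in> borel_measurable borel" and mn: "m \<noteq> n"
  shows "(\<integral>\<^sup>+x. g (x + (x $ n) *\<^sub>R axis m 1) \<partial>lborel) = (\<integral>\<^sup>+x. g x \<partial>lborel)"
proof -
  interpret product_sigma_finite "\<lambda>_ :: real ^ 'n. lborel :: real measure" ..
  let ?b = "axis m 1 :: real ^ 'n"
  define I where "I = Basis - {?b}"
  have b: "?b \<in> Basis" "?b \<notin> I" "finite I" and Basis: "Basis = insert ?b I"
    by (auto simp: I_def)
  define T where "T F = (\<Sum>b\<in>Basis. F b *\<^sub>R b)" for F :: "real ^ 'n \<Rightarrow> real"
  have [measurable]: "T \<in> (\<Pi>\<^sub>M b\<in>Basis. lborel) \<rightarrow>\<^sub>M borel"
    unfolding T_def by measurable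
  define R where "R F = (\<Sum>b\<in>I. F b *\<^sub>R b)" for F :: "real ^ 'n \<Rightarrow> real"
  have T_upd: "T (F(?b := y)) = R F + y *\<^sub>R ?b" for F y
  proof -
    have "(\<Sum>b\<in>I. (F(?b := y)) b *\<^sub>R b) = R F"
      unfolding R_def by (rule sum.cong) (use b in auto)
    then show ?thesis unfolding T_def Basis using b by simp
  qed
  have Tn: "T F $ n = F (axis n 1)" for F
  proof -
    have "T F $ n = T F \<bullet> axis n 1"
      by (simp add: inner_axis)
    also have "\<dots> = F (axis n 1)" unfolding T_def by simp
    finally show ?thesis .
  qed
  have ne: "axis n 1 \<noteq> ?b" using mn by (simp add: axis_eq_axis)
  have lb: "lborel = distr (\<Pi>\<^sub>M b\<in>Basis. lborel) borel T"
    unfolding T_def by (rule lborel_eq)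
  have "(\<integral>\<^sup>+x. g (x + (x $ n) *\<^sub>R ?b) \<partial>lborel) = (\<integral>\<^sup>+F. g (T F + (T F $ n) *\<^sub>R ?b) \<partial>(\<Pi>\<^sub>M b\<in>Basis. lborel))"
    unfolding lb by (subst nn_integral_distr) auto
  also have "\<dots> = (\<integral>\<^sup>+F. (\<integral>\<^sup>+y. g (T (F(?b := y)) + (T (F(?b := y)) $ n) *\<^sub>R ?b) \<partial>lborel) \<partial>(\<Pi>\<^sub>M b\<in>I. lborel))"
  proof -
    have [measurable]: "T \<in> (\<Pi>\<^sub>M b\<in>insert ?b I. lborel) \<rightarrow>\<^sub>M borel"
      unfolding Basis[symmetric] by measurable
    have h: "(\<lambda>x. g (x + (x $ n) *\<^sub>R ?b)) \<in> borel_measurable borel"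
      by (rule measurable_compose[OF _ assms(1)]) (intro borel_measurable_continuous_onI continuous_intros)
    have "(\<lambda>F. g (T F + (T F $ n) *\<^sub>R ?b)) \<in> borel_measurable (\<Pi>\<^sub>M b\<in>insert ?b I. lborel)"
      by (rule measurable_compose[OF _ h]) measurable
    then show ?thesis
      unfolding Basis by (intro product_nn_integral_insert b)
  qed
  also have "\<dots> = (\<integral>\<^sup>+F. (\<integral>\<^sup>+y. g (T (F(?b := y))) \<partial>lborel) \<partial>(\<Pi>\<^sub>M b\<in>I. lborel))"
  proof (rule nn_integral_cong)
    fix F :: "real ^ 'n \<Rightarrow> real"
    have "(\<lambda>y. g (R F + y *\<^sub>R ?b)) \<in> borel_measurable borel"
      by measurable
    from nn_integral_real_affine[OF this, of 1 "F (axis n 1)"]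
    have "(\<integral>\<^sup>+y. g (R F + y *\<^sub>R ?b) \<partial>lborel) = (\<integral>\<^sup>+y. g (R F + (F (axis n 1) + 1 * y) *\<^sub>R ?b) \<partial>lborel)"
      by simp
    then show "(\<integral>\<^sup>+y. g (T (F(?b := y)) + (T (F(?b := y)) $ n) *\<^sub>R ?b) \<partial>lborel) = (\<integral>\<^sup>+y. g (T (F(?b := y))) \<partial>lborel)"
      unfolding Tn using ne by (simp add: T_upd scaleR_add_left add_ac)
  qed
  also have "\<dots> = (\<integral>\<^sup>+F. g (T F) \<partial>(\<Pi>\<^sub>M b\<in>Basis. lborel))"
  proof -
    have [measurable]: "T \<in> (\<Pi>\<^sub>M b\<in>insert ?b I. lborel) \<rightarrow>\<^sub>M borel"
      unfolding Basis[symmetric] by measurable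
    show ?thesis
      unfolding Basis by (rule product_nn_integral_insert[symmetric]) (use b in auto)
  qed
  also have "\<dots> = (\<integral>\<^sup>+x. g x \<partial>lborel)"
    unfolding lb by (subst nn_integral_distr) auto
  finally show ?thesis .
qed

lemma prod_Basis_vec: "(\<Prod>b\<in>(Basis :: (real ^ 'n) set). f (x \<bullet> b)) = (\<Prod>i\<in>UNIV. f (x $ i))"
proof -
  have Basis: "(Basis :: (real ^ 'n) set) = (\<lambda>i. axis i 1) ` UNIV"
    by (auto simp: Basis_vec_def)
  have inj: "inj (\<lambda>i. axis i 1 :: real ^ 'n)"
    by (auto simp: inj_on_def axis_eq_axis)
  show ?thesis unfolding Basis by (simp add: prod.reindex[OF inj] inner_axis)
qed

lemma lborel_permute_coordinates:
  fixes \<tau> :: "'n :: finite \<Rightarrow> 'n"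
  assumes bij: "bij \<tau>"
  shows "distr lborel borel (\<lambda>x :: real ^ 'n. \<chi> i. x $ \<tau> i) = lborel"
proof (rule lborel_eqI[symmetric])
  have m: "(\<lambda>x :: real ^ 'n. \<chi> i. x $ \<tau> i) \<in> borel \<rightarrow>\<^sub>M borel"
    by (intro borel_measurable_continuous_onI continuous_intros)
  have inv: "\<tau> (inv \<tau> i) = i" "inv \<tau> (\<tau> i) = i" for i
    using bij by (auto simp: bij_def surj_f_inv_f)
  fix l u :: "real ^ 'n" assume lu: "\<And>b. b \<in> Basis \<Longrightarrow> l \<bullet> b \<le> u \<bullet> b"
  have lu': "l $ i \<le> u $ i" for i
    using lu[of "axis i 1"] by (simp add: inner_axis)
  have pre: "(\<lambda>x :: real ^ 'n. \<chi> i. x $ \<tau> i) -` box l u = box (\<chi> i. l $ inv \<tau> i) (\<chi> i. u $ inv \<tau> i)"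
    by (auto simp: mem_box_cart) (metis inv)+
  have "emeasure (distr lborel borel (\<lambda>x :: real ^ 'n. \<chi> i. x $ \<tau> i)) (box l u)
    = emeasure lborel (box (\<chi> i. l $ inv \<tau> i) (\<chi> i. u $ inv \<tau> i) :: (real ^ 'n) set)"
    using m by (subst emeasure_distr) (auto simp: pre)
  also have "\<dots> = (\<Prod>b\<in>(Basis :: (real ^ 'n) set). ((\<chi> i. u $ inv \<tau> i) - (\<chi> i. l $ inv \<tau> i)) \<bullet> b)"
    by (rule emeasure_lborel_box) (auto simp: Basis_vec_def inner_axis lu')
  also have "\<dots> = (\<Prod>i\<in>UNIV. (u - l) $ inv \<tau> i)"
    by (subst prod_Basis_vec[where f = "\<lambda>t. t"]) simp
  also have "\<dots> = (\<Prod>i\<in>UNIV. (u - l) $ i)"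
    by (rule arg_cong[where f = ennreal], rule prod.reindex_bij_betw) (rule bij_imp_bij_inv[OF bij])
  also have "\<dots> = (\<Prod>b\<in>Basis. (u - l) \<bullet> b)"
    by (subst prod_Basis_vec[where f = "\<lambda>t. t"]) simp
  finally show "emeasure (distr lborel borel (\<lambda>x :: real ^ 'n. \<chi> i. x $ \<tau> i)) (box l u) = (\<Prod>b\<in>Basis. (u - l) \<bullet> b)" .
qed simp

text \<open>Both sides are multiplicative in the matrix, so it is enough to treat diagonal matrices,
  transpositions of two coordinates and shears.\<close>

lemma nn_integral_lborel_matrix:
  fixes A :: "real ^ 'n ^ 'n" and g :: "real ^ 'n \<Rightarrow> ennreal"
  assumes "det A \<noteq> 0" "g \<in> borel_measurable borel"
  shows "(\<integral>\<^sup>+x. g x \<partial>lborel) = ennreal \<bar>det A\<bar> * (\<integral>\<^sup>+x. g (A *v x) \<partial>lborel)"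
proof -
  have meas[measurable]: "(\<lambda>x. A *v x) \<in> borel \<rightarrow>\<^sub>M borel" for A :: "real ^ 'n ^ 'n"
    by (intro borel_measurable_continuous_onI linear_continuous_on matrix_vector_mul_bounded_linear)
  define P where "P A \<longleftrightarrow> (det A \<noteq> 0 \<longrightarrow> (\<forall>g\<in>borel_measurable borel.
     (\<integral>\<^sup>+x. g x \<partial>lborel) = ennreal \<bar>det A\<bar> * (\<integral>\<^sup>+x. g (A *v x) \<partial>lborel)))" for A :: "real ^ 'n ^ 'n"
  have "P A"
  proof (rule induct_matrix_elementary_alt)
    fix A B assume AB: "P A" "P B"
    show "P (A ** B)" unfolding P_def
    proof (intro impI ballI)
      fix g :: "real ^ 'n \<Rightarrow> ennreal" assume g[measurable]: "g \<in> borel_measurable borel" and "det (A ** B) \<noteq> 0"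
      then have d: "det A \<noteq> 0" "det B \<noteq> 0" by (auto simp: det_mul)
      have 1: "(\<integral>\<^sup>+x. g x \<partial>lborel) = ennreal \<bar>det A\<bar> * (\<integral>\<^sup>+x. g (A *v x) \<partial>lborel)"
        using AB(1) d g unfolding P_def by blast
      have m: "(\<lambda>x. g (A *v x)) \<in> borel_measurable borel" by measurable
      have "(\<integral>\<^sup>+x. g (A *v x) \<partial>lborel) = ennreal \<bar>det B\<bar> * (\<integral>\<^sup>+x. g (A *v (B *v x)) \<partial>lborel)"
        using AB(2) d m unfolding P_def by blast
      with 1 show "(\<integral>\<^sup>+x. g x \<partial>lborel) = ennreal \<bar>det (A ** B)\<bar> * (\<integral>\<^sup>+x. g ((A ** B) *v x) \<partial>lborel)"
        by (simp add: det_mul abs_mult ennreal_mult matrix_vector_mul_assoc mult.assoc)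
    qed
  next
    fix A :: "real ^ 'n ^ 'n" and i assume "row i A = 0"
    then show "P A" by (simp add: P_def det_zero_row)
  next
    fix A :: "real ^ 'n ^ 'n" assume diag: "\<And>i j. i \<noteq> j \<Longrightarrow> A $ i $ j = 0"
    have dA: "det A = (\<Prod>i\<in>UNIV. A $ i $ i)" by (rule det_diagonal) (use diag in auto)
    show "P A" unfolding P_def
    proof (intro impI ballI)
      fix g :: "real ^ 'n \<Rightarrow> ennreal" assume [measurable]: "g \<in> borel_measurable borel" and d: "det A \<noteq> 0"
      have nz: "A $ i $ i \<noteq> 0" for i using d unfolding dA by (auto)
      have Av: "(A *v x) $ i = A $ i $ i * x $ i" for x i
      proof -
        have "(A *v x) $ i = (\<Sum>j\<in>UNIV. A $ i $ j * x $ j)" by (simp add: matrix_vector_mult_def)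
        also have "\<dots> = (\<Sum>j\<in>{i}. A $ i $ j * x $ j)" by (rule sum.mono_neutral_right) (use diag in auto)
        finally show ?thesis by simp
      qed
      define c where "c b = b \<bullet> (A *v b)" for b
      have c_axis: "c (axis i 1) = A $ i $ i" for i
        by (simp add: c_def inner_axis' Av)
      have c: "(0 + (\<Sum>b\<in>Basis. (c b * (x \<bullet> b)) *\<^sub>R b)) = A *v x" for x
      proof (rule euclidean_eqI)
        fix b :: "real ^ 'n" assume b: "b \<in> Basis"
        then obtain i where i: "b = axis i 1" by (auto simp: Basis_vec_def)
        have "(0 + (\<Sum>b\<in>Basis. (c b * (x \<bullet> b)) *\<^sub>R b)) \<bullet> b = c b * (x \<bullet> b)"
          using b by simp
        then show "(0 + (\<Sum>b\<in>Basis. (c b * (x \<bullet> b)) *\<^sub>R b)) \<bullet> b = (A *v x) \<bullet> b"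
          by (simp add: i inner_axis Av c_axis)
      qed
      have cnz: "c b \<noteq> 0" if "b \<in> Basis" for b using that nz by (auto simp: Basis_vec_def c_axis)
      have pc: "(\<Prod>b\<in>(Basis :: (real ^ 'n) set). \<bar>c b\<bar>) = \<bar>det A\<bar>"
      proof -
        have Basis: "(Basis :: (real ^ 'n) set) = (\<lambda>i. axis i 1) ` UNIV"
          by (auto simp: Basis_vec_def)
        have inj: "inj (\<lambda>i. axis i 1 :: real ^ 'n)"
          by (auto simp: inj_on_def axis_eq_axis)
        show ?thesis unfolding Basis by (simp add: prod.reindex[OF inj] c_axis dA abs_prod)
      qed
      have "lborel = density (distr lborel borel (\<lambda>x. A *v x)) (\<lambda>_. ennreal \<bar>det A\<bar>)"
        using lborel_affine_euclidean[of c 0] cnz unfolding c pc by blast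
      then have "(\<integral>\<^sup>+x. g x \<partial>lborel) = (\<integral>\<^sup>+x. g x \<partial>density (distr lborel borel (\<lambda>x. A *v x)) (\<lambda>_. ennreal \<bar>det A\<bar>))"
        by simp
      also have "\<dots> = ennreal \<bar>det A\<bar> * (\<integral>\<^sup>+x. g (A *v x) \<partial>lborel)"
        by (simp add: nn_integral_density nn_integral_distr nn_integral_cmult)
      finally show "(\<integral>\<^sup>+x. g x \<partial>lborel) = ennreal \<bar>det A\<bar> * (\<integral>\<^sup>+x. g (A *v x) \<partial>lborel)" .
    qed
  next
    fix m n :: 'n assume mn: "m \<noteq> n"
    define S :: "real ^ 'n ^ 'n" where "S = (\<chi> i j. mat 1 $ i $ Transposition.transpose m n j)"
    have sym: "i = Transposition.transpose m n j \<longleftrightarrow> j = Transposition.transpose m n i" for i j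
      by (metis transpose_involutory)
    have Sv: "S *v x = (\<chi> i. x $ Transposition.transpose m n i)" for x
    proof -
      have "(S *v x) $ i = x $ Transposition.transpose m n i" for i
      proof -
        have "(S *v x) $ i = (\<Sum>j\<in>UNIV. (if i = Transposition.transpose m n j then 1 else 0) * x $ j)"
          by (simp add: S_def matrix_vector_mult_def mat_def)
        also have "\<dots> = (\<Sum>j\<in>UNIV. (if j = Transposition.transpose m n i then x $ j else 0))"
          by (rule sum.cong) (use sym in auto)
        also have "\<dots> = x $ Transposition.transpose m n i" by simp
        finally show ?thesis .
      qed
      then show ?thesis by (simp add: vec_eq_iff)
    qed
    have "S ** S = mat 1"
    proof -
      have "(S ** S) *v x = mat 1 *v x" for x
        by (simp add: matrix_vector_mul_assoc[symmetric] Sv vec_eq_iff)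
      then show ?thesis by (simp add: matrix_eq)
    qed
    then have "det S * det S = 1" by (metis det_I det_mul)
    then have "\<bar>det S\<bar> = 1" by (simp add: abs_square_eq_1 flip: power2_eq_square)
    moreover have "(\<integral>\<^sup>+x. g (S *v x) \<partial>lborel) = (\<integral>\<^sup>+x. g x \<partial>lborel)" if [measurable]: "g \<in> borel_measurable borel" for g
    proof -
      have "bij (Transposition.transpose m n)" by simp
      from lborel_permute_coordinates[OF this]
      have "(\<integral>\<^sup>+x. g x \<partial>lborel) = (\<integral>\<^sup>+x. g x \<partial>distr lborel borel (\<lambda>x. S *v x))"
        by (simp add: Sv)
      also have "\<dots> = (\<integral>\<^sup>+x. g (S *v x) \<partial>lborel)" by (rule nn_integral_distr) auto
      finally show ?thesis by simp
    qed
    ultimately have "P S" by (simp add: P_def)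
    then show "P (\<chi> i j. mat 1 $ i $ Transposition.transpose m n j)" by (simp add: S_def)
  next
    fix m n :: 'n assume mn: "m \<noteq> n"
    define S :: "real ^ 'n ^ 'n" where "S = (\<chi> i j. of_bool (i = m \<and> j = n \<or> i = j))"
    have S_row: "S = (\<chi> k. if k = m then row m (mat 1) + 1 *s row n (mat 1) else row k (mat 1))"
      using mn by (auto simp: S_def vec_eq_iff row_def mat_def)
    have "det S = det (mat 1 :: real ^ 'n ^ 'n)"
      unfolding S_row by (rule det_row_operation[OF mn])
    then have dS: "det S = 1" by (simp only: det_I)
    have Sv: "S *v x = x + (x $ n) *\<^sub>R axis m 1" for x
    proof -
      have "S *v x = (\<chi> i. row i S \<bullet> x)" by (simp add: matrix_vector_mult_def inner_vec_def row_def vec_eq_iff)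
      also have "\<dots> = x + (x $ n) *\<^sub>R axis m 1"
        unfolding S_row
        by (auto simp: vec_eq_iff row_def mat_def inner_vec_def axis_def distrib_right sum.distrib if_distrib[of "\<lambda>t. t * _"] cong: if_cong)
      finally show ?thesis .
    qed
    have "P S" using nn_integral_lborel_shear[OF _ mn] by (simp add: P_def dS Sv)
    then show "P (\<chi> i j. of_bool (i = m \<and> j = n \<or> i = j))" by (simp add: S_def)
  qed
  then show ?thesis using assms unfolding P_def by blast
qed

lemma lborel_matrix:
  fixes A :: "real ^ 'n ^ 'n"
  assumes "det A \<noteq> 0"
  shows "lborel = density (distr lborel borel (\<lambda>x. A *v x)) (\<lambda>_. ennreal \<bar>det A\<bar>)"
proof (rule measure_eqI)
  have meas[measurable]: "(\<lambda>x. A *v x) \<in> borel \<rightarrow>\<^sub>M borel"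
    by (intro borel_measurable_continuous_onI linear_continuous_on matrix_vector_mul_bounded_linear)
  fix X :: "(real ^ 'n) set" assume "X \<in> sets lborel"
  then have X[measurable]: "X \<in> sets borel" by simp
  have "emeasure lborel X = (\<integral>\<^sup>+x. indicator X x \<partial>lborel)" by simp
  also have "\<dots> = ennreal \<bar>det A\<bar> * (\<integral>\<^sup>+x. indicator X (A *v x) \<partial>lborel)"
    by (rule nn_integral_lborel_matrix[OF assms]) simp
  also have "\<dots> = (\<integral>\<^sup>+x. indicator X x \<partial>density (distr lborel borel (\<lambda>x. A *v x)) (\<lambda>_. ennreal \<bar>det A\<bar>))"
    by (simp add: nn_integral_density nn_integral_distr nn_integral_cmult del: nn_integral_indicator)
  also have "\<dots> = emeasure (density (distr lborel borel (\<lambda>x. A *v x)) (\<lambda>_. ennreal \<bar>det A\<bar>)) X"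
    by simp
  finally show "emeasure lborel X = emeasure (density (distr lborel borel (\<lambda>x. A *v x)) (\<lambda>_. ennreal \<bar>det A\<bar>)) X" .
qed simp

lemma
  fixes A :: "real ^ 'n ^ 'n" and f :: "real ^ 'n \<Rightarrow> 'b :: {banach, second_countable_topology}"
  assumes "det A \<noteq> 0" and [measurable]: "f \<in> borel_measurable borel"
  shows integral_lborel_matrix: "(\<integral>x. f x \<partial>lborel) = \<bar>det A\<bar> *\<^sub>R (\<integral>x. f (A *v x) \<partial>lborel)"
    and integrable_lborel_matrix: "integrable lborel f \<longleftrightarrow> integrable lborel (\<lambda>x. f (A *v x))"
proof -
  have [measurable]: "(\<lambda>x. A *v x) \<in> borel \<rightarrow>\<^sub>M borel"
    by (intro borel_measurable_continuous_onI linear_continuous_on matrix_vector_mul_bounded_linear)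
  show "(\<integral>x. f x \<partial>lborel) = \<bar>det A\<bar> *\<^sub>R (\<integral>x. f (A *v x) \<partial>lborel)"
    by (subst lborel_matrix[OF assms(1)]) (simp add: integral_density integral_distr)
  have "integrable lborel f \<longleftrightarrow> integrable (density (distr lborel borel (\<lambda>x. A *v x)) (\<lambda>_. ennreal \<bar>det A\<bar>)) f"
    using lborel_matrix[OF assms(1)] by simp
  also have "\<dots> \<longleftrightarrow> integrable lborel (\<lambda>x. f (A *v x))"
  proof
    assume "integrable (density (distr lborel borel (\<lambda>x. A *v x)) (\<lambda>_. ennreal \<bar>det A\<bar>)) f"
    then have i: "integrable lborel (\<lambda>x. \<bar>det A\<bar> *\<^sub>R f (A *v x))"
      by (simp add: integrable_density integrable_distr_eq)
    have "integrable lborel (\<lambda>x. (1 / \<bar>det A\<bar>) *\<^sub>R (\<bar>det A\<bar> *\<^sub>R f (A *v x)))"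
      by (rule integrable_scaleR_right, rule i)
    then show "integrable lborel (\<lambda>x. f (A *v x))"
      using assms(1) by (simp only: scaleR_scaleR) simp
  qed (simp add: integrable_density integrable_distr_eq)
  finally show "integrable lborel f \<longleftrightarrow> integrable lborel (\<lambda>x. f (A *v x))" .
qed

lemma
  fixes f :: "real ^ 'n \<Rightarrow> 'b :: {banach, second_countable_topology}"
  assumes "c > 0" and [measurable]: "f \<in> borel_measurable borel"
  shows integral_lborel_scale: "(\<integral>x. f x \<partial>lborel) = (c ^ CARD('n)) *\<^sub>R (\<integral>x. f (c *\<^sub>R x) \<partial>lborel)"
    and integrable_lborel_scale: "integrable lborel f \<longleftrightarrow> integrable lborel (\<lambda>x. f (c *\<^sub>R x))"
proof -
  have eq: "(\<chi> i j. if i = j then c else 0) *v x = c *\<^sub>R x" for x :: "real ^ 'n"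
    by (simp add: vec_eq_iff matrix_vector_mult_def if_distrib[of "\<lambda>t. t * _"] cong: if_cong)
  have det: "det (\<chi> i j. if i = j then c else 0 :: real ^ 'n ^ 'n) = c ^ CARD('n)"
    by (subst det_diagonal) simp_all
  show "(\<integral>x. f x \<partial>lborel) = (c ^ CARD('n)) *\<^sub>R (\<integral>x. f (c *\<^sub>R x) \<partial>lborel)"
    using integral_lborel_matrix[of "\<chi> i j. if i = j then c else 0" f] assms by (simp add: det eq)
  show "integrable lborel f \<longleftrightarrow> integrable lborel (\<lambda>x. f (c *\<^sub>R x))"
    using integrable_lborel_matrix[of "\<chi> i j. if i = j then c else 0" f] assms by (simp add: det eq)
qed

lemma
  shows integral_gaussian_cis: "(\<integral>t. exp (- t\<^sup>2 / 2) *\<^sub>R cis (t * s) \<partial>lborel) = complex_of_real (sqrt (2 * pi) * exp (- s\<^sup>2 / 2))"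
    and integrable_gaussian_cis: "integrable lborel (\<lambda>t. exp (- t\<^sup>2 / 2) *\<^sub>R cis (t * s))"
proof -
  have i: "integrable lborel (\<lambda>t :: real. exp (- t\<^sup>2 / 2))"
    using integrable_mult_right[OF integrable_std_normal_moment[of 0], of "sqrt (2 * pi)"]
    by (simp add: std_normal_density_def)
  show "integrable lborel (\<lambda>t. exp (- t\<^sup>2 / 2) *\<^sub>R cis (t * s))"
    by (rule Bochner_Integration.integrable_bound[OF i])
       (auto intro!: borel_measurable_continuous_onI continuous_intros)
  have "complex_of_real (exp (- s\<^sup>2 / 2)) = char std_normal_distribution s"
    by (simp add: char_std_normal_distribution)
  also have "\<dots> = (\<integral>t. std_normal_density t *\<^sub>R exp (\<i> * complex_of_real (s * t)) \<partial>lborel)"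
    unfolding char_def by (subst integral_density) (auto simp: normal_density_nonneg mult_ac)
  also have "\<dots> = (\<integral>t. (1 / sqrt (2 * pi)) *\<^sub>R (exp (- t\<^sup>2 / 2) *\<^sub>R cis (t * s)) \<partial>lborel)"
    by (simp add: std_normal_density_def cis_conv_exp mult_ac)
  also have "\<dots> = (1 / sqrt (2 * pi)) *\<^sub>R (\<integral>t. exp (- t\<^sup>2 / 2) *\<^sub>R cis (t * s) \<partial>lborel)"
    by (rule integral_scaleR_right)
  finally show "(\<integral>t. exp (- t\<^sup>2 / 2) *\<^sub>R cis (t * s) \<partial>lborel) = complex_of_real (sqrt (2 * pi) * exp (- s\<^sup>2 / 2))"
    by (simp add: scaleR_conv_of_real field_simps)
qed

lemma
  fixes z :: "real ^ 'n"
  shows integral_std_gaussian_vec: "(\<integral>t. exp (- (t \<bullet> t) / 2) *\<^sub>R cis (t \<bullet> z) \<partial>lborel)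
     = complex_of_real ((2 * pi) powr (real CARD('n) / 2) * exp (- (z \<bullet> z) / 2))"
    and integrable_std_gaussian_vec: "integrable lborel (\<lambda>t :: real ^ 'n. exp (- (t \<bullet> t) / 2) *\<^sub>R cis (t \<bullet> z))"
proof -
  have eq: "exp (- (t \<bullet> t) / 2) *\<^sub>R cis (t \<bullet> z) = (\<Prod>i\<in>UNIV. exp (- (t $ i)\<^sup>2 / 2) *\<^sub>R cis (t $ i * z $ i))" for t :: "real ^ 'n"
  proof -
    have "exp (- (t \<bullet> t) / 2) = (\<Prod>i\<in>UNIV. exp (- (t $ i)\<^sup>2 / 2))"
      by (simp add: inner_vec_def exp_sum[symmetric] sum_negf sum_divide_distrib power2_eq_square)
    then show ?thesis
      by (simp add: scaleR_conv_of_real prod.distrib inner_vec_def cis_sum)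
  qed
  show "integrable lborel (\<lambda>t :: real ^ 'n. exp (- (t \<bullet> t) / 2) *\<^sub>R cis (t \<bullet> z))"
    unfolding eq by (rule integrable_lborel_vec_prod) (rule integrable_gaussian_cis)
  have "(\<integral>t. exp (- (t \<bullet> t) / 2) *\<^sub>R cis (t \<bullet> z) \<partial>lborel) = (\<Prod>i\<in>UNIV. complex_of_real (sqrt (2 * pi) * exp (- (z $ i)\<^sup>2 / 2)))"
    unfolding eq by (subst integral_lborel_vec_prod[OF integrable_gaussian_cis], simp only: integral_gaussian_cis)
  also have "\<dots> = complex_of_real (sqrt (2 * pi) ^ CARD('n) * exp (- (z \<bullet> z) / 2))"
    by (simp add: prod.distrib inner_vec_def exp_sum[symmetric] sum_negf sum_divide_distrib power2_eq_square flip: of_real_prod)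
  also have "sqrt (2 * pi) ^ CARD('n) = (2 * pi) powr (real CARD('n) / 2)"
    by (simp add: powr_half_sqrt[symmetric] powr_realpow[symmetric] powr_powr)
  finally show "(\<integral>t. exp (- (t \<bullet> t) / 2) *\<^sub>R cis (t \<bullet> z) \<partial>lborel)
     = complex_of_real ((2 * pi) powr (real CARD('n) / 2) * exp (- (z \<bullet> z) / 2))" .
qed

lemma positive_definite_sym:
  assumes "positive_definite B"
  shows "x \<bullet> (B *v y) = y \<bullet> (B *v x)"
proof -
  have "x \<bullet> (B *v y) = (x v* B) \<bullet> y" by (simp add: dot_lmul_matrix)
  also have "x v* B = transpose B *v x" by simp
  also have "transpose B = B" using assms by (simp add: positive_definite_def)
  finally show ?thesis by (simp add: inner_commute)
qed

text \<open>Gram-Schmidt for the inner product \<open>x \<bullet> (B *v y)\<close>.\<close>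

lemma positive_definite_orthonormal_family:
  fixes B :: "real ^ 'n ^ 'n" and S :: "'n set"
  assumes pd: "positive_definite B" and "finite S"
  shows "\<exists>v. \<forall>i\<in>S. \<forall>j\<in>S. v i \<bullet> (B *v v j) = of_bool (i = j)"
  using \<open>finite S\<close>
proof (induction S rule: finite_induct)
  case (insert k S)
  then obtain v where v: "\<And>i j. i \<in> S \<Longrightarrow> j \<in> S \<Longrightarrow> v i \<bullet> (B *v v j) = of_bool (i = j)" by blast
  have "dim (span (v ` S)) \<le> card (v ` S)"
    by (simp add: dim_le_card' insert.hyps)
  also have "\<dots> \<le> card S" using insert.hyps by (intro card_image_le)
  also have "\<dots> < card (insert k S)" using insert.hyps by simp
  also have "\<dots> \<le> CARD('n)" by (intro card_mono) auto
  finally have "span (v ` S) \<noteq> UNIV" by (metis DIM_cart DIM_real dim_UNIV mult.right_neutral less_irrefl)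
  then obtain w where w: "w \<notin> span (v ` S)" by blast
  define w' where "w' = w - (\<Sum>i\<in>S. (v i \<bullet> (B *v w)) *\<^sub>R v i)"
  have "(\<Sum>i\<in>S. (v i \<bullet> (B *v w)) *\<^sub>R v i) \<in> span (v ` S)"
    by (intro span_sum span_scale span_base) auto
  with w have "w' \<noteq> 0" unfolding w'_def by auto
  then have r: "w' \<bullet> (B *v w') > 0" using pd by (auto simp: positive_definite_def)
  have orth: "v j \<bullet> (B *v w') = 0" if "j \<in> S" for j
  proof -
    have "v j \<bullet> (B *v w') = w' \<bullet> (B *v v j)" by (rule positive_definite_sym[OF pd])
    also have "\<dots> = w \<bullet> (B *v v j) - (\<Sum>i\<in>S. (v i \<bullet> (B *v w)) * (v i \<bullet> (B *v v j)))"
      by (simp add: w'_def inner_diff_left inner_sum_left)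
    also have "(\<Sum>i\<in>S. (v i \<bullet> (B *v w)) * (v i \<bullet> (B *v v j))) = (\<Sum>i\<in>S. if i = j then v i \<bullet> (B *v w) else 0)"
      by (rule sum.cong) (use v that in auto)
    also have "\<dots> = v j \<bullet> (B *v w)" using that insert.hyps by simp
    also have "w \<bullet> (B *v v j) = v j \<bullet> (B *v w)" by (rule positive_definite_sym[OF pd])
    finally show ?thesis by simp
  qed
  define r where "r = w' \<bullet> (B *v w')"
  have rp: "r > 0" using r by (simp add: r_def)
  define u where "u = v(k := (1 / sqrt r) *\<^sub>R w')"
  have "u i \<bullet> (B *v u j) = of_bool (i = j)" if ij: "i \<in> insert k S" "j \<in> insert k S" for i j
  proof -
    have sc: "B *v (c *\<^sub>R x) = c *\<^sub>R (B *v x)" for c x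
      by (simp add: scaleR_matrix_vector_assoc matrix_vector_mult_scaleR)
    have kk: "((1 / sqrt r) *\<^sub>R w') \<bullet> (B *v ((1 / sqrt r) *\<^sub>R w')) = 1"
      using rp by (simp add: sc flip: r_def)
    have kj: "((1 / sqrt r) *\<^sub>R w') \<bullet> (B *v v j) = 0" if "j \<in> S" for j
      using orth[OF that] positive_definite_sym[OF pd, of w' "v j"] by simp
    have jk: "v j \<bullet> (B *v ((1 / sqrt r) *\<^sub>R w')) = 0" if "j \<in> S" for j
      using orth[OF that] by (simp add: sc)
    show ?thesis
      using ij insert.hyps v kk kj jk by (cases "i = k"; cases "j = k") (auto simp: u_def)
  qed
  then show ?case by blast
qed simp

lemma positive_definite_congruent_mat_1:
  fixes B :: "real ^ 'n ^ 'n"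
  assumes pd: "positive_definite B"
  obtains A :: "real ^ 'n ^ 'n" where "transpose A ** B ** A = mat 1"
proof -
  obtain v :: "'n \<Rightarrow> real ^ 'n" where v: "\<And>i j. v i \<bullet> (B *v v j) = of_bool (i = j)"
    using positive_definite_orthonormal_family[OF pd finite[of UNIV]] by blast
  define A :: "real ^ 'n ^ 'n" where "A = (\<chi> i j. v j $ i)"
  have "(transpose A ** B ** A) $ i $ j = v i \<bullet> (B *v v j)" for i j
    unfolding matrix_mul_assoc[symmetric]
    by (simp add: matrix_matrix_mult_def A_def transpose_def inner_vec_def matrix_vector_mult_def)
  then have "transpose A ** B ** A = mat 1" by (simp add: vec_eq_iff v mat_def)
  then show ?thesis by (rule that)
qed

text \<open>The substitution \<open>t = A *v s\<close> with \<open>transpose A ** B ** A = mat 1\<close> turns the quadratic form into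
  \<open>s \<bullet> s\<close>. That identity also says that \<open>A ** transpose A\<close> is the inverse of \<open>B\<close> and that
  \<open>(det A)\<^sup>2 det B = 1\<close>, which identifies the exponent and the constant.\<close>

lemma
  fixes B :: "real ^ 'n ^ 'n"
  assumes pd: "positive_definite B"
  shows positive_definite_det: "det B > 0"
    and integral_gaussian_vec: "(\<integral>t. exp (- (t \<bullet> (B *v t)) / 2) *\<^sub>R cis (t \<bullet> z) \<partial>lborel)
     = complex_of_real ((2 * pi) powr (real CARD('n) / 2) / sqrt (det B) * exp (- (z \<bullet> (matrix_inv B *v z)) / 2))"
    and integrable_gaussian_vec: "integrable lborel (\<lambda>t. exp (- (t \<bullet> (B *v t)) / 2) *\<^sub>R cis (t \<bullet> z))"
proof -
  obtain A :: "real ^ 'n ^ 'n" where A: "transpose A ** B ** A = mat 1"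
    using positive_definite_congruent_mat_1[OF pd] by blast
  have "det (transpose A ** B ** A) = 1" by (simp add: A)
  then have d: "det A * det A * det B = 1" by (simp add: det_mul mult_ac)
  then have dA: "det A \<noteq> 0" by auto
  have dB: "det B = 1 / (det A)\<^sup>2" using d dA by (simp add: field_simps power2_eq_square)
  then show "det B > 0" using dA by simp
  have sq: "\<bar>det A\<bar> = 1 / sqrt (det B)" by (simp add: dB real_sqrt_divide)
  have "B ** A ** transpose A = mat 1"
    using A by (metis matrix_left_right_inverse matrix_mul_assoc)
  then have BA: "B ** (A ** transpose A) = mat 1" by (simp add: matrix_mul_assoc)
  then have "A ** transpose A ** B = mat 1" by (metis matrix_left_right_inverse)
  then have inv: "matrix_inv B = A ** transpose A"
  proof -
    have "B ** matrix_inv B = mat 1 \<and> matrix_inv B ** B = mat 1"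
      unfolding matrix_inv_def by (rule someI[of _ "A ** transpose A"]) (use BA \<open>A ** transpose A ** B = mat 1\<close> in blast)
    then show ?thesis using BA by (metis matrix_mul_assoc matrix_mul_lid matrix_mul_rid)
  qed
  have adj: "(A *v s) \<bullet> y = s \<bullet> (transpose A *v y)" for s y
    by (metis dot_lmul_matrix transpose_matrix_vector transpose_transpose)
  have q: "(A *v s) \<bullet> (B *v (A *v s)) = s \<bullet> s" for s
    by (simp add: adj matrix_vector_mul_assoc A matrix_mul_assoc)
  have qz: "z \<bullet> (matrix_inv B *v z) = (transpose A *v z) \<bullet> (transpose A *v z)" for z
    by (simp add: inv adj matrix_vector_mul_assoc[symmetric] inner_commute[of z])
  have meas: "(\<lambda>t. exp (- (t \<bullet> (B *v t)) / 2) *\<^sub>R cis (t \<bullet> z)) \<in> borel_measurable borel"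
    by (intro borel_measurable_continuous_onI continuous_intros matrix_vector_mult_linear_continuous_on) auto
  show "integrable lborel (\<lambda>t. exp (- (t \<bullet> (B *v t)) / 2) *\<^sub>R cis (t \<bullet> z))"
    by (subst integrable_lborel_matrix[OF dA meas], unfold q, unfold adj) (rule integrable_std_gaussian_vec)
  show "(\<integral>t. exp (- (t \<bullet> (B *v t)) / 2) *\<^sub>R cis (t \<bullet> z) \<partial>lborel)
     = complex_of_real ((2 * pi) powr (real CARD('n) / 2) / sqrt (det B) * exp (- (z \<bullet> (matrix_inv B *v z)) / 2))"
    by (subst integral_lborel_matrix[OF dA meas], unfold q, unfold adj, subst integral_std_gaussian_vec)
       (simp add: sq qz scaleR_conv_of_real)
qed

lemma
  fixes a :: real
  assumes "a > 0"
  shows integral_gaussian_norm: "(\<integral>t. exp (- a * (norm (t :: real ^ 'n))\<^sup>2 / 2) \<partial>lborel) = (2 * pi / a) powr (real CARD('n) / 2)"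
    and integrable_gaussian_norm: "integrable lborel (\<lambda>t :: real ^ 'n. exp (- a * (norm t)\<^sup>2 / 2))"
proof -
  have sa: "sqrt a > 0" using assms by simp
  have i1: "integrable lborel (\<lambda>t :: real ^ 'n. complex_of_real (exp (- (norm t)\<^sup>2 / 2)))"
    using integrable_std_gaussian_vec[of 0] by (simp add: scaleR_conv_of_real dot_square_norm)
  then have i: "integrable lborel (\<lambda>t :: real ^ 'n. exp (- (norm t)\<^sup>2 / 2))"
    by (simp only: complex_of_real_integrable_eq)
  have meas: "(\<lambda>t :: real ^ 'n. exp (- (norm t)\<^sup>2 / 2)) \<in> borel_measurable borel"
    by measurable
  have eq: "exp (- (norm (sqrt a *\<^sub>R t))\<^sup>2 / 2) = exp (- a * (norm t)\<^sup>2 / 2)" for t :: "real ^ 'n"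
    using assms by (simp add: power_mult_distrib)
  show "integrable lborel (\<lambda>t :: real ^ 'n. exp (- a * (norm t)\<^sup>2 / 2))"
    using i integrable_lborel_scale[OF sa meas] unfolding eq by simp
  have "complex_of_real (\<integral>t. exp (- (norm (t :: real ^ 'n))\<^sup>2 / 2) \<partial>lborel) = complex_of_real ((2 * pi) powr (real CARD('n) / 2))"
    using integral_std_gaussian_vec[of "0 :: real ^ 'n"]
    by (simp add: scaleR_conv_of_real dot_square_norm)
  then have "(2 * pi) powr (real CARD('n) / 2) = (\<integral>t. exp (- (norm (t :: real ^ 'n))\<^sup>2 / 2) \<partial>lborel)"
    by (simp only: of_real_eq_iff)
  also have "\<dots> = sqrt a ^ CARD('n) * (\<integral>t. exp (- a * (norm (t :: real ^ 'n))\<^sup>2 / 2) \<partial>lborel)"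
    by (subst integral_lborel_scale[OF sa meas], unfold eq) simp
  also have "sqrt a ^ CARD('n) = a powr (real CARD('n) / 2)"
    using assms by (simp add: powr_half_sqrt[symmetric] powr_realpow[symmetric] powr_powr)
  finally show "(\<integral>t. exp (- a * (norm (t :: real ^ 'n))\<^sup>2 / 2) \<partial>lborel) = (2 * pi / a) powr (real CARD('n) / 2)"
    using assms by (simp add: powr_divide field_simps)
qed

lemma power_times_gaussian_bound:
  fixes y :: real
  assumes "y \<ge> 0"
  shows "y ^ k * exp (- y\<^sup>2 / 2) \<le> fact k * exp (1 / 2)"
proof -
  have "y ^ k / fact k \<le> exp y"
  proof -
    have "(\<Sum>i\<in>{k}. y ^ i /\<^sub>R fact i) \<le> (\<Sum>i. y ^ i /\<^sub>R fact i)"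
      by (rule sum_le_suminf) (use assms summable_exp_generic[of y] in auto)
    then show ?thesis by (simp add: exp_def divide_inverse mult.commute)
  qed
  moreover have "exp y \<le> exp (1 / 2 + y\<^sup>2 / 2)"
    using zero_le_power2[of "y - 1"] by (simp add: power2_eq_square algebra_simps)
  ultimately have "y ^ k \<le> fact k * exp (1 / 2 + y\<^sup>2 / 2)" 
    by (smt (verit) divide_le_eq fact_gt_zero mult.commute)
  then have "y ^ k * exp (- y\<^sup>2 / 2) \<le> fact k * exp (1 / 2 + y\<^sup>2 / 2) * exp (- y\<^sup>2 / 2)"
    by (intro mult_right_mono) auto
  also have "\<dots> = fact k * exp (1 / 2)" by (simp flip: exp_add)
  finally show ?thesis .
qed

lemma norm_le_on_torus: "l \<in> torus \<Longrightarrow> norm (l :: real ^ 'n) \<le> real CARD('n) * pi"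
  using norm_le_l1_cart[of l] sum_bounded_above[of UNIV "\<lambda>i. \<bar>l $ i\<bar>" pi]
  by (force simp: mem_torus)

text \<open>Scaling \<open>l\<close> by \<open>\<surd>m\<close> shows the exponent; the shift from \<open>m\<close> to \<open>m + 1\<close> only costs a constant
  because the torus is bounded.\<close>

lemma torus_gaussian_moment_bound:
  fixes c :: real
  assumes "c > 0"
  obtains C where "C \<ge> 0" "\<And>m. (LINT l:torus|lborel. norm (l :: real ^ 'n) ^ k * exp (- c * real m * (norm l)\<^sup>2))
      \<le> C * real (Suc m) powr (- (real CARD('n) + real k) / 2)"
proof -
  define R where "R = real CARD('n) * pi"
  define K where "K = exp (c * R\<^sup>2) * (fact k * exp (1 / 2)) * c powr (- real k / 2)"
  have K: "K \<ge> 0" by (simp add: K_def)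
  define C where "C = K * (2 * pi / c) powr (real CARD('n) / 2)"
  have "(LINT l:torus|lborel. norm (l :: real ^ 'n) ^ k * exp (- c * real m * (norm l)\<^sup>2))
      \<le> C * real (Suc m) powr (- (real CARD('n) + real k) / 2)" for m
  proof -
    define M where "M = real (Suc m)"
    have M: "M \<ge> 1" by (simp add: M_def)
    define h where "h l = K * M powr (- real k / 2) * exp (- (c * M) * (norm l)\<^sup>2 / 2)" for l :: "real ^ 'n"
    have bound: "norm l ^ k * exp (- c * real m * (norm l)\<^sup>2) \<le> h l" if l: "l \<in> torus" for l :: "real ^ 'n"
    proof -
      define y where "y = sqrt (c * M) * norm l"
      have y: "y \<ge> 0" "y\<^sup>2 = c * M * (norm l)\<^sup>2" using assms M by (auto simp: y_def power_mult_distrib)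
      have cM: "sqrt (c * M) ^ k = c powr (real k / 2) * M powr (real k / 2)"
        using assms M by (simp add: powr_half_sqrt[symmetric] powr_realpow[symmetric] powr_powr powr_mult)
      have nk: "norm l ^ k = y ^ k * (c powr (- real k / 2) * M powr (- real k / 2))"
      proof -
        have "y ^ k = c powr (real k / 2) * M powr (real k / 2) * norm l ^ k"
          by (simp only: y_def power_mult_distrib cM)
        then show ?thesis using assms M by (simp add: powr_minus field_simps)
      qed
      have "exp (- c * real m * (norm l)\<^sup>2) = exp (- y\<^sup>2) * exp (c * (norm l)\<^sup>2)"
        unfolding y(2) M_def by (simp add: algebra_simps flip: exp_add)
      also have "\<dots> \<le> exp (- y\<^sup>2) * exp (c * R\<^sup>2)"
        using norm_le_on_torus[OF l] assms by (intro mult_left_mono) (auto simp: R_def intro!: power_mono mult_left_mono)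
      finally have e: "exp (- c * real m * (norm l)\<^sup>2) \<le> exp (- y\<^sup>2) * exp (c * R\<^sup>2)" .
      have "norm l ^ k * exp (- c * real m * (norm l)\<^sup>2) \<le> norm l ^ k * (exp (- y\<^sup>2) * exp (c * R\<^sup>2))"
        by (intro mult_left_mono e) auto
      also have "exp (- y\<^sup>2) = exp (- y\<^sup>2 / 2) * exp (- y\<^sup>2 / 2)" by (simp flip: exp_add)
      also have "norm l ^ k * (exp (- y\<^sup>2 / 2) * exp (- y\<^sup>2 / 2) * exp (c * R\<^sup>2))
         = (y ^ k * exp (- y\<^sup>2 / 2)) * (exp (c * R\<^sup>2) * (c powr (- real k / 2) * M powr (- real k / 2)) * exp (- y\<^sup>2 / 2))"
        unfolding nk by (simp add: mult_ac)
      also have "\<dots> \<le> (fact k * exp (1 / 2)) * (exp (c * R\<^sup>2) * (c powr (- real k / 2) * M powr (- real k / 2)) * exp (- y\<^sup>2 / 2))"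
        by (intro mult_right_mono power_times_gaussian_bound y) auto
      also have "\<dots> = h l" unfolding h_def K_def y(2) by (simp add: mult_ac)
      finally show ?thesis .
    qed
    have cM: "c * M > 0" using assms M by simp
    have ih: "integrable lborel h" unfolding h_def
      by (intro integrable_mult_right integrable_gaussian_norm cM)
    have "(LINT l:torus|lborel. norm (l :: real ^ 'n) ^ k * exp (- c * real m * (norm l)\<^sup>2)) \<le> (\<integral>l. h l \<partial>lborel)"
      unfolding set_lebesgue_integral_def
    proof (rule integral_mono[OF _ ih])
      show "integrable lborel (\<lambda>x :: real ^ 'n. indicat_real torus x *\<^sub>R (norm x ^ k * exp (- c * real m * (norm x)\<^sup>2)))"
        by (rule borel_integrable_compact) (auto intro!: continuous_intros)
      show "indicat_real torus l *\<^sub>R (norm l ^ k * exp (- c * real m * (norm l)\<^sup>2)) \<le> h l" for l :: "real ^ 'n"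
        using bound[of l] K by (auto simp: indicator_def h_def)
    qed
    also have "\<dots> = K * M powr (- real k / 2) * (2 * pi / (c * M)) powr (real CARD('n) / 2)"
      unfolding h_def by (subst integral_mult_right_zero, subst integral_gaussian_norm[OF cM]) simp
    also have "(2 * pi / (c * M)) powr (real CARD('n) / 2) = (2 * pi / c) powr (real CARD('n) / 2) * M powr (- real CARD('n) / 2)"
      using assms M by (simp add: powr_divide powr_mult powr_minus field_simps)
    also have "K * M powr (- real k / 2) * ((2 * pi / c) powr (real CARD('n) / 2) * M powr (- real CARD('n) / 2))
      = C * (M powr (- real CARD('n) / 2) * M powr (- real k / 2))" by (simp add: C_def mult_ac)
    also have "M powr (- real CARD('n) / 2) * M powr (- real k / 2) = M powr (- (real CARD('n) + real k) / 2)"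
      by (simp add: powr_add[symmetric] diff_divide_distrib)
    finally show ?thesis by (simp add: M_def)
  qed
  moreover have "C \<ge> 0" using K by (simp add: C_def)
  ultimately show ?thesis using that by blast
qed

section \<open>Moments and the size of a Fourier series near the origin\<close>

definition has_moment :: "nat \<Rightarrow> (int ^ 'n \<Rightarrow> real) \<Rightarrow> bool" where
  "has_moment k f \<longleftrightarrow> f summable_on UNIV \<and> (\<lambda>x. norm (real_vec x) ^ k * f x) summable_on UNIV"

definition abs_moment :: "nat \<Rightarrow> (int ^ 'n \<Rightarrow> real) \<Rightarrow> real" where
  "abs_moment k f = (\<Sum>\<^sub>\<infinity>x. norm (real_vec x) ^ k * \<bar>f x\<bar>)"

lemma has_moment_summable: "has_moment k f \<Longrightarrow> f summable_on UNIV"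
  by (simp add: has_moment_def)

lemma has_moment_abs_summable: "has_moment k f \<Longrightarrow> (\<lambda>x. norm (real_vec x) ^ k * \<bar>f x\<bar>) summable_on UNIV"
  using summable_on_real_abs[of "\<lambda>x. norm (real_vec x) ^ k * f x" UNIV] by (simp add: has_moment_def abs_mult)

lemma abs_moment_nonneg: "abs_moment k f \<ge> 0"
  unfolding abs_moment_def by (intro infsum_nonneg) auto

lemma has_moment_mono:
  assumes "has_moment k f" "j \<le> k"
  shows "has_moment j f"
  unfolding has_moment_def
proof (intro conjI)
  show f: "f summable_on UNIV" using assms by (simp add: has_moment_def)
  have "(\<lambda>x. \<bar>f x\<bar> + norm (real_vec x) ^ k * \<bar>f x\<bar>) summable_on UNIV"
    by (intro summable_on_add summable_on_real_abs f has_moment_abs_summable assms)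
  then show "(\<lambda>x. norm (real_vec x) ^ j * f x) summable_on UNIV"
  proof (rule summable_on_real_comparison)
    fix x :: "int ^ 'a"
    have "norm (real_vec x) ^ j \<le> 1 + norm (real_vec x) ^ k"
    proof (cases "norm (real_vec x) \<le> 1")
      case True
      then have "norm (real_vec x) ^ j \<le> 1" by (simp add: power_le_one)
      then show ?thesis by (smt (verit) zero_le_power norm_ge_zero)
    next
      case False
      then have "norm (real_vec x) ^ j \<le> norm (real_vec x) ^ k"
        using assms(2) by (intro power_increasing) auto
      then show ?thesis by simp
    qed
    then have "norm (real_vec x) ^ j * \<bar>f x\<bar> \<le> (1 + norm (real_vec x) ^ k) * \<bar>f x\<bar>"
      by (intro mult_right_mono) auto
    then show "\<bar>norm (real_vec x) ^ j * f x\<bar> \<le> \<bar>f x\<bar> + norm (real_vec x) ^ k * \<bar>f x\<bar>"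
      by (simp add: abs_mult distrib_right)
  qed
qed

lemma has_moment_add: "has_moment k f \<Longrightarrow> has_moment k g \<Longrightarrow> has_moment k (\<lambda>x. f x + g x)"
  by (auto simp: has_moment_def distrib_left intro: summable_on_add)

lemma has_moment_cmult: "has_moment k f \<Longrightarrow> has_moment k (\<lambda>x. c * f x)"
  unfolding has_moment_def
  using summable_on_cmult_right[of f UNIV c] summable_on_cmult_right[of "\<lambda>x. norm (real_vec x) ^ k * f x" UNIV c]
  by (simp add: mult.left_commute)

definition coord_mult :: "'n \<Rightarrow> (int ^ 'n \<Rightarrow> real) \<Rightarrow> int ^ 'n \<Rightarrow> real" where
  "coord_mult j f x = real_of_int (x $ j) * f x"

lemma coord_le_norm: "\<bar>real_of_int (x $ j)\<bar> \<le> norm (real_vec x)"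
  using component_le_norm_cart[of "real_vec x" j] by simp

lemma has_moment_coord_mult:
  assumes "has_moment (Suc k) f"
  shows "has_moment k (coord_mult j f)"
  unfolding has_moment_def
proof (intro conjI)
  show "coord_mult j f summable_on UNIV"
  proof (rule summable_on_real_comparison)
    show "(\<lambda>x. norm (real_vec x) ^ 1 * \<bar>f x\<bar>) summable_on UNIV"
      by (rule has_moment_abs_summable, rule has_moment_mono[OF assms]) simp
  qed (auto simp: coord_mult_def abs_mult intro!: mult_right_mono coord_le_norm)
  show "(\<lambda>x. norm (real_vec x) ^ k * coord_mult j f x) summable_on UNIV"
  proof (rule summable_on_real_comparison[OF has_moment_abs_summable[OF assms]])
    show "\<bar>norm (real_vec x) ^ k * coord_mult j f x\<bar> \<le> norm (real_vec x) ^ Suc k * \<bar>f x\<bar>" for x :: "int ^ 'a"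
      using mult_right_mono[OF coord_le_norm[of x j], of "norm (real_vec x) ^ k * \<bar>f x\<bar>"]
      by (simp add: coord_mult_def abs_mult mult_ac)
  qed
qed

text \<open>Multiplication by a coordinate is a derivation for the convolution.\<close>

lemma coord_mult_conv:
  fixes f g :: "int ^ 'n \<Rightarrow> real"
  assumes f: "f summable_on UNIV" "coord_mult j f summable_on UNIV"
    and g: "g summable_on UNIV" "coord_mult j g summable_on UNIV"
  shows "coord_mult j (lattice_conv f g) = (\<lambda>x. lattice_conv (coord_mult j f) g x + lattice_conv f (coord_mult j g) x)"
    and "coord_mult j (lattice_conv f g) summable_on UNIV"
proof -
  show eq: "coord_mult j (lattice_conv f g) = (\<lambda>x. lattice_conv (coord_mult j f) g x + lattice_conv f (coord_mult j g) x)"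
  proof
    fix x
    have "coord_mult j (lattice_conv f g) x = (\<Sum>\<^sub>\<infinity>y. real_of_int (x $ j) * (f y * g (x - y)))"
      by (simp add: coord_mult_def lattice_conv_def infsum_cmult_right')
    also have "\<dots> = (\<Sum>\<^sub>\<infinity>y. coord_mult j f y * g (x - y) + f y * coord_mult j g (x - y))"
      by (intro infsum_cong) (simp add: coord_mult_def algebra_simps)
    also have "\<dots> = lattice_conv (coord_mult j f) g x + lattice_conv f (coord_mult j g) x"
      unfolding lattice_conv_def by (intro infsum_add lattice_conv_summand f g)
    finally show "coord_mult j (lattice_conv f g) x = lattice_conv (coord_mult j f) g x + lattice_conv f (coord_mult j g) x" .
  qed
  show "coord_mult j (lattice_conv f g) summable_on UNIV"
    unfolding eq by (intro summable_on_add lattice_conv_summable f g)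
qed

lemma inner_power_summable:
  fixes f :: "int ^ 'n \<Rightarrow> real"
  assumes "has_moment k f"
  shows "(\<lambda>x. f x * (l \<bullet> real_vec x) ^ k) summable_on UNIV"
proof (rule summable_on_real_comparison)
  show "(\<lambda>x. norm l ^ k * (norm (real_vec x) ^ k * \<bar>f x\<bar>)) summable_on UNIV"
    by (intro summable_on_cmult_right has_moment_abs_summable assms)
  show "\<bar>f x * (l \<bullet> real_vec x) ^ k\<bar> \<le> norm l ^ k * (norm (real_vec x) ^ k * \<bar>f x\<bar>)" for x
  proof -
    have "\<bar>l \<bullet> real_vec x\<bar> ^ k \<le> (norm l * norm (real_vec x)) ^ k"
      by (intro power_mono Cauchy_Schwarz_ineq2) auto
    then have "\<bar>l \<bullet> real_vec x\<bar> ^ k * \<bar>f x\<bar> \<le> (norm l * norm (real_vec x)) ^ k * \<bar>f x\<bar>"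
      by (intro mult_right_mono) auto
    then show ?thesis by (simp add: abs_mult power_abs power_mult_distrib mult_ac)
  qed
qed

text \<open>The character is expanded in each term of the series; an absolute moment pays for the remainder.\<close>

lemma char_fun_taylor:
  fixes f :: "int ^ 'n \<Rightarrow> real"
  assumes "has_moment (Suc n) f"
  shows "norm (char_fun f l - (\<Sum>k\<le>n. \<i> ^ k / fact k * of_real (\<Sum>\<^sub>\<infinity>x. f x * (l \<bullet> real_vec x) ^ k)))
     \<le> abs_moment (Suc n) f * norm l ^ Suc n / fact (Suc n)"
proof -
  have m: "has_moment k f" if "k \<le> Suc n" for k using has_moment_mono[OF assms that] .
  have s: "(\<lambda>x. complex_of_real (f x * (l \<bullet> real_vec x) ^ k)) summable_on UNIV" if "k \<le> n" for k
    by (intro summable_on_of_real inner_power_summable m) (use that in auto)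
  have "(\<Sum>k\<le>n. \<i> ^ k / fact k * of_real (\<Sum>\<^sub>\<infinity>x. f x * (l \<bullet> real_vec x) ^ k))
     = (\<Sum>k\<le>n. \<Sum>\<^sub>\<infinity>x. \<i> ^ k / fact k * of_real (f x * (l \<bullet> real_vec x) ^ k))"
    by (intro sum.cong refl) (simp only: infsum_cmult_right' infsum_of_real_banach[OF inner_power_summable[OF m]] atMost_iff le_SucI)
  also have "\<dots> = (\<Sum>\<^sub>\<infinity>x. \<Sum>k\<le>n. \<i> ^ k / fact k * of_real (f x * (l \<bullet> real_vec x) ^ k))"
    by (rule infsum_of_finite_sum) (simp, intro summable_on_cmult_right s, simp)
  finally have T: "(\<Sum>k\<le>n. \<i> ^ k / fact k * of_real (\<Sum>\<^sub>\<infinity>x. f x * (l \<bullet> real_vec x) ^ k))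
     = (\<Sum>\<^sub>\<infinity>x. \<Sum>k\<le>n. \<i> ^ k / fact k * of_real (f x * (l \<bullet> real_vec x) ^ k))" .
  have sT: "(\<lambda>x. \<Sum>k\<le>n. \<i> ^ k / fact k * of_real (f x * (l \<bullet> real_vec x) ^ k)) summable_on UNIV"
    by (rule infsum_of_finite_sum(2)) (simp, intro summable_on_cmult_right s, simp)
  have sC: "(\<lambda>x. of_real (f x) * cis (l \<bullet> real_vec x)) summable_on UNIV"
    by (rule abs_summable_summable[OF char_fun_summable[OF has_moment_summable[OF assms]]])
  have bound: "norm (of_real (f x) * cis (l \<bullet> real_vec x) - (\<Sum>k\<le>n. \<i> ^ k / fact k * of_real (f x * (l \<bullet> real_vec x) ^ k)))
      \<le> norm l ^ Suc n / fact (Suc n) * (norm (real_vec x) ^ Suc n * \<bar>f x\<bar>)" for x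
  proof -
    have "of_real (f x) * cis (l \<bullet> real_vec x) - (\<Sum>k\<le>n. \<i> ^ k / fact k * of_real (f x * (l \<bullet> real_vec x) ^ k))
      = of_real (f x) * (iexp (l \<bullet> real_vec x) - (\<Sum>k\<le>n. (\<i> * of_real (l \<bullet> real_vec x)) ^ k / fact k))"
      by (simp add: cis_conv_exp right_diff_distrib sum_distrib_left power_mult_distrib mult_ac)
    then have "norm (of_real (f x) * cis (l \<bullet> real_vec x) - (\<Sum>k\<le>n. \<i> ^ k / fact k * of_real (f x * (l \<bullet> real_vec x) ^ k)))
      \<le> \<bar>f x\<bar> * (\<bar>l \<bullet> real_vec x\<bar> ^ Suc n / fact (Suc n))"
      using mult_left_mono[OF iexp_approx1[of "l \<bullet> real_vec x" n] abs_ge_zero[of "f x"]]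
      by (simp only: norm_mult norm_of_real)
    also have "\<dots> \<le> \<bar>f x\<bar> * ((norm l * norm (real_vec x)) ^ Suc n / fact (Suc n))"
      by (intro mult_left_mono divide_right_mono power_mono Cauchy_Schwarz_ineq2) auto
    finally show ?thesis by (simp add: power_mult_distrib mult_ac)
  qed
  have "norm (char_fun f l - (\<Sum>k\<le>n. \<i> ^ k / fact k * of_real (\<Sum>\<^sub>\<infinity>x. f x * (l \<bullet> real_vec x) ^ k)))
    = norm (\<Sum>\<^sub>\<infinity>x. of_real (f x) * cis (l \<bullet> real_vec x) - (\<Sum>k\<le>n. \<i> ^ k / fact k * of_real (f x * (l \<bullet> real_vec x) ^ k)))"
    unfolding T char_fun_cis by (subst infsum_difference(1)[OF sC sT]) simp
  also have "\<dots> \<le> (\<Sum>\<^sub>\<infinity>x. norm l ^ Suc n / fact (Suc n) * (norm (real_vec x) ^ Suc n * \<bar>f x\<bar>))"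
    by (rule norm_infsum_le[OF has_sum_infsum[OF infsum_difference(2)[OF sC sT]] has_sum_infsum])
       (intro summable_on_cmult_right has_moment_abs_summable assms bound)+
  also have "\<dots> = abs_moment (Suc n) f * norm l ^ Suc n / fact (Suc n)"
    by (simp only: infsum_cmult_right' abs_moment_def) simp
  finally show ?thesis .
qed

lemma infsum_odd_zero:
  fixes h :: "int ^ 'n \<Rightarrow> real"
  assumes "\<And>x. h (- x) = - h x"
  shows "(\<Sum>\<^sub>\<infinity>x. h x) = 0"
proof -
  have "(\<Sum>\<^sub>\<infinity>x. h x) = (\<Sum>\<^sub>\<infinity>x. h (- x))"
    by (rule infsum_reindex_bij_betw[symmetric]) (auto intro!: bij_betw_byWitness[where f' = uminus])
  also have "\<dots> = - (\<Sum>\<^sub>\<infinity>x. h x)" by (simp add: assms infsum_uminus)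
  finally show ?thesis by simp
qed

text \<open>The next three bounds give the order to which a Fourier series vanishes at the origin, and
  hence the decay in time of the convolution with \<open>p\<^sub>m\<close>. Parity removes every other term of the expansion.\<close>

lemma char_fun_bound_1:
  assumes "has_moment 1 f" "odd_fun f"
  shows "norm (char_fun f l) \<le> abs_moment 1 f * norm l"
  using char_fun_taylor[of 0 f l] infsum_odd_zero[of f] assms
  by (simp add: odd_fun_def)

lemma char_fun_bound_2:
  assumes f: "has_moment 2 f" and "(\<Sum>\<^sub>\<infinity>x. f x) = 0" and "\<And>x. f (- x) = f x"
  shows "norm (char_fun f l) \<le> abs_moment 2 f * (norm l)\<^sup>2"
proof -
  have "(\<Sum>\<^sub>\<infinity>x. f x * (l \<bullet> real_vec x)) = 0"
    by (rule infsum_odd_zero) (simp add: assms)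
  then have "norm (char_fun f l) \<le> abs_moment 2 f * (norm l)\<^sup>2 / 2"
    using char_fun_taylor[of 1 f l] assms by (simp add: numeral_2_eq_2 )
  also have "\<dots> \<le> abs_moment 2 f * (norm l)\<^sup>2" using abs_moment_nonneg[of 2 f] by simp
  finally show ?thesis .
qed

lemma char_fun_bound_3:
  assumes f: "has_moment 3 f" and odd: "odd_fun f" and "\<And>l. (\<Sum>\<^sub>\<infinity>x. f x * (l \<bullet> real_vec x)) = 0"
  shows "norm (char_fun f l) \<le> abs_moment 3 f * norm l ^ 3"
proof -
  have "(\<Sum>\<^sub>\<infinity>x. f x * (l \<bullet> real_vec x)\<^sup>2) = 0" "(\<Sum>\<^sub>\<infinity>x. f x) = 0"
    using odd by (auto intro!: infsum_odd_zero simp: odd_fun_def)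
  then have "norm (char_fun f l) \<le> abs_moment 3 f * norm l ^ 3 / 6"
    using char_fun_taylor[of 2 f l] assms by (simp add: numeral_eq_Suc)
  also have "\<dots> \<le> abs_moment 3 f * norm l ^ 3" using abs_moment_nonneg[of 3 f] by simp
  finally show ?thesis .
qed

lemma char_fun_lipschitz:
  fixes f :: "int ^ 'n \<Rightarrow> real"
  assumes "has_moment 1 f"
  shows "norm (char_fun f l - char_fun f l') \<le> abs_moment 1 f * norm (l - l')"
proof -
  have s: "(\<lambda>x. of_real (f x) * cis (l \<bullet> real_vec x)) summable_on UNIV" for l
    by (rule abs_summable_summable[OF char_fun_summable[OF has_moment_summable[OF assms]]])
  have b: "norm (of_real (f x) * cis (l \<bullet> real_vec x) - of_real (f x) * cis (l' \<bullet> real_vec x))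
     \<le> norm (l - l') * (norm (real_vec x) ^ 1 * \<bar>f x\<bar>)" for x
  proof -
    have "of_real (f x) * cis (l \<bullet> real_vec x) - of_real (f x) * cis (l' \<bullet> real_vec x)
      = of_real (f x) * (cis (l' \<bullet> real_vec x) * (cis ((l - l') \<bullet> real_vec x) - 1))"
      by (simp add: right_diff_distrib cis_mult inner_diff_left)
    moreover have "norm (cis ((l - l') \<bullet> real_vec x) - 1) \<le> norm (l - l') * norm (real_vec x)"
      using iexp_approx1[of "(l - l') \<bullet> real_vec x" 0] Cauchy_Schwarz_ineq2[of "l - l'" "real_vec x"]
      by (simp add: cis_conv_exp)
    ultimately have "norm (of_real (f x) * cis (l \<bullet> real_vec x) - of_real (f x) * cis (l' \<bullet> real_vec x))
      \<le> \<bar>f x\<bar> * (norm (l - l') * norm (real_vec x))"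
      by (simp add: norm_mult mult_left_mono)
    then show ?thesis by (simp add: mult_ac)
  qed
  have "norm (char_fun f l - char_fun f l')
    = norm (\<Sum>\<^sub>\<infinity>x. of_real (f x) * cis (l \<bullet> real_vec x) - of_real (f x) * cis (l' \<bullet> real_vec x))"
    unfolding char_fun_cis by (subst infsum_difference(1)[OF s s]) simp
  also have "\<dots> \<le> (\<Sum>\<^sub>\<infinity>x. norm (l - l') * (norm (real_vec x) ^ 1 * \<bar>f x\<bar>))"
    by (rule norm_infsum_le[OF has_sum_infsum[OF infsum_difference(2)[OF s s]] has_sum_infsum])
       (intro summable_on_cmult_right has_moment_abs_summable assms b)+
  also have "\<dots> = abs_moment 1 f * norm (l - l')"
    by (simp only: infsum_cmult_right' abs_moment_def mult.commute)
  finally show ?thesis .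
qed

lemma continuous_on_char_fun:
  fixes f :: "int ^ 'n \<Rightarrow> real"
  assumes "has_moment 1 f"
  shows "continuous_on S (char_fun f)"
proof -
  have "(abs_moment 1 f)-lipschitz_on S (char_fun f)"
    by (intro lipschitz_onI abs_moment_nonneg) (use char_fun_lipschitz[OF assms] in \<open>auto simp: dist_norm\<close>)
  then show ?thesis by (rule lipschitz_on_continuous_on)
qed

section \<open>Symmetric aperiodic walks\<close>

lemma char_fun_point: "char_fun (\<lambda>z. of_bool (z = y)) l = cis (l \<bullet> real_vec y)"
proof -
  have "char_fun (\<lambda>z. of_bool (z = y)) l = (\<Sum>\<^sub>\<infinity>z\<in>{y}. cis (l \<bullet> real_vec z))"
    unfolding char_fun_cis by (rule infsum_cong_neutral) auto
  then show ?thesis by simp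
qed

lemma lattice_conv_point: "lattice_conv (\<lambda>z. of_bool (z = y)) g x = g (x - y)"
proof -
  have "lattice_conv (\<lambda>z. of_bool (z = y)) g x = (\<Sum>\<^sub>\<infinity>z\<in>{y}. g (x - z))"
    unfolding lattice_conv_def by (rule infsum_cong_neutral) auto
  then show ?thesis by simp
qed

primrec conv_power :: "(int ^ 'n \<Rightarrow> real) \<Rightarrow> nat \<Rightarrow> int ^ 'n \<Rightarrow> real" where
  "conv_power p 0 = (\<lambda>x. of_bool (x = 0))"
| "conv_power p (Suc m) = lattice_conv p (conv_power p m)"

lemma summable_delta: "(\<lambda>x :: int ^ 'n. of_bool (x = 0) :: real) summable_on UNIV"
  by (rule finite_nonzero_values_imp_summable_on) simp

lemma char_fun_delta: "char_fun (\<lambda>x :: int ^ 'n. of_bool (x = 0)) l = 1"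
  by (simp add: char_fun_point)

lemma conv_power_summable: "p summable_on UNIV \<Longrightarrow> conv_power p m summable_on UNIV"
  by (induction m) (auto simp: summable_delta lattice_conv_summable)

lemma char_fun_conv_power: "p summable_on UNIV \<Longrightarrow> char_fun (conv_power p m) l = char_fun p l ^ m"
  by (induction m) (auto simp: char_fun_delta char_fun_conv conv_power_summable)

lemma conv_power_Suc_right:
  "p summable_on UNIV \<Longrightarrow> lattice_conv f (conv_power p (Suc m)) = lattice_conv p (lattice_conv f (conv_power p m))"
  if "f summable_on UNIV"
  by (rule char_fun_eq_imp_eq)
     (use that in \<open>auto simp: lattice_conv_summable char_fun_conv conv_power_summable mult_ac simp del: conv_power.simps(2) simp: conv_power.simps\<close>)

text \<open>The last assumption is the form in which aperiodicity and irreducibility enter, and \<open>B_quad\<close> states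
  without coordinates that \<open>B\<close> is the covariance matrix.\<close>

locale symmetric_walk =
  fixes p :: "int ^ 'n \<Rightarrow> real" and B :: "real ^ 'n ^ 'n"
  assumes p_nonneg: "\<And>x. p x \<ge> 0"
    and p_sum: "(p has_sum 1) UNIV"
    and p_sym: "\<And>x. p (- x) = p x"
    and p_moment: "has_moment 4 p"
    and B_pd: "positive_definite B"
    and B_quad: "\<And>l. l \<bullet> (B *v l) = (\<Sum>\<^sub>\<infinity>x. p x * (l \<bullet> real_vec x)\<^sup>2)"
    and char_fun_less_1: "\<And>l. l \<in> torus \<Longrightarrow> l \<noteq> 0 \<Longrightarrow> norm (char_fun p l) < 1"
begin

lemma p_summable: "p summable_on UNIV"
  using p_sum by (auto simp: summable_on_def)

abbreviation pw :: "nat \<Rightarrow> int ^ 'n \<Rightarrow> real" where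
  "pw \<equiv> conv_power p"

lemmas pw_summable = conv_power_summable[OF p_summable]

lemma pw_nonneg: "pw m x \<ge> 0"
  by (induction m arbitrary: x) (auto simp: lattice_conv_def intro!: infsum_nonneg mult_nonneg_nonneg p_nonneg)

lemma pw_sym: "pw m (- x) = pw m x"
proof (induction m arbitrary: x)
  case (Suc m)
  have "pw (Suc m) (- x) = (\<Sum>\<^sub>\<infinity>y. p y * pw m (- x - y))"
    by (simp add: lattice_conv_def)
  also have "\<dots> = (\<Sum>\<^sub>\<infinity>y. p (- y) * pw m (- x - (- y)))"
    by (rule infsum_reindex_bij_betw[symmetric]) (auto intro!: bij_betw_byWitness[where f' = uminus])
  also have "\<dots> = (\<Sum>\<^sub>\<infinity>y. p y * pw m (x - y))"
    using Suc.IH[of "x - _"] by (simp add: p_sym)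
  finally show ?case by (simp add: lattice_conv_def)
qed simp

lemma char_fun_quadratic:
  "norm (char_fun p l - of_real (1 - l \<bullet> (B *v l) / 2)) \<le> abs_moment 4 p * norm l ^ 4"
proof -
  have 3: "(\<Sum>\<^sub>\<infinity>x. p x * (l \<bullet> real_vec x) ^ 3) = 0" "(\<Sum>\<^sub>\<infinity>x. p x * (l \<bullet> real_vec x)) = 0"
    by (rule infsum_odd_zero; simp add: p_sym)+
  have 0: "(\<Sum>\<^sub>\<infinity>x. p x) = 1" using p_sum by (rule infsumI)
  have "(\<Sum>k\<le>3. \<i> ^ k / fact k * of_real (\<Sum>\<^sub>\<infinity>x. p x * (l \<bullet> real_vec x) ^ k)) = of_real (1 - l \<bullet> (B *v l) / 2)"
    using 3 0 by (simp add: eval_nat_numeral B_quad)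
  then have "norm (char_fun p l - of_real (1 - l \<bullet> (B *v l) / 2)) \<le> abs_moment 4 p * norm l ^ 4 / 24"
    using char_fun_taylor[of 3 p l] p_moment by (simp add: fact_numeral)
  also have "\<dots> \<le> abs_moment 4 p * norm l ^ 4" using abs_moment_nonneg[of 4 p] by simp
  finally show ?thesis .
qed

lemma continuous_on_char_fun_p: "continuous_on S (char_fun p)"
  by (rule continuous_on_char_fun, rule has_moment_mono[OF p_moment]) simp

lemma quad_bounds:
  obtains b b' where "b > 0" "b' > 0" "\<And>l. b * (norm l)\<^sup>2 \<le> l \<bullet> (B *v l)" "\<And>l. l \<bullet> (B *v l) \<le> b' * (norm l)\<^sup>2"
proof -
  let ?S = "sphere (0 :: real ^ 'n) 1"
  have ne: "?S \<noteq> {}" by (simp add: sphere_eq_empty)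
  have cont: "continuous_on ?S (\<lambda>l. l \<bullet> (B *v l))"
    by (intro continuous_intros matrix_vector_mult_linear_continuous_on)
  obtain u where u: "u \<in> ?S" "\<And>l. l \<in> ?S \<Longrightarrow> u \<bullet> (B *v u) \<le> l \<bullet> (B *v l)"
    using continuous_attains_inf[OF compact_sphere ne cont] by blast
  obtain v where v: "v \<in> ?S" "\<And>l. l \<in> ?S \<Longrightarrow> l \<bullet> (B *v l) \<le> v \<bullet> (B *v v)"
    using continuous_attains_sup[OF compact_sphere ne cont] by blast
  have pos: "u \<bullet> (B *v u) > 0" "v \<bullet> (B *v v) > 0"
  proof -
    have "u \<noteq> 0" "v \<noteq> 0" using u(1) v(1) by auto
    then show "u \<bullet> (B *v u) > 0" "v \<bullet> (B *v v) > 0"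
      using B_pd by (auto simp: positive_definite_def)
  qed
  have "u \<bullet> (B *v u) * (norm l)\<^sup>2 \<le> l \<bullet> (B *v l) \<and> l \<bullet> (B *v l) \<le> v \<bullet> (B *v v) * (norm l)\<^sup>2" for l
  proof (cases "l = 0")
    case False
    define w where "w = (1 / norm l) *\<^sub>R l"
    have w: "w \<in> ?S" using False by (simp add: w_def)
    have l: "l = norm l *\<^sub>R w" using False by (simp add: w_def)
    have "l \<bullet> (B *v l) = (norm l *\<^sub>R w) \<bullet> (B *v (norm l *\<^sub>R w))" using l by simp
    also have "\<dots> = (norm l)\<^sup>2 * (w \<bullet> (B *v w))"
      by (simp add: matrix_vector_mult_scaleR power2_eq_square)
    finally show ?thesis using u(2)[OF w] v(2)[OF w] by (simp add: mult.commute[of "(norm l)\<^sup>2"] mult_right_mono)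
  qed simp
  then show ?thesis using that[OF pos] by blast
qed

text \<open>Near the origin the decay comes from the quadratic expansion; on the remaining compact part of the
  torus aperiodicity keeps \<open>\<bar>char_fun p\<bar>\<close> away from \<open>1\<close>.\<close>

lemma char_fun_decay_exists: "\<exists>c>0. \<forall>l\<in>torus. norm (char_fun p l) \<le> exp (- c * (norm l)\<^sup>2)"
proof -
  obtain b b' where b: "b > 0" "b' > 0" and q: "\<And>l. b * (norm l)\<^sup>2 \<le> l \<bullet> (B *v l)" "\<And>l. l \<bullet> (B *v l) \<le> b' * (norm l)\<^sup>2"
    using quad_bounds by blast
  define K where "K = abs_moment 4 p + 1"
  have K: "K \<ge> 1" using abs_moment_nonneg[of 4 p] by (simp add: K_def)
  \<comment> \<open>Where \<open>(norm l)\<^sup>2 \<le> e\<close>, the quartic error is at most half of the quadratic term and \<open>1 - l \<bullet> (B *v l) / 2\<close>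
    is positive.\<close>
  define e where "e = min (b / (4 * K)) (1 / b')"
  have e: "e > 0" using b K by (simp add: e_def)
  have near: "norm (char_fun p l) \<le> 1 - b / 4 * (norm l)\<^sup>2" if l: "(norm l)\<^sup>2 \<le> e" for l
  proof -
    have "norm (char_fun p l) \<le> norm (complex_of_real (1 - l \<bullet> (B *v l) / 2)) + abs_moment 4 p * norm l ^ 4"
      using char_fun_quadratic[of l] norm_triangle_ineq2[of "char_fun p l" "complex_of_real (1 - l \<bullet> (B *v l) / 2)"] by linarith
    also have "norm (complex_of_real (1 - l \<bullet> (B *v l) / 2)) = 1 - l \<bullet> (B *v l) / 2"
    proof -
      have "b' * (norm l)\<^sup>2 \<le> b' * (1 / b')" using l b by (intro mult_left_mono) (auto simp: e_def)
      then have "l \<bullet> (B *v l) \<le> 1" using q(2)[of l] b by simp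
      then show ?thesis by (simp del: of_real_diff of_real_divide)
    qed
    also have "\<dots> \<le> 1 - b * (norm l)\<^sup>2 / 2" using q(1)[of l] by simp
    also have "abs_moment 4 p * norm l ^ 4 \<le> K * norm l ^ 4" by (intro mult_right_mono) (auto simp: K_def)
    also have "K * norm l ^ 4 = K * (norm l)\<^sup>2 * (norm l)\<^sup>2" by (simp add: power2_eq_square power4_eq_xxxx mult_ac)
    also have "\<dots> \<le> K * (b / (4 * K)) * (norm l)\<^sup>2" using l K by (intro mult_right_mono mult_left_mono) (auto simp: e_def)
    also have "K * (b / (4 * K)) = b / 4" using K by simp
    finally show ?thesis by (simp add: algebra_simps)
  qed
  define S where "S = torus - {l :: real ^ 'n. (norm l)\<^sup>2 < e}"
  have "open {l :: real ^ 'n. (norm l)\<^sup>2 < e}" by (intro open_Collect_less continuous_intros)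
  then have cS: "compact S" unfolding S_def by (intro compact_diff) auto
  define R where "R = real CARD('n) * pi"
  have R: "R > 0" by (simp add: R_def)
  obtain d where d: "d > 0" "\<And>l. l \<in> S \<Longrightarrow> norm (char_fun p l) \<le> 1 - d"
  proof (cases "S = {}")
    case True then show ?thesis using that[of 1] by auto
  next
    case False
    then obtain u where u: "u \<in> S" "\<And>l. l \<in> S \<Longrightarrow> norm (char_fun p l) \<le> norm (char_fun p u)"
      using continuous_attains_sup[OF cS False continuous_on_norm[OF continuous_on_char_fun_p]] by blast
    have "u \<noteq> 0" "u \<in> torus" using u(1) e by (auto simp: S_def)
    then have "norm (char_fun p u) < 1" by (intro char_fun_less_1)
    then show ?thesis using that[of "1 - norm (char_fun p u)"] u(2) by auto
  qed
  \<comment> \<open>On the rest of the torus \<open>norm l \<le> R\<close>, so there a gap \<open>d\<close> is worth \<open>d / R\<^sup>2\<close> times \<open>(norm l)\<^sup>2\<close>.\<close>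
  define c where "c = min (b / 4) (d / R\<^sup>2)"
  have c: "c > 0" using b d R by (simp add: c_def)
  have "norm (char_fun p l) \<le> exp (- c * (norm l)\<^sup>2)" if l: "l \<in> torus" for l
  proof -
    have "norm (char_fun p l) \<le> 1 - c * (norm l)\<^sup>2"
    proof (cases "l \<in> S")
      case True
      have "c * (norm l)\<^sup>2 \<le> d / R\<^sup>2 * R\<^sup>2"
        using norm_le_on_torus[OF l] d by (intro mult_mono power_mono) (auto simp: c_def R_def)
      then have "c * (norm l)\<^sup>2 \<le> d" using R by simp
      with d(2)[OF True] show ?thesis by simp
    next
      case False
      have "c \<le> b / 4" unfolding c_def by (rule min.cobounded1)
      then have "c * (norm l)\<^sup>2 \<le> b / 4 * (norm l)\<^sup>2" by (intro mult_right_mono) auto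
      moreover have "(norm l)\<^sup>2 \<le> e" using False l by (auto simp: S_def)
      ultimately show ?thesis using near[of l] by simp
    qed
    also have "\<dots> \<le> exp (- c * (norm l)\<^sup>2)" using exp_ge_add_one_self[of "- c * (norm l)\<^sup>2"] by simp
    finally show ?thesis .
  qed
  with c show ?thesis by blast
qed

text \<open>The rate and the constants below are chosen once for the walk, so that later estimates are uniform in time,
  in space and in the function that is convolved with \<open>p\<^sub>m\<close>.\<close>

definition decay_rate :: real where
  "decay_rate = (SOME c. c > 0 \<and> (\<forall>l\<in>torus. norm (char_fun p l) \<le> exp (- c * (norm l)\<^sup>2)))"

lemma decay_rate_pos: "decay_rate > 0"
  and char_fun_decay: "l \<in> torus \<Longrightarrow> norm (char_fun p l) \<le> exp (- decay_rate * (norm l)\<^sup>2)"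
proof -
  have "decay_rate > 0 \<and> (\<forall>l\<in>torus. norm (char_fun p l) \<le> exp (- decay_rate * (norm l)\<^sup>2))"
    unfolding decay_rate_def by (rule someI_ex) (rule char_fun_decay_exists)
  then show "decay_rate > 0" "l \<in> torus \<Longrightarrow> norm (char_fun p l) \<le> exp (- decay_rate * (norm l)\<^sup>2)"
    by blast+
qed

lemma char_fun_power_decay:
  assumes "l \<in> torus"
  shows "norm (char_fun p l ^ m) \<le> exp (- decay_rate * real m * (norm l)\<^sup>2)"
proof -
  have "norm (char_fun p l ^ m) \<le> exp (- decay_rate * (norm l)\<^sup>2) ^ m"
    unfolding norm_power by (intro power_mono char_fun_decay assms) auto
  then show ?thesis by (simp add: exp_of_nat_mult[symmetric] mult_ac)
qed

definition coeff_const :: "nat \<Rightarrow> real" where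
  "coeff_const k = (SOME C. C \<ge> 0 \<and> (\<forall>m. (LINT l:torus|lborel. norm (l :: real ^ 'n) ^ k * exp (- decay_rate * real m * (norm l)\<^sup>2))
      \<le> C * real (Suc m) powr (- (real CARD('n) + real k) / 2)))"

lemma coeff_const_nonneg: "coeff_const k \<ge> 0"
  and coeff_const: "(LINT l:torus|lborel. norm (l :: real ^ 'n) ^ k * exp (- decay_rate * real m * (norm l)\<^sup>2))
      \<le> coeff_const k * real (Suc m) powr (- (real CARD('n) + real k) / 2)"
proof -
  obtain C where C: "C \<ge> 0" "\<And>m. (LINT l:torus|lborel. norm (l :: real ^ 'n) ^ k * exp (- decay_rate * real m * (norm l)\<^sup>2))
      \<le> C * real (Suc m) powr (- (real CARD('n) + real k) / 2)"
    by (rule torus_gaussian_moment_bound[OF decay_rate_pos, where k = k and 'n = 'n]) (rule that)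
  then have "\<exists>C. C \<ge> 0 \<and> (\<forall>m. (LINT l:torus|lborel. norm (l :: real ^ 'n) ^ k * exp (- decay_rate * real m * (norm l)\<^sup>2))
      \<le> C * real (Suc m) powr (- (real CARD('n) + real k) / 2))"
    by blast
  from someI_ex[OF this, folded coeff_const_def] show "coeff_const k \<ge> 0"
    "(LINT l:torus|lborel. norm (l :: real ^ 'n) ^ k * exp (- decay_rate * real m * (norm l)\<^sup>2))
      \<le> coeff_const k * real (Suc m) powr (- (real CARD('n) + real k) / 2)"
    by blast+
qed

text \<open>Two powers of \<open>norm l\<close> are allowed because the second derivative of \<open>char_fun p ^ m\<close> has two terms of
  different order.\<close>

lemma coeff_bound_two:
  fixes g :: "int ^ 'n \<Rightarrow> real"
  assumes g: "g summable_on UNIV" and K: "K \<ge> 0" "K' \<ge> 0"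
    and bound: "\<And>l. l \<in> torus \<Longrightarrow> norm (char_fun g l) \<le> (K * norm l ^ k + K' * norm l ^ k') * exp (- decay_rate * real m * (norm l)\<^sup>2)"
  shows "\<bar>g x\<bar> \<le> coeff_const k * K * real (Suc m) powr (- (real CARD('n) + real k) / 2)
    + coeff_const k' * K' * real (Suc m) powr (- (real CARD('n) + real k') / 2)"
proof -
  let ?e = "\<lambda>k (l :: real ^ 'n). norm l ^ k * exp (- decay_rate * real m * (norm l)\<^sup>2)"
  have i: "integrable lborel (\<lambda>l. indicat_real torus l *\<^sub>R ?e k l)" for k
    by (rule borel_integrable_compact) (auto intro!: continuous_intros)
  have "(2 * pi) ^ CARD('n) \<ge> 1" using pi_gt3 by (intro one_le_power) auto
  then have "\<bar>g x\<bar> \<le> (2 * pi) ^ CARD('n) * \<bar>g x\<bar>" by (simp add: mult_le_cancel_right1)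
  also have "\<dots> = norm (LINT l:torus|lborel. char_fun g l * cis (- (l \<bullet> real_vec x)))"
    unfolding char_fun_inversion[OF g] by (simp add: norm_mult abs_mult del: of_real_mult)
  also have "\<dots> \<le> (\<integral>l. K * (indicat_real torus l *\<^sub>R ?e k l) + K' * (indicat_real torus l *\<^sub>R ?e k' l) \<partial>lborel)"
    unfolding set_lebesgue_integral_def
  proof (rule Bochner_Integration.integral_norm_bound_integral)
    show "integrable lborel (\<lambda>l. indicat_real torus l *\<^sub>R (char_fun g l * cis (- (l \<bullet> real_vec x))))"
      using char_fun_set_integrable[OF g] by (simp add: set_integrable_def)
    show "integrable lborel (\<lambda>l. K * (indicat_real torus l *\<^sub>R ?e k l) + K' * (indicat_real torus l *\<^sub>R ?e k' l))"
      by (intro Bochner_Integration.integrable_add integrable_mult_right i)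
    show "norm (indicat_real torus l *\<^sub>R (char_fun g l * cis (- (l \<bullet> real_vec x))))
      \<le> K * (indicat_real torus l *\<^sub>R ?e k l) + K' * (indicat_real torus l *\<^sub>R ?e k' l)" for l
      using bound[of l] by (auto simp: indicator_def norm_mult distrib_right mult.assoc)
  qed
  also have "\<dots> = K * (LINT l:torus|lborel. ?e k l) + K' * (LINT l:torus|lborel. ?e k' l)"
    unfolding set_lebesgue_integral_def
    by (subst Bochner_Integration.integral_add, (intro integrable_mult_right i)+, simp only: integral_mult_right_zero)
  also have "\<dots> \<le> K * (coeff_const k * real (Suc m) powr (- (real CARD('n) + real k) / 2))
     + K' * (coeff_const k' * real (Suc m) powr (- (real CARD('n) + real k') / 2))"
    by (intro add_mono mult_left_mono coeff_const K)
  finally show ?thesis by (simp add: mult_ac)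
qed

lemma coeff_bound:
  fixes g :: "int ^ 'n \<Rightarrow> real"
  assumes g: "g summable_on UNIV" and K: "K \<ge> 0"
    and bound: "\<And>l. l \<in> torus \<Longrightarrow> norm (char_fun g l) \<le> K * norm l ^ k * exp (- decay_rate * real m * (norm l)\<^sup>2)"
  shows "\<bar>g x\<bar> \<le> coeff_const k * K * real (Suc m) powr (- (real CARD('n) + real k) / 2)"
  using coeff_bound_two[OF g K order_refl, of k 0 m x] bound by simp

text \<open>In the integral for \<open>p\<^sub>m\<close> the variable \<open>l\<close> is of size \<open>m\<^bsup>-1/2\<^esup>\<close>, so each power of \<open>norm l\<close> gains
  this factor over the size \<open>m\<^bsup>-\<nu>/2\<^esup>\<close> of \<open>p\<^sub>m\<close>.\<close>

lemma conv_pw_bound: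
  fixes f :: "int ^ 'n \<Rightarrow> real"
  assumes f: "f summable_on UNIV" and K: "K \<ge> 0"
    and bound: "\<And>l. l \<in> torus \<Longrightarrow> norm (char_fun f l) \<le> K * norm l ^ k"
  shows "\<bar>lattice_conv f (pw m) x\<bar> \<le> coeff_const k * K * real (Suc m) powr (- (real CARD('n) + real k) / 2)"
proof (rule coeff_bound[OF lattice_conv_summable[OF f pw_summable] K])
  fix l :: "real ^ 'n" assume l: "l \<in> torus"
  show "norm (char_fun (lattice_conv f (pw m)) l) \<le> K * norm l ^ k * exp (- decay_rate * real m * (norm l)\<^sup>2)"
    unfolding char_fun_conv[OF f pw_summable] char_fun_conv_power[OF p_summable] norm_mult
    by (intro mult_mono bound[OF l] char_fun_power_decay[OF l] mult_nonneg_nonneg K) auto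
qed

lemma pw_bound: "pw m x \<le> coeff_const 0 * real (Suc m) powr (- real CARD('n) / 2)"
  using coeff_bound[OF pw_summable, of 1 m 0 m x] char_fun_power_decay pw_nonneg[of m x]
  by (simp add: char_fun_conv_power[OF p_summable])

end

section \<open>The local limit theorem\<close>

lemma exp_minus_le_quadratic:
  fixes y :: real
  assumes "y \<ge> 0"
  shows "exp (- y) \<le> 1 - y + y\<^sup>2 / 2"
proof -
  have e: "1 + y + y\<^sup>2 / 2 \<le> exp y" using exp_lower_Taylor_quadratic[OF assms] by simp
  have "(1 - y + y\<^sup>2 / 2) * (1 + y + y\<^sup>2 / 2) = 1 + y ^ 4 / 4"
    by (simp add: algebra_simps power2_eq_square power4_eq_xxxx)
  then have "1 \<le> (1 - y + y\<^sup>2 / 2) * (1 + y + y\<^sup>2 / 2)" by simp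
  also have "\<dots> \<le> (1 - y + y\<^sup>2 / 2) * exp y"
  proof (rule mult_left_mono[OF e])
    show "0 \<le> 1 - y + y\<^sup>2 / 2" using zero_le_power2[of "y - 1"] by (simp add: power2_eq_square algebra_simps)
  qed
  finally show ?thesis by (simp add: exp_minus field_simps)
qed

context symmetric_walk
begin

definition limit_const :: real where
  "limit_const = 1 / ((2 * pi) powr (real CARD('n) / 2) * sqrt (det B))"

lemma limit_const_pos: "limit_const > 0"
  using positive_definite_det[OF B_pd] by (simp add: limit_const_def)

definition gauss :: "nat \<Rightarrow> int ^ 'n \<Rightarrow> real" where
  "gauss n x = limit_const * exp (- (real_vec x \<bullet> (matrix_inv B *v real_vec x)) / (2 * real n))"

text \<open>At \<open>l = t / \<surd>n\<close> the function \<open>char_fun p\<close> and the Gaussian agree up to \<open>O(n\<^bsup>-2\<^esup>)\<close> by the fourth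
  moment. Both have modulus at most \<open>1\<close>, so taking \<open>n\<close>-th powers multiplies the difference by at most \<open>n\<close>.\<close>

lemma char_fun_power_limit:
  "(\<lambda>n. char_fun p ((1 / sqrt (real n)) *\<^sub>R t) ^ n) \<longlonglongrightarrow> of_real (exp (- (t \<bullet> (B *v t)) / 2))"
proof -
  define q where "q = t \<bullet> (B *v t)"
  have q0: "q \<ge> 0" using B_pd by (cases "t = 0") (auto simp: q_def positive_definite_def less_imp_le)
  define E where "E = abs_moment 4 p * norm t ^ 4 + q\<^sup>2 / 8"
  have bound: "norm (char_fun p ((1 / sqrt (real n)) *\<^sub>R t) ^ n - of_real (exp (- q / 2))) \<le> E / real n" if n: "n > 0" for n
  proof -
    define l where "l = (1 / sqrt (real n)) *\<^sub>R t"
    define w where "w = complex_of_real (exp (- q / (2 * real n)))"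
    have nl: "norm l ^ 4 = norm t ^ 4 / (real n)\<^sup>2"
    proof -
      have "sqrt (real n) ^ 4 = ((sqrt (real n))\<^sup>2)\<^sup>2"
        by (simp only: power_mult[symmetric]) simp
      also have "\<dots> = (real n)\<^sup>2" by simp
      finally show ?thesis by (simp add: l_def power_divide)
    qed
    have ql: "l \<bullet> (B *v l) = q / real n"
      using n by (simp add: l_def q_def matrix_vector_mult_scaleR)
    have "w ^ n = of_real (exp (- q / (2 * real n)) ^ n)" by (simp add: w_def)
    also have "exp (- q / (2 * real n)) ^ n = exp (- q / 2)" using n by (simp add: exp_of_nat_mult[symmetric])
    finally have wn: "w ^ n = of_real (exp (- q / 2))" .
    have "norm (char_fun p l ^ n - w ^ n) \<le> real n * norm (char_fun p l - w)"
    proof (rule norm_power_diff)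
      show "norm (char_fun p l) \<le> 1"
        using char_fun_bound[OF p_summable, of l] infsumI[OF p_sum] p_nonneg by simp
      show "norm w \<le> 1" using q0 by (simp add: w_def)
    qed
    also have "norm (char_fun p l - w) \<le> E / (real n)\<^sup>2"
    proof -
      define y where "y = q / (2 * real n)"
      have y: "y \<ge> 0" using q0 by (simp add: y_def)
      have ly: "1 - l \<bullet> (B *v l) / 2 = 1 - y" by (simp add: ql y_def)
      have wy: "w = complex_of_real (exp (- y))" by (simp add: w_def y_def)
      have "norm (complex_of_real (1 - l \<bullet> (B *v l) / 2) - w) = norm (complex_of_real (1 - y - exp (- y)))"
        unfolding ly wy of_real_diff ..
      also have "\<dots> = \<bar>1 - y - exp (- y)\<bar>" by (rule norm_of_real)
      also have "\<dots> \<le> y\<^sup>2 / 2"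
        using exp_ge_add_one_self[of "- y"] exp_minus_le_quadratic[OF y] by simp
      also have "\<dots> = q\<^sup>2 / 8 / (real n)\<^sup>2" by (simp add: y_def power_divide power_mult_distrib)
      finally have "norm (complex_of_real (1 - l \<bullet> (B *v l) / 2) - w) \<le> q\<^sup>2 / 8 / (real n)\<^sup>2" .
      moreover have "norm (char_fun p l - complex_of_real (1 - l \<bullet> (B *v l) / 2)) \<le> abs_moment 4 p * norm t ^ 4 / (real n)\<^sup>2"
        using char_fun_quadratic[of l] by (simp add: nl)
      ultimately have "norm (char_fun p l - w) \<le> abs_moment 4 p * norm t ^ 4 / (real n)\<^sup>2 + q\<^sup>2 / 8 / (real n)\<^sup>2"
        using norm_triangle_ineq[of "char_fun p l - complex_of_real (1 - l \<bullet> (B *v l) / 2)" "complex_of_real (1 - l \<bullet> (B *v l) / 2) - w"] by simp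
      then show ?thesis by (simp add: E_def add_divide_distrib)
    qed
    also have "real n * (E / (real n)\<^sup>2) = E / real n" using n by (simp add: power2_eq_square)
    finally show ?thesis unfolding wn l_def by (simp add: mult_left_mono)
  qed
  have "(\<lambda>n. char_fun p ((1 / sqrt (real n)) *\<^sub>R t) ^ n - of_real (exp (- q / 2))) \<longlonglongrightarrow> 0"
  proof (rule Lim_null_comparison)
    show "eventually (\<lambda>n. norm (char_fun p ((1 / sqrt (real n)) *\<^sub>R t) ^ n - of_real (exp (- q / 2))) \<le> E / real n) sequentially"
      using bound by (auto simp: eventually_at_top_linorder intro!: exI[of _ 1])
    show "(\<lambda>n. E / real n) \<longlonglongrightarrow> 0" by real_asymp
  qed
  then show ?thesis unfolding q_def by (rule LIM_zero_cancel)
qed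

text \<open>After the substitution \<open>l = t / \<surd>n\<close> the position \<open>x\<close> enters both inversion integrals only through a
  factor of modulus \<open>1\<close>. The error is therefore at most an \<open>L\<^sup>1\<close> distance that does not depend on \<open>x\<close>.\<close>

lemma local_limit:
  "uniform_limit UNIV (\<lambda>n x. real n powr (real CARD('n) / 2) * pw n x - gauss n x) (\<lambda>_. 0) sequentially"
proof -
  let ?q = "\<lambda>t :: real ^ 'n. exp (- (t \<bullet> (B *v t)) / 2)"
  define F where "F n t = indicat_real torus ((1 / sqrt (real n)) *\<^sub>R t) *\<^sub>R char_fun p ((1 / sqrt (real n)) *\<^sub>R t) ^ n" for n and t :: "real ^ 'n"
  define \<epsilon> where "\<epsilon> n = (\<integral>t. norm (F n t - of_real (?q t)) \<partial>lborel)" for n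
  have [measurable]: "char_fun p \<in> borel_measurable borel"
    by (intro borel_measurable_continuous_onI continuous_on_char_fun_p)
  have [measurable]: "(\<lambda>t. of_real (?q t) :: complex) \<in> borel_measurable borel"
    by (intro borel_measurable_continuous_onI continuous_intros matrix_vector_mult_linear_continuous_on) auto
  have F_meas[measurable]: "F n \<in> borel_measurable borel" for n
    unfolding F_def by measurable
  have iq: "integrable lborel (\<lambda>t. complex_of_real (?q t))"
    using integrable_gaussian_vec[OF B_pd, of 0] by (simp add: scaleR_conv_of_real)
  define w where "w t = exp (- (2 * decay_rate) * (norm t)\<^sup>2 / 2) + ?q t" for t :: "real ^ 'n"
  have iw: "integrable lborel w"
    unfolding w_def using decay_rate_pos iq complex_of_real_integrable_eq[of lborel ?q]
    by (intro Bochner_Integration.integrable_add integrable_gaussian_norm) auto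
  have Fb: "norm (F n t) \<le> exp (- (2 * decay_rate) * (norm t)\<^sup>2 / 2)" if "n > 0" for n t
  proof (cases "(1 / sqrt (real n)) *\<^sub>R t \<in> torus")
    case True
    then have "norm (F n t) \<le> exp (- decay_rate * real n * (norm ((1 / sqrt (real n)) *\<^sub>R t))\<^sup>2)"
      using char_fun_power_decay[OF True, of n] by (simp add: F_def)
    also have "(norm ((1 / sqrt (real n)) *\<^sub>R t))\<^sup>2 = (norm t)\<^sup>2 / real n"
      by (simp add: power_divide)
    also have "- decay_rate * real n * ((norm t)\<^sup>2 / real n) = - (2 * decay_rate) * (norm t)\<^sup>2 / 2"
      using that by simp
    finally show ?thesis .
  qed (simp add: F_def)
  have wb: "norm (F n t - of_real (?q t)) \<le> w t" if "n > 0" for n t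
    using norm_triangle_ineq4[of "F n t" "of_real (?q t)"] Fb[OF that, of t] by (simp add: w_def)
  have iF: "integrable lborel (F n)" if "n > 0" for n
    by (rule Bochner_Integration.integrable_bound[OF iw]) (use Fb[OF that] in \<open>auto simp: w_def intro!: AE_I2 order_trans[OF Fb[OF that]]\<close>)
  have F_lim: "(\<lambda>n. F n t) \<longlonglongrightarrow> of_real (?q t)" for t
  proof (rule Lim_transform_eventually[OF char_fun_power_limit[of t]])
    have "(\<lambda>n. norm t / sqrt (real n)) \<longlonglongrightarrow> 0" by real_asymp
    then have "eventually (\<lambda>n. norm t / sqrt (real n) < pi) sequentially"
      by (rule order_tendstoD) simp
    then show "eventually (\<lambda>n. char_fun p ((1 / sqrt (real n)) *\<^sub>R t) ^ n = F n t) sequentially"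
    proof eventually_elim
      case (elim n)
      have "\<bar>((1 / sqrt (real n)) *\<^sub>R t) $ i\<bar> \<le> pi" for i
      proof -
        have "\<bar>((1 / sqrt (real n)) *\<^sub>R t) $ i\<bar> \<le> norm ((1 / sqrt (real n)) *\<^sub>R t)" by (rule component_le_norm_cart)
        then show ?thesis using elim by simp
      qed
      then have "(1 / sqrt (real n)) *\<^sub>R t \<in> torus" unfolding mem_torus by blast
      then show ?case by (simp add: F_def)
    qed
  qed
  have eps: "\<epsilon> \<longlonglongrightarrow> 0"
  proof -
    have "(\<lambda>n. \<integral>t. norm (F (Suc n) t - of_real (?q t)) \<partial>lborel) \<longlonglongrightarrow> (\<integral>t. 0 \<partial>(lborel :: (real ^ 'n) measure))"
    proof (rule integral_dominated_convergence[OF _ _ iw])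
      show "AE t in lborel. (\<lambda>n. norm (F (Suc n) t - of_real (?q t))) \<longlonglongrightarrow> 0"
        using LIMSEQ_Suc[OF F_lim] by (intro AE_I2 tendsto_norm_zero LIM_zero)
      show "AE t in lborel. norm (norm (F (Suc n) t - of_real (?q t))) \<le> w t" for n
        using wb[of "Suc n"] by simp
      show "(\<lambda>t. norm (F (Suc n) t - of_real (?q t))) \<in> borel_measurable lborel" for n
        by measurable
    qed simp
    then show ?thesis unfolding \<epsilon>_def by (simp add: LIMSEQ_imp_Suc)
  qed
  have bound: "\<bar>real n powr (real CARD('n) / 2) * pw n x - gauss n x\<bar> \<le> \<epsilon> n" if n: "n > 0" for n x
  proof -
    define c where "c = 1 / sqrt (real n)"
    have c: "c > 0" using n by (simp add: c_def)
    define z where "z = - c *\<^sub>R real_vec x"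
    let ?h = "\<lambda>l :: real ^ 'n. indicat_real torus l *\<^sub>R (char_fun p l ^ n * cis (- (l \<bullet> real_vec x)))"
    have hm: "?h \<in> borel_measurable borel"
    proof -
      have [measurable]: "(\<lambda>l :: real ^ 'n. cis (- (l \<bullet> real_vec x))) \<in> borel_measurable borel"
        by (intro borel_measurable_continuous_onI continuous_intros)
      show ?thesis by measurable
    qed
    have "complex_of_real ((2 * pi) ^ CARD('n) * pw n x) = (\<integral>l. ?h l \<partial>lborel)"
      using char_fun_inversion[OF pw_summable, of n x] by (simp add: set_lebesgue_integral_def char_fun_conv_power[OF p_summable])
    also have "\<dots> = (c ^ CARD('n)) *\<^sub>R (\<integral>t. ?h (c *\<^sub>R t) \<partial>lborel)"
      by (rule integral_lborel_scale[OF c hm])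
    also have "(\<lambda>t. ?h (c *\<^sub>R t)) = (\<lambda>t. F n t * cis (t \<bullet> z))"
      by (auto simp: F_def c_def z_def fun_eq_iff)
    finally have 1: "complex_of_real ((2 * pi) ^ CARD('n) * pw n x) = (c ^ CARD('n)) *\<^sub>R (\<integral>t. F n t * cis (t \<bullet> z) \<partial>lborel)" .
    have cn: "c ^ CARD('n) = 1 / real n powr (real CARD('n) / 2)"
      using n by (simp add: c_def power_divide powr_half_sqrt[symmetric] powr_realpow[symmetric] powr_powr)
    have 2: "(2 * pi) ^ CARD('n) * (real n powr (real CARD('n) / 2) * pw n x) = (\<integral>t. F n t * cis (t \<bullet> z) \<partial>lborel)"
    proof -
      have "complex_of_real (real n powr (real CARD('n) / 2)) * complex_of_real ((2 * pi) ^ CARD('n) * pw n x)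
        = complex_of_real (real n powr (real CARD('n) / 2) * c ^ CARD('n)) * (\<integral>t. F n t * cis (t \<bullet> z) \<partial>lborel)"
        unfolding 1 by (simp add: scaleR_conv_of_real)
      also have "real n powr (real CARD('n) / 2) * c ^ CARD('n) = 1" unfolding cn using n by simp
      finally show ?thesis by (simp add: mult_ac)
    qed
    have pp: "(2 * pi) ^ CARD('n) = (2 * pi) powr (real CARD('n) / 2) * (2 * pi) powr (real CARD('n) / 2)"
      by (simp add: powr_add[symmetric] powr_realpow)
    have zz: "z \<bullet> (matrix_inv B *v z) = (real_vec x \<bullet> (matrix_inv B *v real_vec x)) / real n"
    proof -
      have "matrix_inv B *v z = (- c) *\<^sub>R (matrix_inv B *v real_vec x)"
        unfolding z_def by (rule matrix_vector_mult_scaleR)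
      then have "z \<bullet> (matrix_inv B *v z) = (c * c) * (real_vec x \<bullet> (matrix_inv B *v real_vec x))"
        by (simp add: z_def)
      also have "c * c = 1 / real n" using n by (simp add: c_def)
      finally show ?thesis by simp
    qed
    have 3: "complex_of_real ((2 * pi) ^ CARD('n) * gauss n x) = (\<integral>t. of_real (?q t) * cis (t \<bullet> z) \<partial>lborel)"
    proof -
      have "(\<integral>t. of_real (?q t) * cis (t \<bullet> z) \<partial>lborel) = complex_of_real ((2 * pi) powr (real CARD('n) / 2) / sqrt (det B) * exp (- (z \<bullet> (matrix_inv B *v z)) / 2))"
        using integral_gaussian_vec[OF B_pd, of z] by (simp add: scaleR_conv_of_real)
      also have "(2 * pi) powr (real CARD('n) / 2) / sqrt (det B) * exp (- (z \<bullet> (matrix_inv B *v z)) / 2) = (2 * pi) ^ CARD('n) * gauss n x"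
        unfolding pp gauss_def limit_const_def zz by (simp add: mult.commute)
      finally show ?thesis by simp
    qed
    have iFz: "integrable lborel (\<lambda>t. F n t * cis (t \<bullet> z))"
    proof (rule Bochner_Integration.integrable_bound[OF iF[OF n]])
      have [measurable]: "(\<lambda>t :: real ^ 'n. cis (t \<bullet> z)) \<in> borel_measurable borel"
        by (intro borel_measurable_continuous_onI continuous_intros)
      show "(\<lambda>t. F n t * cis (t \<bullet> z)) \<in> borel_measurable lborel" by measurable
    qed (simp add: norm_mult)
    have iqz: "integrable lborel (\<lambda>t. complex_of_real (?q t) * cis (t \<bullet> z))"
      using integrable_gaussian_vec[OF B_pd, of z] by (simp add: scaleR_conv_of_real)
    have "(2 * pi) ^ CARD('n) \<ge> 1" using pi_gt3 by (intro one_le_power) auto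
    then have "\<bar>real n powr (real CARD('n) / 2) * pw n x - gauss n x\<bar>
      \<le> (2 * pi) ^ CARD('n) * \<bar>real n powr (real CARD('n) / 2) * pw n x - gauss n x\<bar>"
      by (simp add: mult_le_cancel_right1)
    also have "\<dots> = norm (complex_of_real ((2 * pi) ^ CARD('n) * (real n powr (real CARD('n) / 2) * pw n x)) - complex_of_real ((2 * pi) ^ CARD('n) * gauss n x))"
      unfolding of_real_diff[symmetric] right_diff_distrib[symmetric] norm_of_real by (simp add: abs_mult)
    also have "\<dots> = norm (\<integral>t. F n t * cis (t \<bullet> z) - of_real (?q t) * cis (t \<bullet> z) \<partial>lborel)"
      unfolding Bochner_Integration.integral_diff[OF iFz iqz] 2[symmetric] 3[symmetric] by simp
    also have "\<dots> \<le> (\<integral>t. norm (F n t * cis (t \<bullet> z) - of_real (?q t) * cis (t \<bullet> z)) \<partial>lborel)"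
      by (rule integral_norm_bound)
    also have "\<dots> = \<epsilon> n"
      unfolding \<epsilon>_def left_diff_distrib[symmetric] norm_mult by simp
    finally show ?thesis .
  qed
  show ?thesis
    unfolding uniform_limit_iff
  proof (intro allI impI)
    fix e :: real assume "e > 0"
    from order_tendstoD(2)[OF eps this] eventually_gt_at_top[of 0]
    show "\<forall>\<^sub>F n in sequentially. \<forall>x\<in>UNIV. dist (real n powr (real CARD('n) / 2) * pw n x - gauss n x) 0 < e"
    proof eventually_elim
      case (elim n)
      then show ?case using bound[of n] by (auto simp: dist_real_def intro: le_less_trans)
    qed
  qed
qed

lemma pw_0_limit: "(\<lambda>n. real n powr (real CARD('n) / 2) * pw n 0) \<longlonglongrightarrow> limit_const"
proof -
  have "(\<lambda>n. real n powr (real CARD('n) / 2) * pw n 0 - gauss n 0) \<longlonglongrightarrow> 0"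
    using tendsto_uniform_limitI[OF local_limit, of 0] by simp
  then show ?thesis by (simp add: gauss_def LIM_zero_cancel)
qed

end

section \<open>Convolution sums with a regularly decaying weight\<close>

lemma summable_Suc_powr:
  assumes "r > 1"
  shows "summable (\<lambda>m. real (Suc m) powr (- r))"
  using assms summable_real_powr_iff[of "- r"] by (subst summable_Suc_iff) simp

text \<open>In \<open>n\<^sup>s (\<Sum>m<n. c\<^bsub>n-1-m\<^esub> h\<^sub>m)\<close> the indices \<open>m < n / 2\<close> are handled by dominated convergence, the weights
  there being comparable to \<open>\<gamma> n\<^bsup>-s\<^esup>\<close>; for the other indices \<open>h\<^sub>m = O(n\<^bsup>-r\<^esup>)\<close>.\<close>

lemma uniform_limit_weighted_sum:
  fixes c :: "nat \<Rightarrow> real" and h :: "nat \<Rightarrow> 'a \<Rightarrow> real"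
  assumes s: "s \<ge> 0" and r: "r > 1" and c: "\<And>j. c j \<ge> 0"
    and lim: "(\<lambda>n. real n powr s * c n) \<longlonglongrightarrow> \<gamma>"
    and h: "\<And>m x. \<bar>h m x\<bar> \<le> K * real (Suc m) powr (- r)"
    and tail: "(\<lambda>n. real n powr (s - r) * (\<Sum>j<n. c j)) \<longlonglongrightarrow> 0"
  shows "uniform_limit UNIV (\<lambda>n x. real n powr s * (\<Sum>m<n. c (n - 1 - m) * h m x)) (\<lambda>x. \<gamma> * (\<Sum>m. h m x)) sequentially"
proof -
  define a where "a m n = (if 2 * m < n then real n powr s * c (n - 1 - m) else 0)" for m n
  have K: "K \<ge> 0"
  proof -
    have "0 \<le> \<bar>h 0 undefined\<bar>" by simp
    also have "\<dots> \<le> K" using h[of 0 undefined] by simp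
    finally show ?thesis .
  qed
  define M where "M m = K * real (Suc m) powr (- r)" for m
  have M: "summable M" unfolding M_def by (intro summable_mult summable_Suc_powr r)
  have M0: "M m \<ge> 0" for m using K by (simp add: M_def)
  have lim': "(\<lambda>k. real (Suc k) powr s * c k) \<longlonglongrightarrow> \<gamma>"
  proof -
    have "(\<lambda>k. (real (Suc k) / real k) powr s * (real k powr s * c k)) \<longlonglongrightarrow> 1 powr s * \<gamma>"
    proof (intro tendsto_mult lim tendsto_powr)
      show "(\<lambda>k. real (Suc k) / real k) \<longlonglongrightarrow> 1" by real_asymp
    qed auto
    moreover have "\<forall>\<^sub>F k in sequentially. (real (Suc k) / real k) powr s * (real k powr s * c k) = real (Suc k) powr s * c k"
      using eventually_gt_at_top[of 0] by eventually_elim (simp add: powr_divide)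
    ultimately have "(\<lambda>k. real (Suc k) powr s * c k) \<longlonglongrightarrow> 1 powr s * \<gamma>"
      by (rule Lim_transform_eventually)
    then show ?thesis by simp
  qed
  then obtain A where A: "\<And>k. \<bar>real (Suc k) powr s * c k\<bar> \<le> A"
    using convergent_imp_Bseq[OF convergentI[OF lim']] by (auto simp: Bseq_def)
  have A0: "A \<ge> 0" using A[of 0] by linarith
  have a_bound: "\<bar>a m n\<bar> \<le> 2 powr s * A" for m n
  proof (cases "2 * m < n")
    case True
    define k where "k = n - 1 - m"
    have "real n \<le> 2 * real (Suc k)" using True by (simp add: k_def)
    then have "real n powr s \<le> (2 * real (Suc k)) powr s" using s by (intro powr_mono2) auto
    then have "real n powr s * c k \<le> 2 powr s * real (Suc k) powr s * c k"
      using c[of k] powr_mult[of 2 "real (Suc k)" s] by (intro mult_right_mono) auto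
    also have "\<dots> \<le> 2 powr s * A" using A[of k] by (simp add: mult.assoc)
    finally show ?thesis using True c[of k] by (simp add: a_def k_def)
  qed (simp add: a_def A0)
  have a_lim: "(\<lambda>n. a m n) \<longlonglongrightarrow> \<gamma>" for m
  proof -
    have "(\<lambda>n. (real (n + (m + 1)) / real (Suc n)) powr s * (real (Suc n) powr s * c n)) \<longlonglongrightarrow> 1 powr s * \<gamma>"
    proof (intro tendsto_mult lim' tendsto_powr)
      show "(\<lambda>n. real (n + (m + 1)) / real (Suc n)) \<longlonglongrightarrow> 1" by real_asymp
    qed auto
    moreover have "\<forall>\<^sub>F n in sequentially. (real (n + (m + 1)) / real (Suc n)) powr s * (real (Suc n) powr s * c n) = a m (n + (m + 1))"
      using eventually_gt_at_top[of m] by eventually_elim (simp add: a_def powr_divide add_ac)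
    ultimately have "(\<lambda>n. a m (n + (m + 1))) \<longlonglongrightarrow> 1 powr s * \<gamma>"
      by (rule Lim_transform_eventually)
    then have "(\<lambda>n. a m (n + (m + 1))) \<longlonglongrightarrow> \<gamma>" by simp
    then show ?thesis by (rule LIMSEQ_offset)
  qed
  \<comment> \<open>The error of the early indices, together with the missing tail of the limit series, and that of the late ones.\<close>
  define \<epsilon>1 where "\<epsilon>1 n = (\<Sum>m. \<bar>a m n - \<gamma>\<bar> * M m)" for n
  define \<epsilon>2 where "\<epsilon>2 n = K * 2 powr r * (real n powr (s - r) * (\<Sum>j<n. c j))" for n
  have M2: "summable (\<lambda>m. (2 powr s * A + \<bar>\<gamma>\<bar>) * M m)" by (intro summable_mult M)
  have b1: "\<bar>a m n - \<gamma>\<bar> * M m \<le> (2 powr s * A + \<bar>\<gamma>\<bar>) * M m" for m n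
    using a_bound[of m n] M0[of m] by (intro mult_right_mono) linarith+
  have e1: "\<epsilon>1 \<longlonglongrightarrow> 0"
  proof -
    have "((\<lambda>n. suminf (\<lambda>m. \<bar>a m n - \<gamma>\<bar> * M m)) \<longlongrightarrow> suminf (\<lambda>m. \<bar>\<gamma> - \<gamma>\<bar> * M m)) sequentially"
    proof (rule tannerys_theorem[THEN conjunct2, THEN conjunct2])
      show "(\<lambda>n. \<bar>a m n - \<gamma>\<bar> * M m) \<longlonglongrightarrow> \<bar>\<gamma> - \<gamma>\<bar> * M m" for m
        by (intro tendsto_intros a_lim)
      show "\<forall>\<^sub>F (m, n) in at_top \<times>\<^sub>F sequentially. norm (\<bar>a m n - \<gamma>\<bar> * M m) \<le> (2 powr s * A + \<bar>\<gamma>\<bar>) * M m"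
      proof (intro always_eventually allI, clarify)
        show "norm (\<bar>a m n - \<gamma>\<bar> * M m) \<le> (2 powr s * A + \<bar>\<gamma>\<bar>) * M m" for m n
          using b1[of m n] M0[of m] by (simp add: abs_mult)
      qed
    qed (use M2 in auto)
    then show ?thesis by (simp add: \<epsilon>1_def[abs_def])
  qed
  have e2: "\<epsilon>2 \<longlonglongrightarrow> 0" unfolding \<epsilon>2_def[abs_def] using tendsto_mult_left[OF tail, of "K * 2 powr r"] by simp
  have sh: "summable (\<lambda>m. h m x)" for x
  proof (rule summable_comparison_test'[OF M, of 0])
    show "norm (h m x) \<le> M m" for m using h[of m x] by (simp add: M_def)
  qed
  have bound: "\<bar>real n powr s * (\<Sum>m<n. c (n - 1 - m) * h m x) - \<gamma> * (\<Sum>m. h m x)\<bar> \<le> \<epsilon>1 n + \<epsilon>2 n" if n: "n > 0" for n x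
  proof -
    let ?I = "{m. m < n \<and> 2 * m < n}" and ?J = "{m. m < n \<and> \<not> 2 * m < n}"
    have fin: "finite ?I" "finite ?J" by auto
    have un: "{..<n} = ?I \<union> ?J" "?I \<inter> ?J = {}" by auto
    have sa: "(\<Sum>m\<in>?I. a m n * h m x) = (\<Sum>m. a m n * h m x)"
      by (rule suminf_finite[symmetric]) (auto simp: a_def)
    have ssa: "summable (\<lambda>m. a m n * h m x)"
      by (rule summable_finite[of ?I]) (auto simp: a_def)
    have eq1: "real n powr s * (\<Sum>m<n. c (n - 1 - m) * h m x)
       = (\<Sum>m\<in>?I. a m n * h m x) + (\<Sum>m\<in>?J. real n powr s * c (n - 1 - m) * h m x)"
      unfolding un(1) sum_distrib_left sum.union_disjoint[OF fin un(2)]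
      by (simp add: a_def mult.assoc distrib_left sum_distrib_left)
    have eq2: "(\<Sum>m\<in>?I. a m n * h m x) - \<gamma> * (\<Sum>m. h m x) = (\<Sum>m. (a m n - \<gamma>) * h m x)"
      unfolding sa left_diff_distrib using suminf_diff[OF ssa summable_mult[OF sh[of x], of \<gamma>]] suminf_mult[OF sh[of x], of \<gamma>] by simp
    have eq: "real n powr s * (\<Sum>m<n. c (n - 1 - m) * h m x) - \<gamma> * (\<Sum>m. h m x)
      = (\<Sum>m. (a m n - \<gamma>) * h m x) + (\<Sum>m\<in>?J. real n powr s * c (n - 1 - m) * h m x)"
      using eq1 eq2 by linarith
    have s1: "summable (\<lambda>m. \<bar>a m n - \<gamma>\<bar> * M m)"
    proof (rule summable_comparison_test'[OF M2, of 0])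
      show "norm (\<bar>a m n - \<gamma>\<bar> * M m) \<le> (2 powr s * A + \<bar>\<gamma>\<bar>) * M m" for m
        using b1[of m n] M0[of m] by (simp add: abs_mult)
    qed
    have d: "\<bar>(a m n - \<gamma>) * h m x\<bar> \<le> \<bar>a m n - \<gamma>\<bar> * M m" for m
      using h[of m x] by (simp add: abs_mult M_def mult_left_mono)
    have s2: "summable (\<lambda>m. \<bar>(a m n - \<gamma>) * h m x\<bar>)"
    proof (rule summable_comparison_test'[OF s1, of 0])
      show "norm \<bar>(a m n - \<gamma>) * h m x\<bar> \<le> \<bar>a m n - \<gamma>\<bar> * M m" for m
        using d[of m] by simp
    qed
    have "\<bar>\<Sum>m. (a m n - \<gamma>) * h m x\<bar> \<le> (\<Sum>m. \<bar>(a m n - \<gamma>) * h m x\<bar>)" by (rule summable_rabs[OF s2])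
    also have "\<dots> \<le> \<epsilon>1 n" unfolding \<epsilon>1_def by (intro suminf_le d s1 s2)
    finally have 1: "\<bar>\<Sum>m. (a m n - \<gamma>) * h m x\<bar> \<le> \<epsilon>1 n" .
    have "\<bar>\<Sum>m\<in>?J. real n powr s * c (n - 1 - m) * h m x\<bar> \<le> (\<Sum>m\<in>?J. \<bar>real n powr s * c (n - 1 - m) * h m x\<bar>)"
      by (rule sum_abs)
    also have "\<dots> \<le> (\<Sum>m\<in>?J. real n powr s * c (n - 1 - m) * (K * 2 powr r * real n powr (- r)))"
    proof (rule sum_mono)
      fix m assume m: "m \<in> ?J"
      have "real (Suc m) powr (- r) \<le> (real n / 2) powr (- r)"
        using m n r by (intro powr_mono2') auto
      also have "\<dots> = 2 powr r * real n powr (- r)" using n by (simp add: powr_divide powr_minus_divide)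
      finally have "\<bar>h m x\<bar> \<le> K * (2 powr r * real n powr (- r))"
        using h[of m x] K by (meson mult_left_mono order_trans)
      then show "\<bar>real n powr s * c (n - 1 - m) * h m x\<bar> \<le> real n powr s * c (n - 1 - m) * (K * 2 powr r * real n powr (- r))"
        using c[of "n - 1 - m"] by (simp add: abs_mult mult_left_mono mult.assoc)
    qed
    also have "\<dots> \<le> (\<Sum>m<n. real n powr s * c (n - 1 - m) * (K * 2 powr r * real n powr (- r)))"
      using c K by (intro sum_mono2) auto
    also have "\<dots> = K * 2 powr r * (real n powr s * real n powr (- r)) * (\<Sum>m<n. c (n - 1 - m))"
      by (simp add: sum_distrib_left mult_ac)
    also have "(\<Sum>m<n. c (n - 1 - m)) = (\<Sum>j<n. c j)"
      using sum.nat_diff_reindex[of c n] by simp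
    also have "real n powr s * real n powr (- r) = real n powr (s - r)" by (simp add: powr_add[symmetric])
    finally have 2: "\<bar>\<Sum>m\<in>?J. real n powr s * c (n - 1 - m) * h m x\<bar> \<le> \<epsilon>2 n" by (simp add: \<epsilon>2_def mult_ac)
    show ?thesis unfolding eq using 1 2 by linarith
  qed
  have "(\<lambda>n. \<epsilon>1 n + \<epsilon>2 n) \<longlonglongrightarrow> 0" using tendsto_add[OF e1 e2] by simp
  show ?thesis
    unfolding uniform_limit_iff
  proof (intro allI impI)
    fix e :: real assume "e > 0"
    from order_tendstoD(2)[OF \<open>(\<lambda>n. \<epsilon>1 n + \<epsilon>2 n) \<longlonglongrightarrow> 0\<close> this] eventually_gt_at_top[of 0]
    show "\<forall>\<^sub>F n in sequentially. \<forall>x\<in>UNIV. dist (real n powr s * (\<Sum>m<n. c (n - 1 - m) * h m x)) (\<gamma> * (\<Sum>m. h m x)) < e"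
    proof eventually_elim
      case (elim n)
      then show ?case using bound[of n] by (auto simp: dist_real_def intro: le_less_trans)
    qed
  qed
qed

section \<open>The walk perturbed at the origin\<close>

lemma lattice_conv_add_right:
  fixes f g h :: "int ^ 'n \<Rightarrow> real"
  assumes "f summable_on UNIV" "g summable_on UNIV" "h summable_on UNIV"
  shows "lattice_conv f (\<lambda>x. g x + h x) x = lattice_conv f g x + lattice_conv f h x"
  unfolding lattice_conv_def distrib_left
  by (intro infsum_add lattice_conv_summand assms)

lemma lattice_conv_add_left:
  fixes f g h :: "int ^ 'n \<Rightarrow> real"
  assumes "f summable_on UNIV" "g summable_on UNIV" "h summable_on UNIV"
  shows "lattice_conv (\<lambda>x. f x + g x) h x = lattice_conv f h x + lattice_conv g h x"
  unfolding lattice_conv_def distrib_right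
  by (intro infsum_add lattice_conv_summand assms)

lemma lattice_conv_cmult_right: "lattice_conv f (\<lambda>x. c * g x) x = c * lattice_conv f g x"
  unfolding lattice_conv_def by (simp only: infsum_cmult_right'[symmetric] mult.left_commute)

lemma lattice_conv_cmult_left: "lattice_conv (\<lambda>x. c * f x) g x = c * lattice_conv f g x"
  unfolding lattice_conv_def by (simp only: infsum_cmult_right'[symmetric] mult.assoc)

lemma lattice_conv_sum_right:
  fixes f :: "int ^ 'n \<Rightarrow> real" and g :: "'i \<Rightarrow> int ^ 'n \<Rightarrow> real"
  assumes "finite I" "f summable_on UNIV" "\<And>i. i \<in> I \<Longrightarrow> g i summable_on UNIV"
  shows "lattice_conv f (\<lambda>x. \<Sum>i\<in>I. c i * g i x) x = (\<Sum>i\<in>I. c i * lattice_conv f (g i) x)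
    \<and> (\<lambda>x. \<Sum>i\<in>I. c i * g i x) summable_on UNIV"
  using assms(1,3)
proof (induction I rule: finite_induct)
  case empty
  then show ?case by (simp add: lattice_conv_def)
next
  case (insert i I)
  then show ?case
    using assms(2) by (simp add: lattice_conv_add_right lattice_conv_cmult_right summable_on_add summable_on_cmult_right)
qed

lemma lattice_conv_delta_right: "lattice_conv f (\<lambda>x. of_bool (x = 0)) x = f x"
proof -
  have "lattice_conv f (\<lambda>x. of_bool (x = 0)) x = (\<Sum>\<^sub>\<infinity>y\<in>{x}. f y)"
    unfolding lattice_conv_def by (rule infsum_cong_neutral) auto
  then show ?thesis by simp
qed

lemma odd_fun_conv:
  assumes "odd_fun f" "\<And>x. g (- x) = g x"
  shows "odd_fun (lattice_conv f g)"
  unfolding odd_fun_def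
proof
  fix x
  have "lattice_conv f g (- x) = (\<Sum>\<^sub>\<infinity>y. f (- y) * g (- x - (- y)))"
    unfolding lattice_conv_def
    by (rule infsum_reindex_bij_betw[symmetric]) (auto intro!: bij_betw_byWitness[where f' = uminus])
  also have "\<dots> = (\<Sum>\<^sub>\<infinity>y. - (f y * g (x - y)))"
    using assms(1) assms(2)[of "x - _"] by (simp add: odd_fun_def)
  finally show "lattice_conv f g (- x) = - lattice_conv f g x"
    by (simp add: lattice_conv_def infsum_uminus)
qed

lemma odd_fun_0: "odd_fun f \<Longrightarrow> f 0 = (0 :: real)"
  unfolding odd_fun_def by (metis equation_minus_iff neg_equal_zero minus_zero)

context symmetric_walk
begin

text \<open>The contribution of the local drift \<open>f\<close> at the origin to the law at time \<open>n\<close>.\<close>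

definition drift_sum :: "(int ^ 'n \<Rightarrow> real) \<Rightarrow> nat \<Rightarrow> int ^ 'n \<Rightarrow> real" where
  "drift_sum f n x = (\<Sum>m<n. pw (n - 1 - m) 0 * lattice_conv f (pw m) x)"

lemma drift_sum_summable:
  assumes "f summable_on UNIV"
  shows "drift_sum f n summable_on UNIV"
  unfolding drift_sum_def[abs_def]
  using lattice_conv_sum_right[of "{..<n}" p "\<lambda>m. lattice_conv f (pw m)"] p_summable assms pw_summable
  by (simp add: lattice_conv_summable)

lemma drift_sum_Suc:
  assumes f: "f summable_on UNIV"
  shows "drift_sum f (Suc n) x = lattice_conv p (drift_sum f n) x + pw n 0 * f x"
proof -
  have "drift_sum f (Suc n) x = pw n 0 * lattice_conv f (pw 0) x + (\<Sum>m<n. pw (n - Suc m) 0 * lattice_conv f (pw (Suc m)) x)"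
    unfolding drift_sum_def by (subst sum.lessThan_Suc_shift) simp
  also have "lattice_conv f (pw 0) x = f x" by (simp add: lattice_conv_delta_right)
  also have "(\<Sum>m<n. pw (n - Suc m) 0 * lattice_conv f (pw (Suc m)) x) = (\<Sum>m<n. pw (n - Suc m) 0 * lattice_conv p (lattice_conv f (pw m)) x)"
    using conv_power_Suc_right[OF f p_summable] by simp
  also have "\<dots> = lattice_conv p (drift_sum f n) x"
    unfolding drift_sum_def[abs_def]
    using lattice_conv_sum_right[of "{..<n}" p "\<lambda>m. lattice_conv f (pw m)"] p_summable f pw_summable
    by (simp add: lattice_conv_summable)
  finally show ?thesis by simp
qed

lemma drift_sum_lincomb:
  assumes f: "f summable_on UNIV" and g: "g summable_on UNIV"
  shows "drift_sum (\<lambda>x. f x + c * g x) n x = drift_sum f n x + c * drift_sum g n x"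
  unfolding drift_sum_def
  by (subst lattice_conv_add_left, (intro f summable_on_cmult_right g pw_summable)+)
     (simp add: lattice_conv_cmult_left distrib_left sum.distrib sum_distrib_left mult_ac)

lemma drift_sum_odd: "odd_fun f \<Longrightarrow> odd_fun (drift_sum f n)"
  using odd_fun_conv[of f "pw _"] by (simp add: odd_fun_def drift_sum_def sum_negf pw_sym)

text \<open>Since \<open>a\<close> is odd and the walk symmetric, the drift leaves the return probabilities
  unchanged; this is why the recursion has an explicit solution.\<close>

lemma perturbed_recursion_solution:
  fixes P :: "nat \<Rightarrow> int ^ 'n \<Rightarrow> real"
  assumes a: "a summable_on UNIV" "odd_fun a"
    and P0: "P 0 = (\<lambda>x. of_bool (x = 0))"
    and PS: "\<And>n x. P (Suc n) x = lattice_conv p (P n) x + P n 0 * a x"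
  shows "P n x = pw n x + drift_sum a n x"
proof (induction n arbitrary: x)
  case 0
  then show ?case by (simp add: P0 drift_sum_def)
next
  case (Suc n)
  have Pn: "P n = (\<lambda>x. pw n x + drift_sum a n x)" using Suc.IH by auto
  have P0: "P n 0 = pw n 0" unfolding Pn using odd_fun_0[OF drift_sum_odd[OF a(2)]] by simp
  have "P (Suc n) x = lattice_conv p (P n) x + pw n 0 * a x" by (simp add: PS P0)
  also have "lattice_conv p (P n) x = pw (Suc n) x + lattice_conv p (drift_sum a n) x"
    unfolding Pn by (simp add: lattice_conv_add_right p_summable pw_summable drift_sum_summable a)
  finally show ?case by (simp add: drift_sum_Suc a)
qed

lemma pw_0_sum_tail_1:
  assumes "CARD('n) \<ge> 2"
  shows "(\<lambda>n. real n powr (- 1 / 2) * (\<Sum>j<n. pw j 0)) \<longlonglongrightarrow> 0"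
proof (rule Lim_null_comparison)
  define C where "C = coeff_const 0"
  have C: "C \<ge> 0" by (simp add: C_def coeff_const_nonneg)
  have b: "pw j 0 \<le> C * inverse (real (Suc j))" for j
  proof -
    have "real (Suc j) powr (- real CARD('n) / 2) \<le> real (Suc j) powr (- 1)"
      using assms by (intro powr_mono) auto
    then show ?thesis using pw_bound[of j 0] C by (smt (verit) C_def mult_left_mono of_nat_0_le_iff powr_minus powr_one)
  qed
  have "(\<Sum>j<n. pw j 0) \<le> C * harm n" for n
  proof -
    have "(\<Sum>j<n. pw j 0) \<le> (\<Sum>j<n. C * inverse (real (Suc j)))" by (intro sum_mono b)
    also have "\<dots> = C * harm n" by (simp add: harm_altdef sum_distrib_left)
    finally show ?thesis .
  qed
  then show "\<forall>\<^sub>F n in sequentially. norm (real n powr (- 1 / 2) * (\<Sum>j<n. pw j 0)) \<le> C * (real n powr (- 1 / 2) * harm n)"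
    using mult_left_mono[OF _ powr_ge_zero]
    by (intro always_eventually allI) (simp add: abs_mult sum_nonneg pw_nonneg mult.left_commute[of C])
  have "(\<lambda>n. real n powr (- 1 / 2) * (harm n - ln (real n)) + real n powr (- 1 / 2) * ln (real n)) \<longlonglongrightarrow> 0 * euler_mascheroni + 0"
  proof (intro tendsto_intros euler_mascheroni_LIMSEQ)
    show "(\<lambda>n. real n powr (- 1 / 2)) \<longlonglongrightarrow> 0" by real_asymp
    show "(\<lambda>n. real n powr (- 1 / 2) * ln (real n)) \<longlonglongrightarrow> 0" by real_asymp
  qed
  then have "(\<lambda>n. real n powr (- 1 / 2) * harm n) \<longlonglongrightarrow> 0" by (simp add: algebra_simps)
  then show "(\<lambda>n. C * (real n powr (- 1 / 2) * harm n)) \<longlonglongrightarrow> 0" by (rule tendsto_mult_right_zero)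
qed

lemma pw_0_sum_tail_3: "(\<lambda>n. real n powr (- 3 / 2) * (\<Sum>j<n. pw j 0)) \<longlonglongrightarrow> 0"
proof (rule Lim_null_comparison)
  define C where "C = coeff_const 0"
  have b: "pw j 0 \<le> C" for j
  proof -
    have "real (Suc j) powr (- real CARD('n) / 2) \<le> real (Suc j) powr 0" by (intro powr_mono) auto
    then have "C * real (Suc j) powr (- real CARD('n) / 2) \<le> C * 1"
      by (intro mult_left_mono) (auto simp: C_def coeff_const_nonneg)
    then show ?thesis using pw_bound[of j 0] by (simp add: C_def)
  qed
  have "(\<Sum>j<n. pw j 0) \<le> C * real n" for n
    using sum_mono[of "{..<n}" "\<lambda>j. pw j 0" "\<lambda>_. C"] b by (simp add: mult.commute)
  then show "\<forall>\<^sub>F n in sequentially. norm (real n powr (- 3 / 2) * (\<Sum>j<n. pw j 0)) \<le> C * (real n powr (- 3 / 2) * real n)"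
    using mult_left_mono[OF _ powr_ge_zero]
    by (intro always_eventually allI) (simp add: abs_mult sum_nonneg pw_nonneg mult.left_commute[of C])
  have "(\<lambda>n. real n powr (- 3 / 2) * real n) \<longlonglongrightarrow> 0" by real_asymp
  then show "(\<lambda>n. C * (real n powr (- 3 / 2) * real n)) \<longlonglongrightarrow> 0" by (rule tendsto_mult_right_zero)
qed

text \<open>With \<open>r = (\<nu>+k)/2\<close> the condition on the dimension ensures both \<open>r > 1\<close> and that
  \<open>n\<^bsup>-k/2\<^esup> (\<Sum>j<n. p\<^sub>j(0))\<close> tends to \<open>0\<close>. The sum grows at most linearly, and at most
  logarithmically if \<open>\<nu> \<ge> 2\<close>.\<close>

lemma drift_sum_limit:
  fixes f :: "int ^ 'n \<Rightarrow> real"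
  assumes f: "f summable_on UNIV" and K: "K \<ge> 0"
    and bound: "\<And>l. l \<in> torus \<Longrightarrow> norm (char_fun f l) \<le> K * norm l ^ k"
    and dim: "CARD('n) \<ge> 2 \<and> k = 1 \<or> k = 3"
  shows "uniform_limit UNIV (\<lambda>n x. real n powr (real CARD('n) / 2) * drift_sum f n x)
      (\<lambda>x. limit_const * (\<Sum>m. lattice_conv f (pw m) x)) sequentially"
    and "summable (\<lambda>m. \<bar>lattice_conv f (pw m) x\<bar>)"
proof -
  define r where "r = (real CARD('n) + real k) / 2"
  have "CARD('n) \<ge> 1" by (simp add: Suc_leI)
  then have r: "r > 1" using dim by (auto simp: r_def)
  have e: "real CARD('n) / 2 - r = - real k / 2" by (simp add: r_def field_simps)
  have t: "(\<lambda>n. real n powr (real CARD('n) / 2 - r) * (\<Sum>j<n. pw j 0)) \<longlonglongrightarrow> 0"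
    unfolding e using dim pw_0_sum_tail_1 pw_0_sum_tail_3 by auto
  have h: "\<bar>lattice_conv f (pw m) x\<bar> \<le> coeff_const k * K * real (Suc m) powr (- r)" for m x
  proof -
    have "- (real CARD('n) + real k) / 2 = - r" unfolding r_def by linarith
    then show ?thesis using conv_pw_bound[OF f K bound, of m x] by metis
  qed
  show "uniform_limit UNIV (\<lambda>n x. real n powr (real CARD('n) / 2) * drift_sum f n x)
      (\<lambda>x. limit_const * (\<Sum>m. lattice_conv f (pw m) x)) sequentially"
    unfolding drift_sum_def
    by (rule uniform_limit_weighted_sum[OF _ r pw_nonneg pw_0_limit h t]) simp
  show "summable (\<lambda>m. \<bar>lattice_conv f (pw m) x\<bar>)"
    by (rule summable_comparison_test'[OF summable_mult[OF summable_Suc_powr[OF r]], of 0]) (use h[of _ x] in simp)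
qed

end

section \<open>Spatial decay of the drift contribution\<close>

lemma abs_moment_coord_mult_le:
  fixes f :: "int ^ 'n \<Rightarrow> real"
  assumes "has_moment (Suc k) f"
  shows "abs_moment k (coord_mult j f) \<le> abs_moment (Suc k) f"
  unfolding abs_moment_def
proof (rule infsum_mono)
  show "(\<lambda>x. norm (real_vec x) ^ k * \<bar>coord_mult j f x\<bar>) summable_on UNIV"
    by (rule has_moment_abs_summable, rule has_moment_coord_mult, rule assms)
  show "(\<lambda>x. norm (real_vec x) ^ Suc k * \<bar>f x\<bar>) summable_on UNIV"
    by (rule has_moment_abs_summable, rule assms)
  show "norm (real_vec x) ^ k * \<bar>coord_mult j f x\<bar> \<le> norm (real_vec x) ^ Suc k * \<bar>f x\<bar>" for x
    using mult_right_mono[OF coord_le_norm[of x j], of "norm (real_vec x) ^ k * \<bar>f x\<bar>"]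
    by (simp add: coord_mult_def abs_mult mult_ac)
qed

lemma coord_mult_delta: "coord_mult j (\<lambda>x. of_bool (x = 0)) = (\<lambda>x. 0)"
  by (auto simp: coord_mult_def fun_eq_iff)

lemma coord_mult_add: "coord_mult j (\<lambda>x. f x + g x) = (\<lambda>x. coord_mult j f x + coord_mult j g x)"
  by (simp add: coord_mult_def distrib_left fun_eq_iff)

lemma char_fun_zero: "char_fun (\<lambda>x. 0) l = 0"
  by (simp add: char_fun_cis)

context symmetric_walk
begin

definition shift_const :: real where
  "shift_const = exp (decay_rate * (real CARD('n) * pi)\<^sup>2)"

text \<open>Replacing \<open>m\<close> by \<open>m + 1\<close> in the Gaussian bound costs a constant factor on the torus.\<close>

lemma exp_shift:
  assumes "l \<in> torus"
  shows "exp (- decay_rate * real m * (norm (l :: real ^ 'n))\<^sup>2) \<le> shift_const * exp (- decay_rate * real (Suc m) * (norm l)\<^sup>2)"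
proof -
  have "decay_rate * (norm l)\<^sup>2 \<le> decay_rate * (real CARD('n) * pi)\<^sup>2"
    using norm_le_on_torus[OF assms] decay_rate_pos by (intro mult_left_mono power_mono) auto
  then show ?thesis
    unfolding shift_const_def exp_add[symmetric] by (simp add: algebra_simps)
qed

lemma shift_const_pos: "shift_const > 0"
  by (simp add: shift_const_def)

lemma coord_p: "coord_mult j p summable_on UNIV" "has_moment 3 (coord_mult j p)" "odd_fun (coord_mult j p)"
  using has_moment_coord_mult[of 3 p j] p_moment
  by (auto simp: has_moment_summable odd_fun_def coord_mult_def p_sym)

lemma coord_p_bound: "norm (char_fun (coord_mult j p) l) \<le> abs_moment 2 p * norm l"
proof -
  have "norm (char_fun (coord_mult j p) l) \<le> abs_moment 1 (coord_mult j p) * norm l"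
    by (rule char_fun_bound_1, rule has_moment_mono[OF coord_p(2)]) (simp_all add: coord_p)
  also have "\<dots> \<le> abs_moment 2 p * norm l"
    using abs_moment_coord_mult_le[of 1 p j] has_moment_mono[OF p_moment, of 2]
    by (intro mult_right_mono) (auto simp: numeral_2_eq_2)
  finally show ?thesis .
qed

lemma coord_pw_summable: "coord_mult j (pw m) summable_on UNIV"
proof (induction m)
  case (Suc m)
  then show ?case using coord_mult_conv(2)[of p j "pw m"] p_summable coord_p pw_summable by simp
qed (simp add: coord_mult_delta)

text \<open>Multiplication by a coordinate corresponds to differentiation on the Fourier side; the chain rule
  appears here as an induction over the derivation rule \<open>coord_mult_conv\<close>.\<close>

lemma char_fun_coord_pw_Suc:
  "char_fun (coord_mult j (pw (Suc m))) l = of_nat (Suc m) * char_fun (coord_mult j p) l * char_fun p l ^ m"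
proof (induction m)
  case 0
  show ?case
    using coord_mult_conv(1)[of p j "pw 0"] p_summable coord_p pw_summable[of 0] coord_pw_summable[of j 0]
    by (simp add: char_fun_add lattice_conv_summable char_fun_conv coord_mult_delta char_fun_delta char_fun_zero)
next
  case (Suc m)
  have "char_fun (coord_mult j (pw (Suc (Suc m)))) l
     = char_fun (coord_mult j p) l * char_fun p l ^ Suc m + char_fun p l * char_fun (coord_mult j (pw (Suc m))) l"
    using coord_mult_conv(1)[of p j "pw (Suc m)"] p_summable coord_p pw_summable[of "Suc m"] coord_pw_summable[of j "Suc m"]
      char_fun_conv_power[OF p_summable, of "Suc m"]
    by (simp add: char_fun_add lattice_conv_summable char_fun_conv)
  then show ?case unfolding Suc.IH by (simp add: algebra_simps)
qed

lemma char_fun_coord_pw_bound: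
  assumes l: "l \<in> torus"
  shows "norm (char_fun (coord_mult j (pw m)) l)
    \<le> abs_moment 2 p * shift_const * (real m * norm l * exp (- decay_rate * real m * (norm l)\<^sup>2))"
proof (cases m)
  case (Suc m')
  have "norm (char_fun (coord_mult j (pw m)) l) = real m * norm (char_fun (coord_mult j p) l) * norm (char_fun p l ^ m')"
    unfolding Suc char_fun_coord_pw_Suc norm_mult norm_of_nat ..
  also have "\<dots> \<le> real m * (abs_moment 2 p * norm l) * (shift_const * exp (- decay_rate * real m * (norm l)\<^sup>2))"
    unfolding Suc
    by (intro mult_mono coord_p_bound order_trans[OF char_fun_power_decay[OF l] exp_shift[OF l]]) (auto simp: abs_moment_nonneg)
  finally show ?thesis by (simp add: mult_ac)
qed (simp add: coord_mult_delta char_fun_zero)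

end

section \<open>Dimension one\<close>

lemma sum_even_upto: "(\<Sum>x\<in>{1..<int n}. 2 * x) = int n * (int n - 1)"
proof (induction n)
  case (Suc n)
  show ?case
  proof (cases "n = 0")
    case False
    have "{1..<int (Suc n)} = insert (int n) {1..<int n}" using False by auto
    then show ?thesis using Suc by (simp add: algebra_simps)
  qed simp
qed simp

lemma sgn_difference_sum_nonneg:
  fixes N :: int
  assumes "N \<ge> 0"
  shows "(\<Sum>x\<in>{-N..N}. (sgn x - sgn (x - N)) * x) = N\<^sup>2"
proof (cases "N = 0")
  case False
  with assms have N: "N > 0" by simp
  have eq: "{-N..N} = insert N ({-N..0} \<union> {1..<N})" using N by auto
  have "(\<Sum>x\<in>{-N..N}. (sgn x - sgn (x - N)) * x)
    = (\<Sum>x\<in>{-N..0}. (sgn x - sgn (x - N)) * x) + (\<Sum>x\<in>{1..<N}. (sgn x - sgn (x - N)) * x) + N"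
    using N by (subst eq, subst sum.insert, simp, simp, subst sum.union_disjoint) auto
  also have "(\<Sum>x\<in>{-N..0}. (sgn x - sgn (x - N)) * x) = 0"
    by (rule sum.neutral) (use N in \<open>auto simp: sgn_if\<close>)
  also have "(\<Sum>x\<in>{1..<N}. (sgn x - sgn (x - N)) * x) = (\<Sum>x\<in>{1..<int (nat N)}. 2 * x)"
    using N by (intro sum.cong) (auto simp: sgn_if)
  also have "\<dots> = N * (N - 1)" unfolding sum_even_upto using N by simp
  finally show ?thesis by (simp add: power2_eq_square algebra_simps)
qed simp

lemma sgn_difference_sum:
  fixes N :: int
  shows "(\<Sum>x\<in>{-\<bar>N\<bar>..\<bar>N\<bar>}. (sgn x - sgn (x - N)) * x) = N\<^sup>2"
proof (cases "N \<ge> 0")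
  case True
  then show ?thesis using sgn_difference_sum_nonneg[of N] by simp
next
  case False
  have "(\<Sum>x\<in>{-\<bar>N\<bar>..\<bar>N\<bar>}. (sgn x - sgn (x - N)) * x) = (\<Sum>x\<in>{-\<bar>N\<bar>..\<bar>N\<bar>}. (sgn (- x) - sgn (- x - N)) * (- x))"
    by (rule sum.reindex_bij_witness[of _ uminus uminus]) auto
  also have "\<dots> = (\<Sum>x\<in>{-\<bar>N\<bar>..\<bar>N\<bar>}. (sgn x - sgn (x - (- N))) * x)"
    by (intro sum.cong refl) (auto simp: sgn_if)
  also have "\<dots> = N\<^sup>2" using sgn_difference_sum_nonneg[of "- N"] False by simp
  finally show ?thesis .
qed

lemma cos_bound_quadratic: "2 - 2 * cos t \<le> (t :: real)\<^sup>2"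
proof -
  have "2 - 2 * cos t = 4 * (sin (t / 2))\<^sup>2"
    using cos_double_sin[of "t / 2"] by simp
  also have "\<dots> \<le> 4 * (t / 2)\<^sup>2"
    using iffD1[OF abs_le_square_iff abs_sin_x_le_abs_x[of "t / 2"]] by linarith
  finally show ?thesis by (simp add: power_divide)
qed

lemma uniform_limit_zero_bound:
  fixes f g :: "nat \<Rightarrow> 'a \<Rightarrow> real"
  assumes f: "uniform_limit A f (\<lambda>_. 0) sequentially"
    and g: "\<And>n x. x \<in> A \<Longrightarrow> \<bar>g n x\<bar> \<le> C * \<bar>f n x\<bar>"
  shows "uniform_limit A g (\<lambda>_. 0) sequentially"
  unfolding uniform_limit_iff
proof (intro allI impI)
  fix e :: real assume e: "e > 0"
  define C' where "C' = \<bar>C\<bar> + 1"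
  have C': "C' > 0" by (simp add: C'_def)
  from f e C' have "\<forall>\<^sub>F n in sequentially. \<forall>x\<in>A. dist (f n x) 0 < e / C'"
    unfolding uniform_limit_iff by simp
  then show "\<forall>\<^sub>F n in sequentially. \<forall>x\<in>A. dist (g n x) 0 < e"
  proof eventually_elim
    case (elim n)
    show ?case
    proof
      fix x assume x: "x \<in> A"
      have "\<bar>g n x\<bar> \<le> C * \<bar>f n x\<bar>" by (rule g[OF x])
      also have "\<dots> \<le> C' * \<bar>f n x\<bar>" by (intro mult_right_mono) (auto simp: C'_def)
      also have "\<dots> < e" using elim x C' by (auto simp: dist_real_def field_simps)
      finally show "dist (g n x) 0 < e" by (simp add: dist_real_def)
    qed
  qed
qed

locale symmetric_walk_1d = symmetric_walk p B
  for p :: "int ^ 'n \<Rightarrow> real" and B +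
  fixes k :: 'n
  assumes card_1: "CARD('n) = 1"
begin

lemma index_eq: "(i :: 'n) = k"
  using card_1 by (metis (full_types) UNIV_I card_1_singletonE singletonD)

lemma UNIV_k: "(UNIV :: 'n set) = {k}"
  using index_eq by auto

definition X :: "int ^ 'n \<Rightarrow> real" where "X x = real_of_int (x $ k)"

definition sg :: "int ^ 'n \<Rightarrow> real" where "sg x = sgn (X x)"

lemma X_simps [simp]: "X 0 = 0" "X (- x) = - X x" "X (x + y) = X x + X y" "X (x - y) = X x - X y"
  by (simp_all add: X_def)

lemma norm_X: "norm (real_vec x) = \<bar>X x\<bar>"
  by (simp add: norm_vec_def UNIV_k X_def L2_set_def)

lemma inner_X: "l \<bullet> real_vec x = l $ k * X x"
  by (simp add: inner_vec_def UNIV_k X_def)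

lemma X_0_iff: "X x = 0 \<longleftrightarrow> x = 0"
  by (auto simp: X_def vec_eq_iff) (metis index_eq)

lemma sg_bound: "\<bar>sg x\<bar> \<le> 1"
  by (simp add: sg_def abs_sgn_eq)

lemma sg_neg: "sg (- x) = - sg x"
  by (simp add: sg_def sgn_minus)

lemma sg_eq: "sg x = real_of_int (sgn (x $ k))"
  by (simp add: sg_def X_def sgn_if)

text \<open>The two signs differ only if \<open>0\<close> lies between \<open>x - z\<close> and \<open>x\<close>.\<close>

lemma sg_diff_nonzero:
  assumes "sg x \<noteq> sg (x - z)"
  shows "\<bar>X x\<bar> \<le> \<bar>X z\<bar>" "\<bar>X (x - z)\<bar> \<le> \<bar>X z\<bar>" "\<bar>X z\<bar> \<ge> 1"
proof -
  show "\<bar>X x\<bar> \<le> \<bar>X z\<bar>" "\<bar>X (x - z)\<bar> \<le> \<bar>X z\<bar>"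
    using assms by (auto simp: sg_def sgn_if split: if_splits)
  have "z \<noteq> 0" using assms by auto
  then have "z $ k \<noteq> 0" using X_0_iff[of z] by (simp add: X_def)
  then have "\<bar>z $ k\<bar> \<ge> 1" by simp
  then show "\<bar>X z\<bar> \<ge> 1" unfolding X_def by (metis of_int_1_le_iff of_int_abs)
qed

lemma bij_coord: "bij_betw (\<lambda>x :: int ^ 'n. x $ k) {x. \<bar>X x\<bar> \<le> \<bar>X z\<bar>} {-\<bar>z $ k\<bar>..\<bar>z $ k\<bar>}"
proof -
  have iff: "\<bar>X x\<bar> \<le> \<bar>X z\<bar> \<longleftrightarrow> x $ k \<in> {-\<bar>z $ k\<bar>..\<bar>z $ k\<bar>}" for x
  proof -
    have "\<bar>X x\<bar> \<le> \<bar>X z\<bar> \<longleftrightarrow> \<bar>x $ k\<bar> \<le> \<bar>z $ k\<bar>"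
      unfolding X_def by (metis of_int_abs of_int_le_iff)
    then show ?thesis by (simp add: abs_le_iff minus_le_iff conj_commute)
  qed
  show ?thesis
  proof (rule bij_betw_byWitness[where f' = "\<lambda>i. \<chi> j. i"])
    have "(\<chi> j. x $ k) = x" for x :: "int ^ 'n"
      unfolding vec_eq_iff
    proof
      show "(\<chi> j. x $ k) $ i = x $ i" for i by (subst index_eq[of i]) simp
    qed
    then show "\<forall>x\<in>{x. \<bar>X x\<bar> \<le> \<bar>X z\<bar>}. (\<chi> j. x $ k) = x" by blast
    show "(\<lambda>x. x $ k) ` {x. \<bar>X x\<bar> \<le> \<bar>X z\<bar>} \<subseteq> {-\<bar>z $ k\<bar>..\<bar>z $ k\<bar>}"
      unfolding iff by blast
    show "(\<lambda>i. \<chi> j. i) ` {-\<bar>z $ k\<bar>..\<bar>z $ k\<bar>} \<subseteq> {x. \<bar>X x\<bar> \<le> \<bar>X z\<bar>}"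
    proof
      fix y :: "int ^ 'n" assume "y \<in> (\<lambda>i. \<chi> j. i) ` {-\<bar>z $ k\<bar>..\<bar>z $ k\<bar>}"
      then have "y $ k \<in> {-\<bar>z $ k\<bar>..\<bar>z $ k\<bar>}" by (elim imageE) simp
      then show "y \<in> {x. \<bar>X x\<bar> \<le> \<bar>X z\<bar>}" unfolding iff[symmetric] by simp
    qed
  qed simp
qed

lemma finite_near: "finite {x. \<bar>X x\<bar> \<le> \<bar>X z\<bar>}"
  using bij_betw_finite[OF bij_coord[of z]] by simp

lemma card_near: "real (card {x. \<bar>X x\<bar> \<le> \<bar>X z\<bar>}) = 2 * \<bar>X z\<bar> + 1"
  using bij_betw_same_card[OF bij_coord[of z]] by (simp add: X_def)

text \<open>A double sum whose kernel \<open>G z x\<close> lives on \<open>\<bar>x\<bar> \<le> \<bar>z\<bar>\<close> costs one moment of \<open>p\<close> more than the growth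
  of \<open>G\<close> in \<open>z\<close>.\<close>

lemma
  fixes G :: "int ^ 'n \<Rightarrow> int ^ 'n \<Rightarrow> real"
  assumes G: "\<And>z x. \<bar>G z x\<bar> \<le> K * \<bar>X z\<bar> ^ 3" and supp: "\<And>z x. \<bar>X x\<bar> > \<bar>X z\<bar> \<Longrightarrow> G z x = 0"
  shows kernel_summable: "(\<lambda>x. \<Sum>\<^sub>\<infinity>z. p z * G z x) summable_on UNIV"
    and kernel_summand: "(\<lambda>z. p z * G z x) summable_on UNIV"
    and kernel_bound: "(\<Sum>\<^sub>\<infinity>x. \<bar>\<Sum>\<^sub>\<infinity>z. p z * G z x\<bar>) \<le> 3 * K * abs_moment 4 p"
    and kernel_swap: "(\<Sum>\<^sub>\<infinity>x. \<Sum>\<^sub>\<infinity>z. p z * G z x) = (\<Sum>\<^sub>\<infinity>z. p z * (\<Sum>x | \<bar>X x\<bar> \<le> \<bar>X z\<bar>. G z x))"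
proof -
  have inner: "(\<Sum>\<^sub>\<infinity>x. \<bar>p z * G z x\<bar>) \<le> 3 * K * (norm (real_vec z) ^ 4 * \<bar>p z\<bar>)" for z
  proof -
    have K: "0 \<le> K * \<bar>X z\<bar> ^ 3" using order_trans[OF abs_ge_zero G] .
    have "(\<Sum>\<^sub>\<infinity>x. \<bar>p z * G z x\<bar>) = (\<Sum>x | \<bar>X x\<bar> \<le> \<bar>X z\<bar>. \<bar>p z * G z x\<bar>)"
      by (subst infsum_finite[OF finite_near, symmetric], rule infsum_cong_neutral) (use supp in force)+
    also have "\<dots> \<le> (\<Sum>x | \<bar>X x\<bar> \<le> \<bar>X z\<bar>. p z * (K * \<bar>X z\<bar> ^ 3))"
      using G p_nonneg by (intro sum_mono) (auto simp: abs_mult intro!: mult_left_mono)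
    also have "\<dots> = (2 * \<bar>X z\<bar> + 1) * (p z * (K * \<bar>X z\<bar> ^ 3))" by (simp add: card_near)
    also have "\<dots> \<le> 3 * K * (norm (real_vec z) ^ 4 * \<bar>p z\<bar>)"
    proof (cases "z = 0")
      case False
      then have "z $ k \<noteq> 0" using X_0_iff[of z] by (simp add: X_def)
      then have "\<bar>z $ k\<bar> \<ge> 1" by simp
      then have "\<bar>X z\<bar> \<ge> 1" unfolding X_def by (metis of_int_1_le_iff of_int_abs)
      then have "(2 * \<bar>X z\<bar> + 1) * (p z * (K * \<bar>X z\<bar> ^ 3)) \<le> (3 * \<bar>X z\<bar>) * (p z * (K * \<bar>X z\<bar> ^ 3))"
        by (intro mult_right_mono mult_nonneg_nonneg[OF p_nonneg K]) auto
      then show ?thesis by (simp add: norm_X p_nonneg power_numeral_reduce mult_ac)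
    qed simp
    finally show ?thesis .
  qed
  have s4: "(\<lambda>z. 3 * K * (norm (real_vec z) ^ 4 * \<bar>p z\<bar>)) summable_on UNIV"
    by (intro summable_on_cmult_right has_moment_abs_summable p_moment)
  have "(\<lambda>(z, x). p z * G z x) abs_summable_on (UNIV \<times> UNIV)"
    unfolding Infinite_Sum.abs_summable_on_Sigma_iff
  proof (intro conjI ballI)
    fix z
    show "(\<lambda>x. case (z, x) of (z, x) \<Rightarrow> p z * G z x) abs_summable_on UNIV"
    proof (rule finite_nonzero_values_imp_summable_on)
      have "{x. norm (case (z, x) of (z, x) \<Rightarrow> p z * G z x) \<noteq> 0} \<subseteq> {x. \<bar>X x\<bar> \<le> \<bar>X z\<bar>}"
        using supp by force
      then show "finite {x \<in> UNIV. norm (case (z, x) of (z, x) \<Rightarrow> p z * G z x) \<noteq> 0}"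
        using finite_near finite_subset by fastforce
    qed
  next
    show "(\<lambda>z. \<Sum>\<^sub>\<infinity>x. norm (case (z, x) of (z, x) \<Rightarrow> p z * G z x)) abs_summable_on UNIV"
      by (rule Infinite_Sum.abs_summable_on_comparison_test'[OF s4])
         (use inner in \<open>auto simp: abs_of_nonneg infsum_nonneg\<close>)
  qed
  note abs_zx = this
  have bij: "bij_betw prod.swap (UNIV :: ((int ^ 'n) \<times> (int ^ 'n)) set) UNIV"
    by (rule bij_betw_byWitness[where f' = prod.swap]) auto
  have abs_xz: "(\<lambda>(x, z). p z * G z x) abs_summable_on (UNIV \<times> UNIV)"
    using summable_on_reindex_bij_betw[OF bij, of "\<lambda>(z, x). \<bar>p z * G z x\<bar>"] abs_zx
    by (simp add: case_prod_unfold)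
  have pairs: "(\<lambda>(x, z). p z * G z x) summable_on UNIV"
    using abs_summable_summable[OF abs_xz] by simp
  have abs_pairs: "(\<lambda>(x, z). \<bar>p z * G z x\<bar>) summable_on UNIV"
    using abs_xz by (simp add: case_prod_unfold)
  have abs_in: "(\<lambda>z. p z * G z x) abs_summable_on UNIV" for x
    using abs_xz unfolding Infinite_Sum.abs_summable_on_Sigma_iff by simp
  then show "(\<lambda>z. p z * G z x) summable_on UNIV" for x by (rule abs_summable_summable)
  show sx: "(\<lambda>x. \<Sum>\<^sub>\<infinity>z. p z * G z x) summable_on UNIV"
    using summable_on_Sigma_banach[of "\<lambda>x z. p z * G z x" UNIV "\<lambda>_. UNIV"] pairs by simp
  have sxa: "(\<lambda>x. \<Sum>\<^sub>\<infinity>z. \<bar>p z * G z x\<bar>) summable_on UNIV"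
    using summable_on_Sigma_banach[of "\<lambda>x z. \<bar>p z * G z x\<bar>" UNIV "\<lambda>_. UNIV"] abs_pairs by simp
  have "(\<Sum>\<^sub>\<infinity>x. \<bar>\<Sum>\<^sub>\<infinity>z. p z * G z x\<bar>) \<le> (\<Sum>\<^sub>\<infinity>x. \<Sum>\<^sub>\<infinity>z. \<bar>p z * G z x\<bar>)"
    using norm_infsum_bound[OF abs_in] by (intro infsum_mono summable_on_real_abs sx sxa) simp
  also have "\<dots> = (\<Sum>\<^sub>\<infinity>z. \<Sum>\<^sub>\<infinity>x. \<bar>p z * G z x\<bar>)"
    by (rule infsum_swap_banach) (use abs_pairs in simp)
  also have "\<dots> \<le> (\<Sum>\<^sub>\<infinity>z. 3 * K * (norm (real_vec z) ^ 4 * \<bar>p z\<bar>))"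
  proof (rule infsum_mono[OF _ s4 inner])
    show "(\<lambda>z. \<Sum>\<^sub>\<infinity>x. \<bar>p z * G z x\<bar>) summable_on UNIV"
      using abs_zx unfolding Infinite_Sum.abs_summable_on_Sigma_iff
      by (auto intro: abs_summable_summable)
  qed
  also have "\<dots> = 3 * K * abs_moment 4 p" by (simp add: infsum_cmult_right' abs_moment_def)
  finally show "(\<Sum>\<^sub>\<infinity>x. \<bar>\<Sum>\<^sub>\<infinity>z. p z * G z x\<bar>) \<le> 3 * K * abs_moment 4 p" .
  have "(\<Sum>\<^sub>\<infinity>x. \<Sum>\<^sub>\<infinity>z. p z * G z x) = (\<Sum>\<^sub>\<infinity>z. \<Sum>\<^sub>\<infinity>x. p z * G z x)"
    by (rule infsum_swap_banach) (use pairs in simp)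
  also have "\<dots> = (\<Sum>\<^sub>\<infinity>z. p z * (\<Sum>x | \<bar>X x\<bar> \<le> \<bar>X z\<bar>. G z x))"
  proof (intro infsum_cong)
    fix z
    have "(\<Sum>\<^sub>\<infinity>x. G z x) = (\<Sum>x | \<bar>X x\<bar> \<le> \<bar>X z\<bar>. G z x)"
      by (subst infsum_finite[OF finite_near, symmetric], rule infsum_cong_neutral) (use supp in force)+
    then show "(\<Sum>\<^sub>\<infinity>x. p z * G z x) = p z * (\<Sum>x | \<bar>X x\<bar> \<le> \<bar>X z\<bar>. G z x)"
      by (simp add: infsum_cmult_right')
  qed
  finally show "(\<Sum>\<^sub>\<infinity>x. \<Sum>\<^sub>\<infinity>z. p z * G z x) = (\<Sum>\<^sub>\<infinity>z. p z * (\<Sum>x | \<bar>X x\<bar> \<le> \<bar>X z\<bar>. G z x))" .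
qed

subsection \<open>A drift with an explicit answer\<close>

text \<open>Formally \<open>crossing = sg - p * sg\<close>. For the walk with jumps \<open>\<plusminus>1\<close> this drift sends the walker
  always to the right, so that the perturbed walk is the modulus of the free one and has law
  \<open>(1 + sg x) p\<^sub>n(x)\<close>; for a general walk that law is correct up to \<open>o(n\<^bsup>-1/2\<^esup>)\<close>.\<close>

definition crossing :: "int ^ 'n \<Rightarrow> real" where
  "crossing x = (\<Sum>\<^sub>\<infinity>z. p z * (sg x - sg (x - z)))"

lemma sg_kernel:
  assumes "\<And>z x. \<bar>X x\<bar> \<le> \<bar>X z\<bar> \<Longrightarrow> \<bar>X (x - z)\<bar> \<le> \<bar>X z\<bar> \<Longrightarrow> \<bar>X z\<bar> \<ge> 1 \<Longrightarrow> \<bar>F z x\<bar> \<le> K * \<bar>X z\<bar> ^ 3"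
    and K: "K \<ge> 0"
  shows "\<bar>F z x * (sg x - sg (x - z))\<bar> \<le> 2 * K * \<bar>X z\<bar> ^ 3"
proof (cases "sg x = sg (x - z)")
  case True
  then show ?thesis using K by simp
next
  case False
  have "\<bar>F z x\<bar> * \<bar>sg x - sg (x - z)\<bar> \<le> (K * \<bar>X z\<bar> ^ 3) * 2"
  proof (rule mult_mono)
    show "\<bar>F z x\<bar> \<le> K * \<bar>X z\<bar> ^ 3" using assms(1) sg_diff_nonzero[OF False] by blast
    show "\<bar>sg x - sg (x - z)\<bar> \<le> 2" using sg_bound[of x] sg_bound[of "x - z"] by linarith
  qed (use K in auto)
  then show ?thesis by (simp add: abs_mult)
qed

lemma sg_kernel_support: "\<bar>X x\<bar> > \<bar>X z\<bar> \<Longrightarrow> F z x * (sg x - sg (x - z)) = 0"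
  using sg_diff_nonzero[of x z] by fastforce

lemma crossing_kernel_summand: "(\<lambda>z. p z * (1 * (sg x - sg (x - z)))) summable_on UNIV"
  by (rule kernel_summand[where G = "\<lambda>z x. 1 * (sg x - sg (x - z))" and K = "2 * 1"]; (rule sg_kernel | rule sg_kernel_support)) auto

lemma crossing_odd: "odd_fun crossing"
  unfolding odd_fun_def
proof
  fix x
  have "crossing (- x) = (\<Sum>\<^sub>\<infinity>z. p (- z) * (sg (- x) - sg (- x - (- z))))"
    unfolding crossing_def
    by (rule infsum_reindex_bij_betw[symmetric]) (auto intro!: bij_betw_byWitness[where f' = uminus])
  also have "\<dots> = (\<Sum>\<^sub>\<infinity>z. - (p z * (sg x - sg (x - z))))"
  proof (intro infsum_cong)
    fix z
    have "sg (- x - (- z)) = - sg (x - z)" using sg_neg[of "x - z"] by simp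
    then show "p (- z) * (sg (- x) - sg (- x - (- z))) = - (p z * (sg x - sg (x - z)))"
      by (simp only: p_sym sg_neg) (simp add: algebra_simps)
  qed
  finally show "crossing (- x) = - crossing x" by (simp add: crossing_def infsum_uminus)
qed

lemma crossing_moment: "has_moment 3 crossing"
  unfolding has_moment_def
proof
  have "(\<lambda>x. \<Sum>\<^sub>\<infinity>z. p z * (1 * (sg x - sg (x - z)))) summable_on UNIV"
    by (rule kernel_summable[where K = "2 * 1"]; (rule sg_kernel | rule sg_kernel_support)) auto
  then show "crossing summable_on UNIV" by (simp add: crossing_def[abs_def])
  have "(\<lambda>x. \<Sum>\<^sub>\<infinity>z. p z * (\<bar>X x\<bar> ^ 3 * (sg x - sg (x - z)))) summable_on UNIV"
    by (rule kernel_summable[where K = "2 * 1"]; (rule sg_kernel | rule sg_kernel_support)) (auto intro!: power_mono)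
  also have "(\<lambda>x. \<Sum>\<^sub>\<infinity>z. p z * (\<bar>X x\<bar> ^ 3 * (sg x - sg (x - z)))) = (\<lambda>x. norm (real_vec x) ^ 3 * crossing x)"
    by (simp add: crossing_def norm_X infsum_cmult_right'[symmetric] mult.left_commute)
  finally show "(\<lambda>x. norm (real_vec x) ^ 3 * crossing x) summable_on UNIV" .
qed

definition variance :: real where "variance = B $ k $ k"

lemma quad_1d: "l \<bullet> (B *v l) = variance * (l $ k)\<^sup>2"
  by (simp add: inner_vec_def matrix_vector_mult_def UNIV_k variance_def power2_eq_square)

lemma variance_eq: "variance = (\<Sum>\<^sub>\<infinity>z. p z * (X z)\<^sup>2)"
  using B_quad[of "\<chi> i. 1"] by (simp add: quad_1d inner_X)

lemma variance_pos: "variance > 0"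
proof -
  have "(\<chi> i. 1 :: real ^ 'n) \<noteq> 0" by (simp add: vec_eq_iff)
  then have "(\<chi> i. 1) \<bullet> (B *v (\<chi> i. 1)) > 0" using B_pd unfolding positive_definite_def by blast
  then show ?thesis unfolding quad_1d by simp
qed

lemma gauss_1d: "gauss n x = exp (- (X x)\<^sup>2 / (2 * variance * real n)) / sqrt (2 * pi * variance)"
proof -
  have d: "det B = variance"
    by (subst det_diagonal) (auto simp: UNIV_k variance_def index_eq, (metis index_eq)+)
  then have "invertible B" using variance_pos by (simp add: invertible_det_nz)
  then have "B ** matrix_inv B = mat 1"
    unfolding invertible_def matrix_inv_def by (rule someI2_ex) simp
  then have "(B ** matrix_inv B) $ k $ k = 1" by (simp add: mat_def)
  then have i: "matrix_inv B $ k $ k = 1 / variance"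
    using variance_pos by (simp add: matrix_matrix_mult_def UNIV_k variance_def field_simps)
  have "real_vec x \<bullet> (matrix_inv B *v real_vec x) = (X x)\<^sup>2 / variance"
    by (simp add: inner_vec_def matrix_vector_mult_def UNIV_k i X_def power2_eq_square)
  moreover have "limit_const = 1 / sqrt (2 * pi * variance)"
    unfolding limit_const_def d card_1 by (simp add: powr_half_sqrt real_sqrt_mult)
  ultimately show ?thesis by (simp add: gauss_def)
qed

text \<open>For each fixed jump \<open>z\<close> the points \<open>x\<close> reached by jumping over the origin contribute \<open>z\<^sup>2\<close>.\<close>

lemma crossing_mean: "(\<Sum>\<^sub>\<infinity>x. crossing x * X x) = variance"
proof -
  have "(\<Sum>\<^sub>\<infinity>x. crossing x * X x) = (\<Sum>\<^sub>\<infinity>x. \<Sum>\<^sub>\<infinity>z. p z * (X x * (sg x - sg (x - z))))"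
    by (simp only: crossing_def infsum_cmult_left'[symmetric]) (simp add: mult_ac)
  also have "\<dots> = (\<Sum>\<^sub>\<infinity>z. p z * (\<Sum>x | \<bar>X x\<bar> \<le> \<bar>X z\<bar>. X x * (sg x - sg (x - z))))"
  proof (rule kernel_swap[where K = "2 * 1"]; (rule sg_kernel | rule sg_kernel_support))
    fix z x :: "int ^ 'n" assume a: "\<bar>X x\<bar> \<le> \<bar>X z\<bar>" "\<bar>X z\<bar> \<ge> 1"
    have "\<bar>X z\<bar> ^ 1 \<le> \<bar>X z\<bar> ^ 3" by (rule power_increasing) (use a in auto)
    then show "\<bar>X x\<bar> \<le> 1 * \<bar>X z\<bar> ^ 3" using a by simp
  qed auto
  also have "(\<lambda>z. p z * (\<Sum>x | \<bar>X x\<bar> \<le> \<bar>X z\<bar>. X x * (sg x - sg (x - z)))) = (\<lambda>z. p z * (X z)\<^sup>2)"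
  proof
    fix z
    have "(\<Sum>x | \<bar>X x\<bar> \<le> \<bar>X z\<bar>. X x * (sg x - sg (x - z)))
      = (\<Sum>x | \<bar>X x\<bar> \<le> \<bar>X z\<bar>. real_of_int ((sgn (x $ k) - sgn (x $ k - z $ k)) * (x $ k)))"
      by (intro sum.cong refl) (simp add: X_def sg_eq)
    also have "\<dots> = (\<Sum>i\<in>{-\<bar>z $ k\<bar>..\<bar>z $ k\<bar>}. real_of_int ((sgn i - sgn (i - z $ k)) * i))"
      by (rule sum.reindex_bij_betw[OF bij_coord])
    also have "\<dots> = (X z)\<^sup>2"
      unfolding of_int_sum[symmetric] sgn_difference_sum by (simp add: X_def)
    finally show "p z * (\<Sum>x | \<bar>X x\<bar> \<le> \<bar>X z\<bar>. X x * (sg x - sg (x - z))) = p z * (X z)\<^sup>2"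
      by (rule arg_cong)
  qed
  finally show ?thesis by (simp add: variance_eq)
qed

text \<open>The difference of \<open>drift_sum crossing n\<close> and \<open>sg p\<^sub>n\<close> satisfies the recursion of the walk with this
  source. It is small because only jumps across the origin count, and \<open>p\<^sub>n\<close> is nearly constant over
  the range of one such jump.\<close>

definition crossing_defect :: "nat \<Rightarrow> int ^ 'n \<Rightarrow> real" where
  "crossing_defect n x = (\<Sum>\<^sub>\<infinity>z. p z * ((pw n 0 - pw n (x - z)) * (sg x - sg (x - z))))"

text \<open>By symmetry \<open>2 (p\<^sub>m(0) - p\<^sub>m(y))\<close> is a second difference of \<open>p\<^sub>m\<close> at the origin, and the Fourier series
  \<open>2 - 2 cos (l \<bullet> y)\<close> of the second difference vanishes to order \<open>2\<close>.\<close>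

lemma pw_increment_bound: "\<bar>pw m 0 - pw m y\<bar> \<le> coeff_const 2 * (X y)\<^sup>2 * real (Suc m) powr (- 3 / 2)"
proof -
  define f :: "int ^ 'n \<Rightarrow> real" where "f z = 2 * of_bool (z = 0) + ((- 1) * of_bool (z = y) + (- 1) * of_bool (z = - y))" for z
  have s: "(\<lambda>z :: int ^ 'n. c * of_bool (z = v) :: real) summable_on UNIV" for c v
    by (rule finite_nonzero_values_imp_summable_on) simp
  have ss: "(\<lambda>z. (- 1) * of_bool (z = y) + (- 1) * of_bool (z = - y) :: real) summable_on UNIV"
    by (intro summable_on_add s)
  have fs: "f summable_on UNIV" unfolding f_def by (intro summable_on_add s)
  have c: "char_fun f l = of_real (2 - 2 * cos (l \<bullet> real_vec y))" for l
  proof -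
    have "char_fun f l = 2 * char_fun (\<lambda>z. of_bool (z = 0)) l + ((- 1) * char_fun (\<lambda>z. of_bool (z = y)) l + (- 1) * char_fun (\<lambda>z. of_bool (z = - y)) l)"
      unfolding f_def char_fun_add[OF s ss] char_fun_add[OF s s] char_fun_cmult by simp
    then show ?thesis unfolding char_fun_point by (simp add: complex_eq_iff)
  qed
  have "norm (char_fun f l) \<le> (X y)\<^sup>2 * norm l ^ 2" for l
  proof -
    have "2 - 2 * cos (l \<bullet> real_vec y) \<le> (l \<bullet> real_vec y)\<^sup>2"
      using cos_bound_quadratic[of "l \<bullet> real_vec y"] by simp
    also have "\<dots> \<le> (norm l * norm (real_vec y))\<^sup>2"
      using Cauchy_Schwarz_ineq2[of l "real_vec y"] by (metis abs_ge_zero power2_abs power_mono)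
    finally have "2 - 2 * cos (l \<bullet> real_vec y) \<le> (X y)\<^sup>2 * norm l ^ 2"
      by (simp add: norm_X power_mult_distrib mult.commute)
    then show ?thesis unfolding c norm_of_real using cos_le_one[of "l \<bullet> real_vec y"] by linarith
  qed
  from conv_pw_bound[OF fs _ this, of m 0]
  have "\<bar>lattice_conv f (pw m) 0\<bar> \<le> coeff_const 2 * (X y)\<^sup>2 * real (Suc m) powr (- 3 / 2)"
    by (simp add: card_1)
  moreover have "lattice_conv f (pw m) 0 = 2 * (pw m 0 - pw m y)"
    unfolding f_def using s ss pw_summable[of m] pw_sym[of m y]
    by (simp only: lattice_conv_add_left lattice_conv_cmult_left lattice_conv_point diff_zero diff_0_right minus_minus diff_0) simp
  moreover have "0 \<le> coeff_const 2 * (X y)\<^sup>2 * real (Suc m) powr (- 3 / 2)"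
    by (intro mult_nonneg_nonneg coeff_const_nonneg) auto
  ultimately show ?thesis by simp
qed

lemma defect_kernel:
  assumes "j \<le> 1"
  shows "\<bar>\<bar>X x\<bar> ^ j * (pw n 0 - pw n (x - z)) * (sg x - sg (x - z))\<bar> \<le> 2 * (coeff_const 2 * real (Suc n) powr (- 3 / 2)) * \<bar>X z\<bar> ^ 3"
    and "\<bar>X x\<bar> > \<bar>X z\<bar> \<Longrightarrow> \<bar>X x\<bar> ^ j * (pw n 0 - pw n (x - z)) * (sg x - sg (x - z)) = 0"
proof -
  define K where "K = coeff_const 2 * real (Suc n) powr (- 3 / 2)"
  have K: "K \<ge> 0" unfolding K_def by (intro mult_nonneg_nonneg coeff_const_nonneg) auto
  have F: "\<bar>\<bar>X x\<bar> ^ j * (pw n 0 - pw n (x - z))\<bar> \<le> K * \<bar>X z\<bar> ^ 3"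
    if a: "\<bar>X x\<bar> \<le> \<bar>X z\<bar>" "\<bar>X (x - z)\<bar> \<le> \<bar>X z\<bar>" "\<bar>X z\<bar> \<ge> 1" for z x
  proof -
    have "\<bar>pw n 0 - pw n (x - z)\<bar> \<le> K * \<bar>X (x - z)\<bar>\<^sup>2"
      using pw_increment_bound[of n "x - z"] by (simp add: K_def mult_ac)
    also have "\<dots> \<le> K * \<bar>X z\<bar>\<^sup>2" using a K by (intro mult_left_mono power_mono) auto
    finally have 1: "\<bar>pw n 0 - pw n (x - z)\<bar> \<le> K * \<bar>X z\<bar>\<^sup>2" .
    have "\<bar>X x\<bar> ^ j \<le> \<bar>X z\<bar> ^ j" using a by (intro power_mono) auto
    also have "\<dots> \<le> \<bar>X z\<bar> ^ 1" using a assms by (intro power_increasing) auto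
    finally have 2: "\<bar>X x\<bar> ^ j \<le> \<bar>X z\<bar>" by simp
    have "\<bar>X x\<bar> ^ j * \<bar>pw n 0 - pw n (x - z)\<bar> \<le> \<bar>X z\<bar> * (K * \<bar>X z\<bar>\<^sup>2)"
      by (intro mult_mono 1 2) auto
    then show ?thesis by (simp add: abs_mult power3_eq_cube power2_eq_square mult_ac)
  qed
  show "\<bar>\<bar>X x\<bar> ^ j * (pw n 0 - pw n (x - z)) * (sg x - sg (x - z))\<bar> \<le> 2 * (coeff_const 2 * real (Suc n) powr (- 3 / 2)) * \<bar>X z\<bar> ^ 3"
    using sg_kernel[where F = "\<lambda>z x. \<bar>X x\<bar> ^ j * (pw n 0 - pw n (x - z))" and z = z and x = x, OF F K] unfolding K_def by simp
  show "\<bar>X x\<bar> > \<bar>X z\<bar> \<Longrightarrow> \<bar>X x\<bar> ^ j * (pw n 0 - pw n (x - z)) * (sg x - sg (x - z)) = 0"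
    by (rule sg_kernel_support)
qed

lemma defect_moment: "has_moment 1 (crossing_defect n)"
  and defect_moment_bound: "abs_moment 1 (crossing_defect n) \<le> 6 * coeff_const 2 * abs_moment 4 p * real (Suc n) powr (- 3 / 2)"
proof -
  have eq: "(\<lambda>x. \<Sum>\<^sub>\<infinity>z. p z * (\<bar>X x\<bar> ^ j * (pw n 0 - pw n (x - z)) * (sg x - sg (x - z)))) = (\<lambda>x. norm (real_vec x) ^ j * crossing_defect n x)" for j
    by (simp add: crossing_defect_def norm_X infsum_cmult_right'[symmetric] mult_ac)
  let ?G = "\<lambda>j z x. \<bar>X x\<bar> ^ j * (pw n 0 - pw n (x - z)) * (sg x - sg (x - z))"
  have ks: "(\<lambda>x. \<Sum>\<^sub>\<infinity>z. p z * ?G j z x) summable_on UNIV" if "j \<le> 1" for j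
    by (rule kernel_summable[where G = "?G j" and K = "2 * (coeff_const 2 * real (Suc n) powr (- 3 / 2))"]; rule defect_kernel[OF that])
  have kb: "(\<Sum>\<^sub>\<infinity>x. \<bar>\<Sum>\<^sub>\<infinity>z. p z * ?G 1 z x\<bar>) \<le> 3 * (2 * (coeff_const 2 * real (Suc n) powr (- 3 / 2))) * abs_moment 4 p"
    by (rule kernel_bound[where G = "?G 1" and K = "2 * (coeff_const 2 * real (Suc n) powr (- 3 / 2))"]; rule defect_kernel[OF order_refl])
  show "has_moment 1 (crossing_defect n)" unfolding has_moment_def
    using ks[of 0] ks[of 1] unfolding eq by simp
  show "abs_moment 1 (crossing_defect n) \<le> 6 * coeff_const 2 * abs_moment 4 p * real (Suc n) powr (- 3 / 2)"
    using kb unfolding eq[THEN fun_cong] abs_moment_def[of 1]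
    by (simp add: abs_mult mult_ac)
qed

lemma defect_odd: "odd_fun (crossing_defect n)"
  unfolding odd_fun_def
proof
  fix x
  have "crossing_defect n (- x) = (\<Sum>\<^sub>\<infinity>z. p (- z) * ((pw n 0 - pw n (- x - (- z))) * (sg (- x) - sg (- x - (- z)))))"
    unfolding crossing_defect_def
    by (rule infsum_reindex_bij_betw[symmetric]) (auto intro!: bij_betw_byWitness[where f' = uminus])
  also have "\<dots> = (\<Sum>\<^sub>\<infinity>z. - (p z * ((pw n 0 - pw n (x - z)) * (sg x - sg (x - z)))))"
  proof (intro infsum_cong)
    fix z
    have eq: "- x - (- z) = - (x - z)" by simp
    show "p (- z) * ((pw n 0 - pw n (- x - (- z))) * (sg (- x) - sg (- x - (- z)))) = - (p z * ((pw n 0 - pw n (x - z)) * (sg x - sg (x - z))))"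
      unfolding eq by (simp only: p_sym sg_neg pw_sym) (simp add: algebra_simps)
  qed
  finally show "crossing_defect n (- x) = - crossing_defect n x" by (simp add: crossing_defect_def infsum_uminus)
qed

definition crossing_error :: "nat \<Rightarrow> int ^ 'n \<Rightarrow> real" where
  "crossing_error n x = drift_sum crossing n x - sg x * pw n x"

lemma sg_mult_summable: "f summable_on UNIV \<Longrightarrow> (\<lambda>x. sg x * f x) summable_on UNIV"
  using summable_on_mult_bounded[of f UNIV sg 1] sg_bound
  by (auto simp: mult.commute intro: abs_summable_summable)

lemma crossing_error_Suc: "crossing_error (Suc n) x = lattice_conv p (crossing_error n) x + crossing_defect n x"
proof -
  have cs: "crossing summable_on UNIV" by (rule has_moment_summable[OF crossing_moment])
  have s1: "(\<lambda>z. p z * pw n (x - z)) summable_on UNIV"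
    by (intro lattice_conv_summand p_summable pw_summable)
  have s2: "(\<lambda>z. p z * (sg (x - z) * pw n (x - z))) summable_on UNIV"
    by (rule lattice_conv_summand[of p "\<lambda>y. sg y * pw n y"]) (intro p_summable sg_mult_summable pw_summable)+
  have s3: "(\<lambda>z. p z * (1 * (sg x - sg (x - z)))) summable_on UNIV" by (rule crossing_kernel_summand)
  have "crossing_defect n x = (\<Sum>\<^sub>\<infinity>z. pw n 0 * (p z * (1 * (sg x - sg (x - z)))) + ((- sg x) * (p z * pw n (x - z)) + p z * (sg (x - z) * pw n (x - z))))"
    unfolding crossing_defect_def by (intro infsum_cong) (simp add: algebra_simps)
  also have "\<dots> = pw n 0 * crossing x + ((- sg x) * pw (Suc n) x + lattice_conv p (\<lambda>y. sg y * pw n y) x)"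
    by (subst infsum_add, (intro summable_on_add summable_on_cmult_right s1 s2 s3)+, subst infsum_add, (intro summable_on_add summable_on_cmult_right s1 s2 s3)+)
       (simp only: infsum_cmult_right' crossing_def lattice_conv_def conv_power.simps mult_1)
  finally have d: "crossing_defect n x = pw n 0 * crossing x + ((- sg x) * pw (Suc n) x + lattice_conv p (\<lambda>y. sg y * pw n y) x)" .
  have "lattice_conv p (crossing_error n) x = lattice_conv p (\<lambda>y. drift_sum crossing n y + (- 1) * (sg y * pw n y)) x"
    by (simp add: crossing_error_def[abs_def])
  also have "\<dots> = lattice_conv p (drift_sum crossing n) x + (- 1) * lattice_conv p (\<lambda>y. sg y * pw n y) x"
    by (subst lattice_conv_add_right, (intro p_summable drift_sum_summable cs summable_on_cmult_right sg_mult_summable pw_summable)+)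
       (simp only: lattice_conv_cmult_right)
  finally have e: "lattice_conv p (crossing_error n) x = lattice_conv p (drift_sum crossing n) x - lattice_conv p (\<lambda>y. sg y * pw n y) x" by simp
  show ?thesis unfolding e d crossing_error_def drift_sum_Suc[OF cs] by simp
qed

lemma crossing_error_eq: "crossing_error n x = (\<Sum>m<n. lattice_conv (crossing_defect m) (pw (n - 1 - m)) x)"
proof (induction n arbitrary: x)
  case 0
  then show ?case by (cases "x = 0") (simp_all add: crossing_error_def drift_sum_def sg_def)
next
  case (Suc n)
  have ds: "crossing_defect m summable_on UNIV" for m by (rule has_moment_summable[OF defect_moment])
  have IH: "crossing_error n = (\<lambda>x. \<Sum>m<n. 1 * lattice_conv (crossing_defect m) (pw (n - 1 - m)) x)"
    using Suc.IH by (simp add: fun_eq_iff)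
  have "lattice_conv p (crossing_error n) x = (\<Sum>m<n. 1 * lattice_conv p (lattice_conv (crossing_defect m) (pw (n - 1 - m))) x)"
    unfolding IH
    by (rule lattice_conv_sum_right[THEN conjunct1]) (auto intro: p_summable lattice_conv_summable ds pw_summable)
  also have "\<dots> = (\<Sum>m<n. lattice_conv (crossing_defect m) (pw (Suc n - 1 - m)) x)"
  proof (intro sum.cong refl)
    fix m assume "m \<in> {..<n}"
    then have "Suc n - 1 - m = Suc (n - 1 - m)" by auto
    then show "1 * lattice_conv p (lattice_conv (crossing_defect m) (pw (n - 1 - m))) x = lattice_conv (crossing_defect m) (pw (Suc n - 1 - m)) x"
      using conv_power_Suc_right[OF ds p_summable] by simp
  qed
  finally show ?case by (simp add: crossing_error_Suc lattice_conv_delta_right)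
qed

text \<open>The defect at time \<open>m\<close> is odd with first moment \<open>O(m\<^bsup>-3/2\<^esup>)\<close>. Oddness gains a factor, so what is left of
  it at time \<open>n\<close> is \<open>O(m\<^bsup>-3/2\<^esup> / (n - m))\<close>, and the sum over \<open>m\<close> is \<open>o(n\<^bsup>-1/2\<^esup>)\<close>.\<close>

lemma crossing_error_limit: "uniform_limit UNIV (\<lambda>n x. real n powr (1 / 2) * crossing_error n x) (\<lambda>_. 0) sequentially"
proof -
  define C where "C = coeff_const 1 * (6 * coeff_const 2 * abs_moment 4 p)"
  define c where "c j = inverse (real (Suc j))" for j
  have b: "\<bar>crossing_error n x\<bar> \<le> C * (\<Sum>m<n. c (n - 1 - m) * real (Suc m) powr (- (3 / 2)))" for n x
  proof -
    have "\<bar>lattice_conv (crossing_defect m) (pw j) x\<bar> \<le> C * (c j * real (Suc m) powr (- (3 / 2)))" for m j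
    proof -
      have "\<bar>lattice_conv (crossing_defect m) (pw j) x\<bar> \<le> coeff_const 1 * abs_moment 1 (crossing_defect m) * real (Suc j) powr (- (real CARD('n) + real 1) / 2)"
        by (rule conv_pw_bound[OF has_moment_summable[OF defect_moment]])
           (use char_fun_bound_1[OF defect_moment defect_odd] in \<open>auto simp: abs_moment_nonneg\<close>)
      also have "real (Suc j) powr (- (real CARD('n) + real 1) / 2) = c j"
        by (simp add: card_1 c_def powr_minus)
      also have "coeff_const 1 * abs_moment 1 (crossing_defect m) * c j \<le> coeff_const 1 * (6 * coeff_const 2 * abs_moment 4 p * real (Suc m) powr (- 3 / 2)) * c j"
        by (intro mult_right_mono mult_left_mono defect_moment_bound coeff_const_nonneg) (simp add: c_def)
      finally show ?thesis by (simp add: C_def mult_ac)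
    qed
    then have "\<bar>crossing_error n x\<bar> \<le> (\<Sum>m<n. C * (c (n - 1 - m) * real (Suc m) powr (- (3 / 2))))"
      unfolding crossing_error_eq by (intro order_trans[OF sum_abs] sum_mono)
    then show ?thesis by (simp add: sum_distrib_left)
  qed
  have "uniform_limit UNIV (\<lambda>n x. real n powr (1 / 2) * (\<Sum>m<n. c (n - 1 - m) * (\<lambda>m _. real (Suc m) powr (- (3 / 2))) m x))
     (\<lambda>x :: int ^ 'n. 0 * (\<Sum>m. (\<lambda>m _. real (Suc m) powr (- (3 / 2))) m x)) sequentially"
  proof (rule uniform_limit_weighted_sum[where r = "3 / 2" and K = 1])
    show "(\<lambda>n. real n powr (1 / 2) * c n) \<longlonglongrightarrow> 0" unfolding c_def by real_asymp
    have h: "(\<Sum>j<n. c j) = harm n" for n by (simp add: c_def harm_altdef)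
    have "(\<lambda>n. real n powr (1 / 2 - 3 / 2) * (harm n - ln (real n)) + real n powr (1 / 2 - 3 / 2) * ln (real n)) \<longlonglongrightarrow> 0 * euler_mascheroni + 0"
    proof (intro tendsto_intros euler_mascheroni_LIMSEQ)
      show "(\<lambda>n. real n powr (1 / 2 - 3 / 2)) \<longlonglongrightarrow> 0" by real_asymp
      show "(\<lambda>n. real n powr (1 / 2 - 3 / 2) * ln (real n)) \<longlonglongrightarrow> 0" by real_asymp
    qed
    then show "(\<lambda>n. real n powr (1 / 2 - 3 / 2) * (\<Sum>j<n. c j)) \<longlonglongrightarrow> 0"
      unfolding h by (simp add: right_diff_distrib)
  qed (auto simp: c_def)
  then have "uniform_limit UNIV (\<lambda>n (x :: int ^ 'n). real n powr (1 / 2) * (\<Sum>m<n. c (n - 1 - m) * real (Suc m) powr (- (3 / 2)))) (\<lambda>_. 0) sequentially"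
    by simp
  then show ?thesis
  proof (rule uniform_limit_zero_bound)
    fix n x
    have "0 \<le> (\<Sum>m<n. c (n - 1 - m) * real (Suc m) powr (- (3 / 2)))"
      by (intro sum_nonneg mult_nonneg_nonneg) (auto simp: c_def)
    then show "\<bar>real n powr (1 / 2) * crossing_error n x\<bar> \<le> C * \<bar>real n powr (1 / 2) * (\<Sum>m<n. c (n - 1 - m) * real (Suc m) powr (- (3 / 2)))\<bar>"
      using mult_left_mono[OF b[of n x], of "real n powr (1 / 2)"]
      by (simp add: abs_mult mult.left_commute)
  qed
qed

end

lemma odd_fun_lincomb: "odd_fun f \<Longrightarrow> odd_fun g \<Longrightarrow> odd_fun (\<lambda>x. f x + c * g x :: real)"
  by (simp add: odd_fun_def)

context symmetric_walk_1d
begin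

text \<open>Multiplying by \<open>x\<close> costs one order of vanishing at the origin, or one factor \<open>m\<close> at the price of two
  orders more; both alternatives leave the summable rate \<open>m\<^bsup>-3/2\<^esup>\<close>.\<close>

lemma one_dim_decay:
  assumes b: "has_moment 3 b" "odd_fun b" "(\<Sum>\<^sub>\<infinity>x. b x * X x) = 0"
  obtains C where "C \<ge> 0" "\<And>m x. \<bar>X x\<bar> * \<bar>lattice_conv b (pw m) x\<bar> \<le> C * real (Suc m) powr (- (3 / 2))"
proof -
  have bs: "b summable_on UNIV" by (rule has_moment_summable[OF b(1)])
  define Db where "Db = coord_mult k b"
  have Db: "has_moment 2 Db" unfolding Db_def by (rule has_moment_coord_mult) (use b(1) in \<open>simp add: numeral_3_eq_3 numeral_2_eq_2\<close>)
  have Dbs: "Db summable_on UNIV" by (rule has_moment_summable[OF Db])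
  have Db_even: "Db (- x) = Db x" for x using b(2) by (simp add: Db_def coord_mult_def odd_fun_def)
  have Db_sum: "(\<Sum>\<^sub>\<infinity>x. Db x) = 0"
    using b(3) by (simp add: Db_def coord_mult_def X_def mult.commute)
  have l: "(\<Sum>\<^sub>\<infinity>x. b x * (l \<bullet> real_vec x)) = 0" for l
  proof -
    have "(\<Sum>\<^sub>\<infinity>x. b x * (l \<bullet> real_vec x)) = (\<Sum>\<^sub>\<infinity>x. l $ k * (b x * X x))" by (simp add: inner_X mult_ac)
    also have "\<dots> = 0" unfolding infsum_cmult_right' b(3) by simp
    finally show ?thesis .
  qed
  define K where "K = abs_moment 3 b * (abs_moment 2 p * shift_const)"
  have K: "K \<ge> 0" unfolding K_def using shift_const_pos by (intro mult_nonneg_nonneg abs_moment_nonneg) auto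
  define C where "C = coeff_const 2 * abs_moment 2 Db + coeff_const 4 * K"
  have C: "C \<ge> 0" unfolding C_def by (intro add_nonneg_nonneg mult_nonneg_nonneg coeff_const_nonneg abs_moment_nonneg K)
  have "\<bar>X x\<bar> * \<bar>lattice_conv b (pw m) x\<bar> \<le> C * real (Suc m) powr (- (3 / 2))" for m x
  proof -
    have "X x * lattice_conv b (pw m) x = coord_mult k (lattice_conv b (pw m)) x"
      by (simp add: coord_mult_def X_def)
    also have "\<dots> = lattice_conv Db (pw m) x + lattice_conv b (coord_mult k (pw m)) x"
      using coord_mult_conv(1)[OF bs Dbs[unfolded Db_def] pw_summable coord_pw_summable] by (simp add: Db_def)
    finally have eq: "X x * lattice_conv b (pw m) x = lattice_conv Db (pw m) x + lattice_conv b (coord_mult k (pw m)) x" .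
    have 1: "\<bar>lattice_conv Db (pw m) x\<bar> \<le> coeff_const 2 * abs_moment 2 Db * real (Suc m) powr (- (real CARD('n) + real 2) / 2)"
      by (rule conv_pw_bound[OF Dbs abs_moment_nonneg]) (use char_fun_bound_2[OF Db Db_sum Db_even] in simp)
    have "\<bar>lattice_conv b (coord_mult k (pw m)) x\<bar> \<le> coeff_const 4 * (K * real m) * real (Suc m) powr (- (real CARD('n) + real 4) / 2)"
    proof (rule coeff_bound)
      show "lattice_conv b (coord_mult k (pw m)) summable_on UNIV" by (intro lattice_conv_summable bs coord_pw_summable)
      show "0 \<le> K * real m" using K by simp
      fix l :: "real ^ 'n" assume lt: "l \<in> torus"
      have "norm (char_fun (lattice_conv b (coord_mult k (pw m))) l) = norm (char_fun b l) * norm (char_fun (coord_mult k (pw m)) l)"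
        by (simp add: char_fun_conv[OF bs coord_pw_summable] norm_mult)
      also have "\<dots> \<le> (abs_moment 3 b * norm l ^ 3) * (abs_moment 2 p * shift_const * (real m * norm l * exp (- decay_rate * real m * (norm l)\<^sup>2)))"
        by (intro mult_mono char_fun_bound_3 b l char_fun_coord_pw_bound lt) (auto intro!: mult_nonneg_nonneg abs_moment_nonneg)
      also have "\<dots> = K * real m * norm l ^ 4 * exp (- decay_rate * real m * (norm l)\<^sup>2)"
        by (simp add: K_def power_numeral_reduce mult_ac)
      finally show "norm (char_fun (lattice_conv b (coord_mult k (pw m))) l) \<le> K * real m * norm l ^ 4 * exp (- decay_rate * real m * (norm l)\<^sup>2)" .
    qed
    also have "\<dots> \<le> coeff_const 4 * (K * real (Suc m)) * real (Suc m) powr (- (real CARD('n) + real 4) / 2)"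
      using K coeff_const_nonneg[of 4] by (intro mult_right_mono mult_left_mono) auto
    also have "\<dots> = coeff_const 4 * K * (real (Suc m) powr 1 * real (Suc m) powr (- (real CARD('n) + real 4) / 2))"
      by simp
    also have "real (Suc m) powr 1 * real (Suc m) powr (- (real CARD('n) + real 4) / 2) = real (Suc m) powr (- (3 / 2))"
      by (subst powr_add[symmetric]) (simp add: card_1)
    finally have 2: "\<bar>lattice_conv b (coord_mult k (pw m)) x\<bar> \<le> coeff_const 4 * K * real (Suc m) powr (- (3 / 2))" .
    have "\<bar>X x\<bar> * \<bar>lattice_conv b (pw m) x\<bar> \<le> \<bar>lattice_conv Db (pw m) x\<bar> + \<bar>lattice_conv b (coord_mult k (pw m)) x\<bar>"
      using abs_triangle_ineq[of "lattice_conv Db (pw m) x" "lattice_conv b (coord_mult k (pw m)) x"] by (simp add: eq[symmetric] abs_mult)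
    also have "\<dots> \<le> C * real (Suc m) powr (- (3 / 2))"
      using 1 2 by (simp add: C_def card_1 distrib_right)
    finally show ?thesis .
  qed
  with C show ?thesis by (rule that)
qed

text \<open>The multiple of \<open>crossing\<close> that has the same mean as \<open>a\<close> carries the part of the drift that reaches
  infinity; the remainder \<open>b\<close> has mean \<open>0\<close>.\<close>

theorem one_dim_expansion:
  assumes a: "has_moment 3 a" "odd_fun a"
    and d: "d = (\<Sum>\<^sub>\<infinity>x. a x * X x)"
    and P: "\<And>n x. P n x = pw n x + drift_sum a n x"
  shows "\<exists>\<psi>. odd_fun \<psi> \<and> (\<exists>C. \<forall>x. \<bar>\<psi> x\<bar> \<le> C) \<and> (\<exists>C. \<forall>x. \<bar>X x\<bar> * \<bar>\<psi> x\<bar> \<le> C)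
    \<and> uniform_limit UNIV (\<lambda>n x. real n powr (1 / 2) * P n x - (gauss n x * (1 + d / variance * sg x) + \<psi> x)) (\<lambda>_. 0) sequentially"
proof -
  define \<kappa> where "\<kappa> = d / variance"
  define b where "b x = a x + (- \<kappa>) * crossing x" for x
  have as: "a summable_on UNIV" and cs: "crossing summable_on UNIV"
    using has_moment_summable a crossing_moment by blast+
  have b3: "has_moment 3 b" unfolding b_def by (intro has_moment_add has_moment_cmult a crossing_moment)
  have bs: "b summable_on UNIV" by (rule has_moment_summable[OF b3])
  have bo: "odd_fun b" unfolding b_def by (intro odd_fun_lincomb a crossing_odd)
  have bX: "(\<Sum>\<^sub>\<infinity>x. b x * X x) = 0"
  proof -
    have m: "(\<lambda>x. f x * X x) summable_on UNIV" if "has_moment 3 f" for f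
      using has_moment_summable[OF has_moment_coord_mult[of 2 f k]] that
      by (simp add: coord_mult_def[abs_def] X_def mult.commute numeral_3_eq_3 numeral_2_eq_2)
    have "(\<Sum>\<^sub>\<infinity>x. b x * X x) = (\<Sum>\<^sub>\<infinity>x. a x * X x + (- \<kappa>) * (crossing x * X x))"
      by (simp add: b_def algebra_simps)
    also have "\<dots> = d + (- \<kappa>) * variance"
      by (subst infsum_add, (intro m a crossing_moment summable_on_cmult_right)+) (simp only: infsum_cmult_right' crossing_mean d)
    also have "\<dots> = 0" using variance_pos by (simp add: \<kappa>_def)
    finally show ?thesis .
  qed
  have l: "(\<Sum>\<^sub>\<infinity>x. b x * (l \<bullet> real_vec x)) = 0" for l
  proof -
    have "(\<Sum>\<^sub>\<infinity>x. b x * (l \<bullet> real_vec x)) = (\<Sum>\<^sub>\<infinity>x. l $ k * (b x * X x))" by (simp add: inner_X mult_ac)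
    also have "\<dots> = 0" unfolding infsum_cmult_right' bX by simp
    finally show ?thesis .
  qed
  note bound = char_fun_bound_3[OF b3 bo l]
  note lim = drift_sum_limit[OF bs abs_moment_nonneg bound, simplified]
  define \<psi> where "\<psi> x = limit_const * (\<Sum>m. lattice_conv b (pw m) x)" for x
  have sabs: "summable (\<lambda>m. \<bar>lattice_conv b (pw m) x\<bar>)" for x using lim(2) by simp
  have slc: "summable (\<lambda>m. lattice_conv b (pw m) x)" for x by (rule summable_rabs_cancel[OF sabs])
  have odd: "odd_fun \<psi>"
    unfolding odd_fun_def \<psi>_def
    using odd_fun_conv[OF bo, of "pw _"] pw_sym suminf_minus[OF slc] by (simp add: odd_fun_def)
  have s2: "summable (\<lambda>m. real (Suc m) powr (- 2))" by (rule summable_Suc_powr) simp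
  have s32: "summable (\<lambda>m. real (Suc m) powr (- (3 / 2)))" by (rule summable_Suc_powr) simp
  have bounded: "\<bar>\<psi> x\<bar> \<le> limit_const * (coeff_const 3 * abs_moment 3 b * (\<Sum>m. real (Suc m) powr (- 2)))" for x
  proof -
    have "\<bar>\<Sum>m. lattice_conv b (pw m) x\<bar> \<le> (\<Sum>m. \<bar>lattice_conv b (pw m) x\<bar>)" by (rule summable_rabs[OF sabs])
    also have "\<dots> \<le> (\<Sum>m. coeff_const 3 * abs_moment 3 b * real (Suc m) powr (- 2))"
      using conv_pw_bound[OF bs abs_moment_nonneg bound] by (intro suminf_le sabs summable_mult s2) (simp add: card_1)
    also have "\<dots> = coeff_const 3 * abs_moment 3 b * (\<Sum>m. real (Suc m) powr (- 2))" by (rule suminf_mult[OF s2])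
    finally show ?thesis using limit_const_pos by (simp add: \<psi>_def abs_mult)
  qed
  obtain C where C: "C \<ge> 0" "\<And>m x. \<bar>X x\<bar> * \<bar>lattice_conv b (pw m) x\<bar> \<le> C * real (Suc m) powr (- (3 / 2))"
    using one_dim_decay[OF b3 bo bX] by blast
  have decay: "\<bar>X x\<bar> * \<bar>\<psi> x\<bar> \<le> limit_const * (C * (\<Sum>m. real (Suc m) powr (- (3 / 2))))" for x
  proof -
    have "\<bar>X x\<bar> * \<bar>\<Sum>m. lattice_conv b (pw m) x\<bar> \<le> \<bar>X x\<bar> * (\<Sum>m. \<bar>lattice_conv b (pw m) x\<bar>)"
      by (intro mult_left_mono summable_rabs[OF sabs]) auto
    also have "\<dots> = (\<Sum>m. \<bar>X x\<bar> * \<bar>lattice_conv b (pw m) x\<bar>)" by (rule suminf_mult[OF sabs, symmetric])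
    also have "\<dots> \<le> (\<Sum>m. C * real (Suc m) powr (- (3 / 2)))"
      by (intro suminf_le C summable_mult sabs s32)
    also have "\<dots> = C * (\<Sum>m. real (Suc m) powr (- (3 / 2)))" by (rule suminf_mult[OF s32])
    finally show ?thesis using limit_const_pos by (simp add: \<psi>_def abs_mult mult.left_commute)
  qed
  have ad: "drift_sum a n x = drift_sum b n x + \<kappa> * drift_sum crossing n x" for n x
  proof -
    have "a = (\<lambda>x. b x + \<kappa> * crossing x)" by (simp add: b_def)
    then show ?thesis using drift_sum_lincomb[OF bs cs, of \<kappa> n x] by simp
  qed
  have L1: "uniform_limit UNIV (\<lambda>n x. (real n powr (1 / 2) * pw n x - gauss n x) * (1 + \<kappa> * sg x)) (\<lambda>_. 0) sequentially"
  proof (rule uniform_limit_zero_bound)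
    show "uniform_limit UNIV (\<lambda>n x. real n powr (1 / 2) * pw n x - gauss n x) (\<lambda>_. 0) sequentially"
      using local_limit by (simp add: card_1)
    fix n x
    have "\<bar>\<kappa> * sg x\<bar> \<le> \<bar>\<kappa>\<bar> * 1" unfolding abs_mult by (intro mult_left_mono sg_bound) auto
    then have "\<bar>1 + \<kappa> * sg x\<bar> \<le> 1 + \<bar>\<kappa>\<bar>" by linarith
    then show "\<bar>(real n powr (1 / 2) * pw n x - gauss n x) * (1 + \<kappa> * sg x)\<bar> \<le> (1 + \<bar>\<kappa>\<bar>) * \<bar>real n powr (1 / 2) * pw n x - gauss n x\<bar>"
      by (simp add: abs_mult mult.commute[of "1 + \<bar>\<kappa>\<bar>"] mult_left_mono)
  qed
  have L2: "uniform_limit UNIV (\<lambda>n x. real n powr (1 / 2) * drift_sum b n x - \<psi> x) (\<lambda>_. 0) sequentially"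
    using uniform_limit_minus[OF lim(1) uniform_limit_const[where S = UNIV and c = \<psi> and f = sequentially]] by (simp add: card_1 \<psi>_def)
  have L3: "uniform_limit UNIV (\<lambda>n x. \<kappa> * (real n powr (1 / 2) * crossing_error n x)) (\<lambda>_. 0) sequentially"
    by (rule uniform_limit_zero_bound[OF crossing_error_limit, where C = "\<bar>\<kappa>\<bar>"]) (simp add: abs_mult)
  have "uniform_limit UNIV (\<lambda>n x. (real n powr (1 / 2) * pw n x - gauss n x) * (1 + \<kappa> * sg x)
     + ((real n powr (1 / 2) * drift_sum b n x - \<psi> x) + \<kappa> * (real n powr (1 / 2) * crossing_error n x))) (\<lambda>x. 0 + (0 + 0)) sequentially"
    by (intro uniform_limit_add L1 L2 L3)
  also have "(\<lambda>n x. (real n powr (1 / 2) * pw n x - gauss n x) * (1 + \<kappa> * sg x)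
     + ((real n powr (1 / 2) * drift_sum b n x - \<psi> x) + \<kappa> * (real n powr (1 / 2) * crossing_error n x)))
    = (\<lambda>n x. real n powr (1 / 2) * P n x - (gauss n x * (1 + d / variance * sg x) + \<psi> x))"
    unfolding P ad crossing_error_def \<kappa>_def[symmetric] by (simp add: fun_eq_iff algebra_simps)
  finally show ?thesis using odd bounded decay by auto
qed

end

section \<open>Dimension two\<close>

lemma Suc_powr_absorb:
  "real m ^ i * real (Suc m) powr r \<le> real (Suc m) powr (r + real i)"
proof -
  have "real m ^ i * real (Suc m) powr r \<le> real (Suc m) ^ i * real (Suc m) powr r"
    by (intro mult_right_mono power_mono) auto
  also have "\<dots> = real (Suc m) powr (r + real i)"
    by (simp add: powr_add powr_realpow mult.commute del: of_nat_Suc)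
  finally show ?thesis .
qed

context symmetric_walk
begin

lemma coord2_p: "coord_mult j (coord_mult j p) summable_on UNIV"
  by (rule has_moment_summable[OF has_moment_coord_mult[of 2]]) (use coord_p(2)[of j] in \<open>simp add: numeral_3_eq_3 numeral_2_eq_2\<close>)

lemma coord2_pw_Suc:
  "coord_mult j (coord_mult j (pw (Suc m))) = (\<lambda>x. lattice_conv (coord_mult j (coord_mult j p)) (pw m) x
      + (lattice_conv (coord_mult j p) (coord_mult j (pw m)) x
      + (lattice_conv (coord_mult j p) (coord_mult j (pw m)) x + lattice_conv p (coord_mult j (coord_mult j (pw m))) x)))"
  if "coord_mult j (coord_mult j (pw m)) summable_on UNIV"
  using coord_mult_conv(1)[OF p_summable coord_p(1) pw_summable coord_pw_summable, of j m]
    coord_mult_conv(1)[OF coord_p(1) coord2_p pw_summable coord_pw_summable, of j m]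
    coord_mult_conv(1)[OF p_summable coord_p(1) coord_pw_summable that]
  by (simp add: coord_mult_add add_ac)

lemma coord2_pw_summable: "coord_mult j (coord_mult j (pw m)) summable_on UNIV"
proof (induction m)
  case 0
  then show ?case by (simp add: coord_mult_delta) (simp add: coord_mult_def[abs_def])
next
  case (Suc m)
  show ?case unfolding coord2_pw_Suc[OF Suc]
    by (intro summable_on_add lattice_conv_summable coord2_p coord_p coord_pw_summable pw_summable p_summable Suc)
qed

text \<open>The second derivative of \<open>\<phi> ^ m\<close> with \<open>\<phi> = char_fun p\<close> is \<open>m \<phi>'' \<phi> ^ (m-1) + m (m-1) \<phi>'\<^sup>2 \<phi> ^ (m-2)\<close>, with
  \<open>\<phi>''\<close> bounded and \<open>\<phi>' = O(\<bar>l\<bar>)\<close>. The induction on \<open>m\<close> reproduces the two terms.\<close>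

lemma char_fun_coord2_pw_bound:
  assumes l: "l \<in> torus"
  shows "norm (char_fun (coord_mult j (coord_mult j (pw m))) l)
    \<le> (abs_moment 0 (coord_mult j (coord_mult j p)) * shift_const * real m + 2 * (abs_moment 2 p)\<^sup>2 * shift_const\<^sup>2 * (real m)\<^sup>2 * (norm l)\<^sup>2)
        * exp (- decay_rate * real m * (norm l)\<^sup>2)"
proof (induction m)
  case 0
  have "coord_mult j (coord_mult j (pw 0)) = (\<lambda>x. 0)" by (simp add: coord_mult_delta) (simp add: coord_mult_def[abs_def])
  then show ?case by (simp add: char_fun_zero)
next
  case (Suc m)
  define A where "A = abs_moment 0 (coord_mult j (coord_mult j p))"
  define M where "M = abs_moment 2 p"
  define s where "s = shift_const"
  define L where "L = norm l"
  define E where "E n = exp (- decay_rate * real n * L\<^sup>2)" for n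
  have nn: "A \<ge> 0" "M \<ge> 0" "s > 0" "L \<ge> 0" "\<And>n. E n > 0" "\<And>n. E n \<ge> 0" using shift_const_pos by (auto simp: A_def M_def s_def L_def E_def abs_moment_nonneg)
  have sh: "E m \<le> s * E (Suc m)" using exp_shift[OF l, of m] by (simp add: E_def s_def L_def)
  have s1: "s \<ge> 1" using decay_rate_pos by (simp add: s_def shift_const_def)
  have phi: "norm (char_fun p l) * E m \<le> E (Suc m)"
  proof -
    have "norm (char_fun p l) * E m \<le> exp (- decay_rate * L\<^sup>2) * E m"
      using char_fun_decay[OF l] nn by (intro mult_right_mono) (auto simp: L_def less_imp_le)
    also have "\<dots> = E (Suc m)" by (simp add: E_def algebra_simps flip: exp_add)
    finally show ?thesis .
  qed
  have c0: "norm (char_fun (coord_mult j (coord_mult j p)) l) \<le> A"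
    using char_fun_bound[OF coord2_p] by (simp add: A_def abs_moment_def)
  have t1: "norm (char_fun (coord_mult j (coord_mult j p)) l * char_fun p l ^ m) \<le> A * (s * E (Suc m))"
    unfolding norm_mult using c0 char_fun_power_decay[OF l, of m] sh nn
    by (intro mult_mono order_trans[OF _ sh]) (auto simp: E_def L_def)
  have t2: "norm (char_fun (coord_mult j p) l * char_fun (coord_mult j (pw m)) l) \<le> (M * L) * (M * s * (real m * L * (s * E (Suc m))))"
  proof -
    have "norm (char_fun (coord_mult j (pw m)) l) \<le> M * s * (real m * L * E m)"
      using char_fun_coord_pw_bound[OF l, of j m] by (simp add: M_def s_def L_def E_def)
    also have "\<dots> \<le> M * s * (real m * L * (s * E (Suc m)))"
      using nn sh by (intro mult_left_mono) auto
    finally show ?thesis unfolding norm_mult using coord_p_bound[of j l] nn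
      by (intro mult_mono) (auto simp: M_def L_def)
  qed
  have t3: "norm (char_fun p l * char_fun (coord_mult j (coord_mult j (pw m))) l) \<le> (A * s * real m + 2 * M\<^sup>2 * s\<^sup>2 * (real m)\<^sup>2 * L\<^sup>2) * E (Suc m)"
  proof -
    have "norm (char_fun p l) * norm (char_fun (coord_mult j (coord_mult j (pw m))) l)
      \<le> norm (char_fun p l) * ((A * s * real m + 2 * M\<^sup>2 * s\<^sup>2 * (real m)\<^sup>2 * L\<^sup>2) * E m)"
      using Suc.IH by (intro mult_left_mono) (auto simp: A_def M_def s_def L_def E_def)
    also have "\<dots> = (A * s * real m + 2 * M\<^sup>2 * s\<^sup>2 * (real m)\<^sup>2 * L\<^sup>2) * (norm (char_fun p l) * E m)" by (simp add: mult_ac)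
    also have "\<dots> \<le> (A * s * real m + 2 * M\<^sup>2 * s\<^sup>2 * (real m)\<^sup>2 * L\<^sup>2) * E (Suc m)"
      using nn phi by (intro mult_left_mono add_nonneg_nonneg mult_nonneg_nonneg) auto
    finally show ?thesis by (simp add: norm_mult)
  qed
  have eq: "char_fun (coord_mult j (coord_mult j (pw (Suc m)))) l
    = char_fun (coord_mult j (coord_mult j p)) l * char_fun p l ^ m
      + (char_fun (coord_mult j p) l * char_fun (coord_mult j (pw m)) l
      + (char_fun (coord_mult j p) l * char_fun (coord_mult j (pw m)) l + char_fun p l * char_fun (coord_mult j (coord_mult j (pw m))) l))"
    unfolding coord2_pw_Suc[OF coord2_pw_summable]
    by (simp only: char_fun_add summable_on_add lattice_conv_summable coord2_p coord_p coord_pw_summable pw_summable p_summable coord2_pw_summable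
        char_fun_conv char_fun_conv_power)
  have "norm (char_fun (coord_mult j (coord_mult j (pw (Suc m)))) l)
     \<le> A * (s * E (Suc m)) + ((M * L) * (M * s * (real m * L * (s * E (Suc m)))) + ((M * L) * (M * s * (real m * L * (s * E (Suc m))))
       + (A * s * real m + 2 * M\<^sup>2 * s\<^sup>2 * (real m)\<^sup>2 * L\<^sup>2) * E (Suc m)))"
    unfolding eq by (intro order_trans[OF norm_triangle_ineq] add_mono t1 t2 t3)
  also have "\<dots> = (A * s * (real m + 1) + 2 * M\<^sup>2 * s\<^sup>2 * L\<^sup>2 * (real m + (real m)\<^sup>2)) * E (Suc m)"
    by (simp add: algebra_simps power2_eq_square)
  also have "\<dots> \<le> (A * s * (real m + 1) + 2 * M\<^sup>2 * s\<^sup>2 * L\<^sup>2 * (real (Suc m))\<^sup>2) * E (Suc m)"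
    using nn by (intro mult_right_mono add_mono mult_left_mono order_refl) (auto simp: power2_eq_square algebra_simps)
  finally show ?case by (simp add: A_def M_def s_def L_def E_def mult_ac add.commute)
qed

text \<open>Leibniz' rule for two derivatives of \<open>char_fun a \<phi> ^ m\<close>. In the three terms the vanishing order of the
  derivatives of the odd \<open>a\<close> and the powers of \<open>m\<close> balance in the same way, each derivative costing a factor
  \<open>\<surd>m\<close>.\<close>

lemma drift_second_moment_bound:
  fixes a :: "int ^ 'n \<Rightarrow> real"
  assumes a: "has_moment 3 a" "odd_fun a"
  obtains C where "C \<ge> 0"
    "\<And>m x. (norm (real_vec x))\<^sup>2 * \<bar>lattice_conv a (pw m) x\<bar> \<le> C * real (Suc m) powr (1 - (real CARD('n) + 1) / 2)"
proof -
  have as: "a summable_on UNIV" by (rule has_moment_summable[OF a(1)])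
  have a1: "has_moment 1 a" by (rule has_moment_mono[OF a(1)]) simp
  define e where "e = 1 - (real CARD('n) + 1) / 2"
  have "\<exists>C\<ge>0. \<forall>m x. (real_of_int (x $ j))\<^sup>2 * \<bar>lattice_conv a (pw m) x\<bar> \<le> C * real (Suc m) powr e" for j
  proof -
    define D where "D = coord_mult j"
    have Da2: "has_moment 2 (D a)" unfolding D_def by (rule has_moment_coord_mult) (use a(1) in \<open>simp add: numeral_3_eq_3 numeral_2_eq_2\<close>)
    have Da: "D a summable_on UNIV" by (rule has_moment_summable[OF Da2])
    have DDa1: "has_moment 1 (D (D a))" unfolding D_def by (rule has_moment_coord_mult) (use Da2 in \<open>simp add: D_def numeral_2_eq_2\<close>)
    have DDa: "D (D a) summable_on UNIV" by (rule has_moment_summable[OF DDa1])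
    have DDo: "odd_fun (D (D a))" using a(2) by (simp add: D_def odd_fun_def coord_mult_def)
    have Dp: "D (pw m) summable_on UNIV" "D (D (pw m)) summable_on UNIV" for m
      unfolding D_def by (rule coord_pw_summable coord2_pw_summable)+
    define K1 where "K1 = abs_moment 1 (D (D a))"
    define K2 where "K2 = abs_moment 0 (D a) * (abs_moment 2 p * shift_const)"
    define K3 where "K3 = abs_moment 1 a * (abs_moment 0 (D (D p)) * shift_const)"
    define K4 where "K4 = abs_moment 1 a * (2 * (abs_moment 2 p)\<^sup>2 * shift_const\<^sup>2)"
    have K: "K1 \<ge> 0" "K2 \<ge> 0" "K3 \<ge> 0" "K4 \<ge> 0"
      using shift_const_pos by (auto simp: K1_def K2_def K3_def K4_def intro!: mult_nonneg_nonneg abs_moment_nonneg)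
    define C where "C = coeff_const 1 * K1 + 2 * (coeff_const 1 * K2) + (coeff_const 1 * K3 + coeff_const 3 * K4)"
    have C: "C \<ge> 0" unfolding C_def using K by (intro add_nonneg_nonneg mult_nonneg_nonneg coeff_const_nonneg) auto
    have "(real_of_int (x $ j))\<^sup>2 * \<bar>lattice_conv a (pw m) x\<bar> \<le> C * real (Suc m) powr e" for m x
    proof -
      have "D (lattice_conv a (pw m)) = (\<lambda>x. lattice_conv (D a) (pw m) x + lattice_conv a (D (pw m)) x)"
        unfolding D_def by (rule coord_mult_conv) (use as Da pw_summable Dp in \<open>simp_all add: D_def\<close>)
      then have "D (D (lattice_conv a (pw m))) = (\<lambda>x. D (lattice_conv (D a) (pw m)) x + D (lattice_conv a (D (pw m))) x)"
        by (simp add: D_def coord_mult_add)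
      also have "D (lattice_conv (D a) (pw m)) = (\<lambda>x. lattice_conv (D (D a)) (pw m) x + lattice_conv (D a) (D (pw m)) x)"
        unfolding D_def by (rule coord_mult_conv) (use as Da DDa pw_summable Dp in \<open>simp_all add: D_def\<close>)
      also have "D (lattice_conv a (D (pw m))) = (\<lambda>x. lattice_conv (D a) (D (pw m)) x + lattice_conv a (D (D (pw m))) x)"
        unfolding D_def by (rule coord_mult_conv) (use as Da DDa pw_summable Dp in \<open>simp_all add: D_def\<close>)
      finally have DD: "D (D (lattice_conv a (pw m))) x = lattice_conv (D (D a)) (pw m) x + lattice_conv (D a) (D (pw m)) x
          + (lattice_conv (D a) (D (pw m)) x + lattice_conv a (D (D (pw m))) x)" by simp
      have "(real_of_int (x $ j))\<^sup>2 * \<bar>lattice_conv a (pw m) x\<bar> = \<bar>D (D (lattice_conv a (pw m))) x\<bar>"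
        by (simp add: D_def coord_mult_def abs_mult power2_eq_square)
      also have "\<dots> \<le> \<bar>lattice_conv (D (D a)) (pw m) x\<bar> + 2 * \<bar>lattice_conv (D a) (D (pw m)) x\<bar> + \<bar>lattice_conv a (D (D (pw m))) x\<bar>"
        unfolding DD by linarith
      finally have main: "(real_of_int (x $ j))\<^sup>2 * \<bar>lattice_conv a (pw m) x\<bar>
        \<le> \<bar>lattice_conv (D (D a)) (pw m) x\<bar> + 2 * \<bar>lattice_conv (D a) (D (pw m)) x\<bar> + \<bar>lattice_conv a (D (D (pw m))) x\<bar>" .
      define q where "q i = real (Suc m) powr (- (real CARD('n) + real i) / 2)" for i :: nat
      have q1: "q 1 \<le> real (Suc m) powr e" unfolding q_def e_def by (intro powr_mono) (auto simp: field_simps)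
      have q1m: "real m * q 1 \<le> real (Suc m) powr e"
        using Suc_powr_absorb[of m 1 "- (real CARD('n) + real 1) / 2"] by (simp add: q_def e_def algebra_simps diff_divide_distrib add_divide_distrib)
      have q3m: "(real m)\<^sup>2 * q 3 \<le> real (Suc m) powr e"
      proof -
        have "- (real CARD('n) + real 3) / 2 + real 2 = e" unfolding e_def by (simp add: field_simps)
        then show ?thesis using Suc_powr_absorb[of m 2 "- (real CARD('n) + real 3) / 2"] by (simp only: q_def)
      qed
      have "\<bar>lattice_conv (D (D a)) (pw m) x\<bar> \<le> coeff_const 1 * K1 * q 1"
        unfolding q_def by (rule conv_pw_bound[OF DDa K(1)]) (use char_fun_bound_1[OF DDa1 DDo] in \<open>simp add: K1_def\<close>)
      also have "\<dots> \<le> coeff_const 1 * K1 * real (Suc m) powr e"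
        using K by (intro mult_left_mono q1 mult_nonneg_nonneg coeff_const_nonneg) auto
      finally have b1: "\<bar>lattice_conv (D (D a)) (pw m) x\<bar> \<le> coeff_const 1 * K1 * real (Suc m) powr e" .
      have "\<bar>lattice_conv (D a) (D (pw m)) x\<bar> \<le> coeff_const 1 * (K2 * real m) * q 1"
        unfolding q_def
      proof (rule coeff_bound[OF lattice_conv_summable[OF Da Dp(1)]])
        show "0 \<le> K2 * real m" using K by simp
        fix l :: "real ^ 'n" assume l: "l \<in> torus"
        have "norm (char_fun (lattice_conv (D a) (D (pw m))) l)
          \<le> abs_moment 0 (D a) * (abs_moment 2 p * shift_const * (real m * norm l * exp (- decay_rate * real m * (norm l)\<^sup>2)))"
          unfolding char_fun_conv[OF Da Dp(1)] norm_mult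
          using char_fun_bound[OF Da, of l] char_fun_coord_pw_bound[OF l, of j m]
          by (intro mult_mono) (auto simp: D_def abs_moment_def infsum_nonneg)
        then show "norm (char_fun (lattice_conv (D a) (D (pw m))) l) \<le> K2 * real m * norm l ^ 1 * exp (- decay_rate * real m * (norm l)\<^sup>2)"
          by (simp add: K2_def mult_ac)
      qed
      also have "\<dots> = coeff_const 1 * K2 * (real m * q 1)" by (simp add: mult_ac)
      also have "\<dots> \<le> coeff_const 1 * K2 * real (Suc m) powr e"
        using K by (intro mult_left_mono q1m mult_nonneg_nonneg coeff_const_nonneg) auto
      finally have b2: "\<bar>lattice_conv (D a) (D (pw m)) x\<bar> \<le> coeff_const 1 * K2 * real (Suc m) powr e" .
      have "\<bar>lattice_conv a (D (D (pw m))) x\<bar> \<le> coeff_const 1 * (K3 * real m) * q 1 + coeff_const 3 * (K4 * (real m)\<^sup>2) * q 3"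
        unfolding q_def
      proof (rule coeff_bound_two[OF lattice_conv_summable[OF as Dp(2)]])
        show "0 \<le> K3 * real m" "0 \<le> K4 * (real m)\<^sup>2" using K by simp_all
        fix l :: "real ^ 'n" assume l: "l \<in> torus"
        have "norm (char_fun (lattice_conv a (D (D (pw m)))) l)
          \<le> (abs_moment 1 a * norm l) * ((abs_moment 0 (D (D p)) * shift_const * real m + 2 * (abs_moment 2 p)\<^sup>2 * shift_const\<^sup>2 * (real m)\<^sup>2 * (norm l)\<^sup>2)
             * exp (- decay_rate * real m * (norm l)\<^sup>2))"
          unfolding char_fun_conv[OF as Dp(2)] norm_mult
          using char_fun_bound_1[OF a1 a(2), of l] char_fun_coord2_pw_bound[OF l, of j m]
          by (intro mult_mono) (auto simp: D_def abs_moment_nonneg)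
        then show "norm (char_fun (lattice_conv a (D (D (pw m)))) l)
          \<le> (K3 * real m * norm l ^ 1 + K4 * (real m)\<^sup>2 * norm l ^ 3) * exp (- decay_rate * real m * (norm l)\<^sup>2)"
          by (simp add: K3_def K4_def algebra_simps power3_eq_cube power2_eq_square)
      qed
      also have "\<dots> = coeff_const 1 * K3 * (real m * q 1) + coeff_const 3 * K4 * ((real m)\<^sup>2 * q 3)" by (simp add: mult_ac)
      also have "\<dots> \<le> coeff_const 1 * K3 * real (Suc m) powr e + coeff_const 3 * K4 * real (Suc m) powr e"
        using K by (intro add_mono mult_left_mono q1m q3m mult_nonneg_nonneg coeff_const_nonneg) auto
      finally have b3: "\<bar>lattice_conv a (D (D (pw m))) x\<bar> \<le> coeff_const 1 * K3 * real (Suc m) powr e + coeff_const 3 * K4 * real (Suc m) powr e" .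
      have "(real_of_int (x $ j))\<^sup>2 * \<bar>lattice_conv a (pw m) x\<bar> \<le> coeff_const 1 * K1 * real (Suc m) powr e
          + 2 * (coeff_const 1 * K2 * real (Suc m) powr e) + (coeff_const 1 * K3 * real (Suc m) powr e + coeff_const 3 * K4 * real (Suc m) powr e)"
        using main b1 b2 b3 by linarith
      also have "\<dots> = C * real (Suc m) powr e" unfolding C_def by (simp only: distrib_right mult.assoc)
      finally show ?thesis .
    qed
    with C show ?thesis by blast
  qed
  then obtain C where C: "\<And>j. C j \<ge> 0" "\<And>j m x. (real_of_int (x $ j))\<^sup>2 * \<bar>lattice_conv a (pw m) x\<bar> \<le> C j * real (Suc m) powr e"
    by metis
  have "(norm (real_vec x))\<^sup>2 * \<bar>lattice_conv a (pw m) x\<bar> \<le> (\<Sum>j\<in>UNIV. C j) * real (Suc m) powr e" for m x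
  proof -
    have "(norm (real_vec x))\<^sup>2 = (\<Sum>j\<in>UNIV. (real_of_int (x $ j))\<^sup>2)"
      by (simp add: norm_vec_def L2_set_def sum_nonneg)
    then have "(norm (real_vec x))\<^sup>2 * \<bar>lattice_conv a (pw m) x\<bar> = (\<Sum>j\<in>UNIV. (real_of_int (x $ j))\<^sup>2 * \<bar>lattice_conv a (pw m) x\<bar>)"
      by (simp add: sum_distrib_right)
    also have "\<dots> \<le> (\<Sum>j\<in>UNIV. C j * real (Suc m) powr e)" by (intro sum_mono C)
    finally show ?thesis by (simp add: sum_distrib_right)
  qed
  then show ?thesis using that[of "\<Sum>j\<in>UNIV. C j"] C(1) unfolding e_def by (simp add: sum_nonneg)
qed

end

lemma lattice_norm_ge_1: "x \<noteq> 0 \<Longrightarrow> norm (real_vec (x :: int ^ 'n)) \<ge> 1"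
proof -
  assume "x \<noteq> 0"
  then obtain j where "x $ j \<noteq> 0" by (auto simp: vec_eq_iff)
  then have "\<bar>x $ j\<bar> \<ge> 1" by simp
  then have "\<bar>real_of_int (x $ j)\<bar> \<ge> 1" by (metis of_int_1_le_iff of_int_abs)
  then show ?thesis using coord_le_norm[of x j] by linarith
qed

lemma sum_inverse_sqrt: "(\<Sum>m<N. real (Suc m) powr (- (1 / 2))) \<le> 2 * sqrt (real N)"
proof (induction N)
  case (Suc N)
  have "real (Suc N) powr (- (1 / 2)) = 1 / sqrt (real (Suc N))"
    by (simp add: powr_minus_divide powr_half_sqrt)
  also have "\<dots> \<le> 2 * (sqrt (real (Suc N)) - sqrt (real N))"
  proof -
    define u where "u = sqrt (real (Suc N))"
    define v where "v = sqrt (real N)"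
    have u: "u > 0" "v \<ge> 0" "v \<le> u" "u * u = v * v + 1" by (auto simp: u_def v_def)
    have "1 = (u - v) * (u + v)" using u by (simp add: algebra_simps)
    also have "\<dots> \<le> (u - v) * (2 * u)" using u by (intro mult_left_mono) auto
    finally show ?thesis using u unfolding u_def[symmetric] v_def[symmetric] by (simp add: field_simps)
  qed
  finally show ?case using Suc by simp
qed simp

lemma powr_three_halves_telescope:
  assumes "m \<ge> 1"
  shows "real (Suc m) powr (- (3 / 2)) \<le> 2 * (1 / sqrt (real m) - 1 / sqrt (real (Suc m)))"
proof -
  define u where "u = sqrt (real (Suc m))"
  define v where "v = sqrt (real m)"
  have u: "u > 0" "v > 0" "v \<le> u" "u * u = v * v + 1" using assms by (auto simp: u_def v_def)
  have "real (Suc m) powr (3 / 2) = real (Suc m) powr (1 + 1 / 2)" by simp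
  also have "\<dots> = real (Suc m) * u" unfolding powr_add u_def by (simp add: powr_half_sqrt)
  also have "\<dots> = u * u * u" by (simp add: u_def)
  finally have p: "real (Suc m) powr (- (3 / 2)) = 1 / (u * u * u)" by (simp add: powr_minus_divide)
  have "1 = (u - v) * (u + v)" using u by (simp add: algebra_simps)
  also have "\<dots> \<le> (u - v) * (2 * u)" using u by (intro mult_left_mono) auto
  finally have "1 / (u * u * u) \<le> (u - v) * (2 * u) / (u * u * u)" using u by (intro divide_right_mono) auto
  also have "\<dots> = 2 * (u - v) / (u * u)" using u(1) by (simp add: field_simps)
  also have "\<dots> \<le> 2 * (u - v) / (u * v)" using u(1-3) by (intro divide_left_mono mult_left_mono) auto
  also have "\<dots> = 2 * (1 / v - 1 / u)" using u by (simp add: field_simps)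
  finally show ?thesis unfolding p unfolding u_def v_def .
qed

text \<open>Splitting at \<open>m \<approx> R\<^sup>2\<close> balances the two bounds.\<close>

lemma suminf_two_scale_bound:
  fixes h :: "nat \<Rightarrow> real"
  assumes A: "A \<ge> 0" and R: "R \<ge> 1"
    and h1: "\<And>m. \<bar>h m\<bar> \<le> A * real (Suc m) powr (- (3 / 2))"
    and h2: "\<And>m. R\<^sup>2 * \<bar>h m\<bar> \<le> A * real (Suc m) powr (- (1 / 2))"
  shows "\<bar>\<Sum>m. h m\<bar> \<le> 6 * A / R"
proof -
  \<comment> \<open>Below \<open>N\<close> the bound \<open>h2\<close> sums to \<open>A \<surd>N / R\<^sup>2\<close> and from \<open>N\<close> on \<open>h1\<close> sums to \<open>A / \<surd>N\<close>, up to constants.\<close>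
  define N where "N = nat \<lceil>R\<^sup>2\<rceil>"
  have R2: "R\<^sup>2 \<ge> 1" using R by simp
  have N: "real N \<ge> R\<^sup>2" "real N \<le> 2 * R\<^sup>2" "N \<ge> 1" using R2 unfolding N_def by linarith+
  have sA: "summable (\<lambda>m. A * real (Suc m) powr (- (3 / 2)))" by (intro summable_mult summable_Suc_powr) simp
  have sh: "summable (\<lambda>m. \<bar>h m\<bar>)"
    by (rule summable_comparison_test'[OF sA, of 0]) (use h1 in simp)
  have "\<bar>\<Sum>m. h m\<bar> \<le> (\<Sum>m. \<bar>h m\<bar>)" by (rule summable_rabs[OF sh])
  also have "\<dots> = (\<Sum>m. \<bar>h (m + N)\<bar>) + (\<Sum>m<N. \<bar>h m\<bar>)" by (rule suminf_split_initial_segment[OF sh])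
  also have "(\<Sum>m<N. \<bar>h m\<bar>) \<le> (\<Sum>m<N. A / R\<^sup>2 * real (Suc m) powr (- (1 / 2)))"
  proof (rule sum_mono)
    fix m
    have "R\<^sup>2 > 0" using R2 by linarith
    then show "\<bar>h m\<bar> \<le> A / R\<^sup>2 * real (Suc m) powr (- (1 / 2))"
      using h2[of m] by (simp add: pos_le_divide_eq mult.commute del: of_nat_Suc)
  qed
  also have "\<dots> = A / R\<^sup>2 * (\<Sum>m<N. real (Suc m) powr (- (1 / 2)))" by (simp add: sum_distrib_left)
  also have "\<dots> \<le> A / R\<^sup>2 * (2 * (2 * R))"
  proof -
    have "sqrt (real N) \<le> 2 * R"
      by (rule real_le_lsqrt) (use N R R2 in \<open>auto simp: power_mult_distrib\<close>)
    then have "(\<Sum>m<N. real (Suc m) powr (- (1 / 2))) \<le> 2 * (2 * R)" using sum_inverse_sqrt[of N] by linarith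
    then show ?thesis using A by (intro mult_left_mono) auto
  qed
  also have "\<dots> = 4 * A / R" using R by (simp add: power2_eq_square)
  also have "(\<Sum>m. \<bar>h (m + N)\<bar>) \<le> 2 * A / R"
  proof -
    define g where "g m = 1 / sqrt (real (m + N))" for m
    have g0: "g \<longlonglongrightarrow> 0" unfolding g_def by real_asymp
    have gs: "(\<lambda>m. g m - g (Suc m)) sums (g 0 - 0)" by (rule telescope_sums'[OF g0])
    have "(\<Sum>m. \<bar>h (m + N)\<bar>) \<le> (\<Sum>m. 2 * A * (g m - g (Suc m)))"
    proof (intro suminf_le)
      show "\<bar>h (m + N)\<bar> \<le> 2 * A * (g m - g (Suc m))" for m
      proof -
        have "\<bar>h (m + N)\<bar> \<le> A * (2 * (g m - g (Suc m)))"
          using h1[of "m + N"] mult_left_mono[OF powr_three_halves_telescope[of "m + N"] A] N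
          unfolding g_def add_Suc by linarith
        then show ?thesis by (simp add: algebra_simps)
      qed
      show "summable (\<lambda>m. \<bar>h (m + N)\<bar>)" by (rule summable_ignore_initial_segment[OF sh])
      show "summable (\<lambda>m. 2 * A * (g m - g (Suc m)))" using gs by (intro summable_mult) (rule sums_summable)
    qed
    also have "\<dots> = 2 * A * g 0" using sums_mult[OF gs, of "2 * A"] by (simp add: sums_iff)
    also have "\<dots> \<le> 2 * A * (1 / R)"
    proof (intro mult_left_mono)
      have "R \<le> sqrt (real N)" using N R by (intro real_le_rsqrt)
      then show "g 0 \<le> 1 / R" using R by (simp add: g_def frac_le)
    qed (use A in auto)
    finally show ?thesis by simp
  qed
  finally show ?thesis by simp
qed

context symmetric_walk
begin

text \<open>An odd drift has vanishing order \<open>1\<close>, which gives the summable rate \<open>m\<^bsup>-(\<nu>+1)/2\<^esup>\<close> from dimension two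
  on. Hence the drift only adds a function of \<open>x\<close> and leaves the Gaussian term unchanged.\<close>

theorem drift_expansion:
  assumes a: "has_moment 3 a" "odd_fun a" and dim: "CARD('n) \<ge> 2"
    and P: "\<And>n x. P n x = pw n x + drift_sum a n x"
  shows "uniform_limit UNIV (\<lambda>n x. real n powr (real CARD('n) / 2) * P n x - (gauss n x + limit_const * (\<Sum>m. lattice_conv a (pw m) x))) (\<lambda>_. 0) sequentially"
    and "\<bar>lattice_conv a (pw m) x\<bar> \<le> coeff_const 1 * abs_moment 1 a * real (Suc m) powr (- (real CARD('n) + 1) / 2)"
    and "summable (\<lambda>m. \<bar>lattice_conv a (pw m) x\<bar>)"
proof -
  have as: "a summable_on UNIV" by (rule has_moment_summable[OF a(1)])
  have a1: "has_moment 1 a" by (rule has_moment_mono[OF a(1)]) simp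
  have bound: "norm (char_fun a l) \<le> abs_moment 1 a * norm l ^ 1" for l using char_fun_bound_1[OF a1 a(2)] by simp
  note lim = drift_sum_limit[OF as abs_moment_nonneg bound]
  show "\<bar>lattice_conv a (pw m) x\<bar> \<le> coeff_const 1 * abs_moment 1 a * real (Suc m) powr (- (real CARD('n) + 1) / 2)"
    using conv_pw_bound[OF as abs_moment_nonneg bound, of m x] by simp
  show "summable (\<lambda>m. \<bar>lattice_conv a (pw m) x\<bar>)" using lim(2) dim by simp
  define \<psi> where "\<psi> x = limit_const * (\<Sum>m. lattice_conv a (pw m) x)" for x
  have L2: "uniform_limit UNIV (\<lambda>n x. real n powr (real CARD('n) / 2) * drift_sum a n x - \<psi> x) (\<lambda>x. \<psi> x - \<psi> x) sequentially"
    using uniform_limit_minus[OF lim(1) uniform_limit_const[where S = UNIV and c = \<psi> and f = sequentially]] dim by (simp add: \<psi>_def)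
  have "uniform_limit UNIV (\<lambda>n x. (real n powr (real CARD('n) / 2) * pw n x - gauss n x)
      + (real n powr (real CARD('n) / 2) * drift_sum a n x - \<psi> x)) (\<lambda>x. 0 + (\<psi> x - \<psi> x)) sequentially"
    by (intro uniform_limit_add L2 local_limit)
  also have "(\<lambda>n x. (real n powr (real CARD('n) / 2) * pw n x - gauss n x)
      + (real n powr (real CARD('n) / 2) * drift_sum a n x - \<psi> x)) = (\<lambda>n x. real n powr (real CARD('n) / 2) * P n x - (gauss n x + \<psi> x))"
    unfolding P by (simp add: fun_eq_iff algebra_simps)
  finally show "uniform_limit UNIV (\<lambda>n x. real n powr (real CARD('n) / 2) * P n x - (gauss n x + limit_const * (\<Sum>m. lattice_conv a (pw m) x))) (\<lambda>_. 0) sequentially"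
    by (simp add: \<psi>_def)
qed

theorem two_dim_expansion:
  assumes a: "has_moment 3 a" "odd_fun a" and dim: "CARD('n) = 2"
    and P: "\<And>n x. P n x = pw n x + drift_sum a n x"
  shows "\<exists>\<psi>. odd_fun \<psi> \<and> (\<exists>C. \<forall>x. \<bar>\<psi> x\<bar> \<le> C) \<and> (\<exists>C. \<forall>x. x \<noteq> 0 \<longrightarrow> \<bar>\<psi> x\<bar> \<le> C / norm (real_vec x))
    \<and> uniform_limit UNIV (\<lambda>n x. real n * P n x - (gauss n x + \<psi> x)) (\<lambda>_. 0) sequentially"
proof -
  have dim2: "CARD('n) \<ge> 2" using dim by simp
  note E = drift_expansion[OF a dim2 P]
  have as: "a summable_on UNIV" by (rule has_moment_summable[OF a(1)])
  define \<psi> where "\<psi> x = limit_const * (\<Sum>m. lattice_conv a (pw m) x)" for x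
  have slc: "summable (\<lambda>m. lattice_conv a (pw m) x)" for x by (rule summable_rabs_cancel[OF E(3)])
  have odd: "odd_fun \<psi>"
    unfolding odd_fun_def \<psi>_def
    using odd_fun_conv[OF a(2), of "pw _"] pw_sym suminf_minus[OF slc] by (simp add: odd_fun_def)
  obtain C where C: "C \<ge> 0" "\<And>m x. (norm (real_vec x))\<^sup>2 * \<bar>lattice_conv a (pw m) x\<bar> \<le> C * real (Suc m) powr (1 - (real CARD('n) + 1) / 2)"
    using drift_second_moment_bound[OF a] by blast
  define C0 where "C0 = coeff_const 1 * abs_moment 1 a"
  have C0: "C0 \<ge> 0" unfolding C0_def by (intro mult_nonneg_nonneg coeff_const_nonneg abs_moment_nonneg)
  define A where "A = max C C0"
  have A: "A \<ge> 0" using C by (simp add: A_def)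
  have h1: "\<bar>lattice_conv a (pw m) x\<bar> \<le> A * real (Suc m) powr (- (3 / 2))" for m x
  proof -
    have "\<bar>lattice_conv a (pw m) x\<bar> \<le> C0 * real (Suc m) powr (- (3 / 2))" using E(2)[of m x] by (simp add: dim C0_def)
    also have "\<dots> \<le> A * real (Suc m) powr (- (3 / 2))" by (intro mult_right_mono) (auto simp: A_def)
    finally show ?thesis .
  qed
  have h2: "(norm (real_vec x))\<^sup>2 * \<bar>lattice_conv a (pw m) x\<bar> \<le> A * real (Suc m) powr (- (1 / 2))" for m x
  proof -
    have "(norm (real_vec x))\<^sup>2 * \<bar>lattice_conv a (pw m) x\<bar> \<le> C * real (Suc m) powr (- (1 / 2))" using C(2)[of x m] by (simp add: dim)
    also have "\<dots> \<le> A * real (Suc m) powr (- (1 / 2))" by (intro mult_right_mono) (auto simp: A_def)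
    finally show ?thesis .
  qed
  have decay: "\<bar>\<psi> x\<bar> \<le> (limit_const * (6 * A)) / norm (real_vec x)" if "x \<noteq> 0" for x
  proof -
    have "\<bar>\<Sum>m. lattice_conv a (pw m) x\<bar> \<le> 6 * A / norm (real_vec x)"
      by (rule suminf_two_scale_bound[OF A lattice_norm_ge_1[OF that] h1 h2])
    from mult_left_mono[OF this, of limit_const] show ?thesis using limit_const_pos by (simp add: \<psi>_def abs_mult)
  qed
  have bounded: "\<bar>\<psi> x\<bar> \<le> limit_const * (6 * A)" for x
  proof (cases "x = 0")
    case True
    then show ?thesis using odd_fun_0[OF odd] limit_const_pos A by simp
  next
    case False
    have "(limit_const * (6 * A)) / norm (real_vec x) \<le> (limit_const * (6 * A)) / 1"
      using lattice_norm_ge_1[OF False] limit_const_pos A by (intro divide_left_mono) auto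
    then show ?thesis using decay[OF False] by simp
  qed
  have "uniform_limit UNIV (\<lambda>n x. real n * P n x - (gauss n x + \<psi> x)) (\<lambda>_. 0) sequentially"
    using E(1) by (simp add: dim \<psi>_def)
  then show ?thesis using odd bounded decay by blast
qed

section \<open>Dimension at least three: the Green function\<close>

lemma pw_summable_time:
  assumes "CARD('n) \<ge> 3"
  shows "summable (\<lambda>m. coeff_const 0 * real (Suc m) powr (- (real CARD('n) / 2)))"
  using assms by (intro summable_mult summable_Suc_powr) auto

text \<open>The geometric series for \<open>1 / (1 - char_fun p)\<close> is integrated term by term. The integrals of the norms are
  \<open>O(m\<^bsup>-\<nu>/2\<^esup>)\<close>, which is summable from dimension three on.\<close>

lemma green_function_eq:
  assumes dim: "CARD('n) \<ge> 3"
  shows "green_function p x = (\<Sum>m. pw m x)" and "summable (\<lambda>m. pw m x)"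
proof -
  define F where "F m l = indicat_real torus l *\<^sub>R (char_fun (pw m) l * cis (- (l \<bullet> real_vec x)))" for m and l :: "real ^ 'n"
  have int: "integrable lborel (F m)" for m
    using char_fun_set_integrable[OF pw_summable, of m x] by (simp add: set_integrable_def F_def[abs_def])
  have nF: "norm (F m l) = indicat_real torus l * norm (char_fun p l) ^ m" for m l
    by (simp add: F_def norm_mult char_fun_conv_power[OF p_summable] norm_power)
  have AE0: "AE l :: real ^ 'n in lborel. l \<noteq> 0" by (rule AE_lborel_singleton)
  have small: "l \<in> torus \<Longrightarrow> l \<noteq> 0 \<Longrightarrow> norm (char_fun p l) < 1" for l by (rule char_fun_less_1)
  have 1: "AE l in lborel. summable (\<lambda>m. norm (F m l))"
    using AE0
  proof eventually_elim
    case (elim l)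
    show ?case
    proof (cases "l \<in> torus")
      case True
      then show ?thesis unfolding nF using small[OF True elim] by (simp add: summable_geometric)
    qed (simp add: nF)
  qed
  have sum_time: "summable (\<lambda>m. coeff_const 0 * real (Suc m) powr (- (real CARD('n) / 2)))"
    by (rule pw_summable_time[OF dim])
  have 2: "summable (\<lambda>m. \<integral>l. norm (F m l) \<partial>lborel)"
  proof (rule summable_comparison_test'[OF sum_time, of 0])
    fix m
    have "(\<integral>l. norm (F m l) \<partial>lborel) \<le> (LINT l:torus|lborel. norm (l :: real ^ 'n) ^ 0 * exp (- decay_rate * real m * (norm l)\<^sup>2))"
      unfolding set_lebesgue_integral_def
    proof (rule integral_mono)
      show "integrable lborel (\<lambda>l. norm (F m l))" using int by (rule integrable_norm)
      show "integrable lborel (\<lambda>l :: real ^ 'n. indicat_real torus l *\<^sub>R (norm l ^ 0 * exp (- decay_rate * real m * (norm l)\<^sup>2)))"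
        by (rule borel_integrable_compact) (auto intro!: continuous_intros)
      show "norm (F m l) \<le> indicat_real torus l *\<^sub>R (norm l ^ 0 * exp (- decay_rate * real m * (norm l)\<^sup>2))" for l
        unfolding nF using char_fun_power_decay[of l m] by (auto simp: indicator_def norm_power)
    qed
    also have "\<dots> \<le> coeff_const 0 * real (Suc m) powr (- (real CARD('n) / 2))" using coeff_const[where k = 0 and m = m] by simp
    finally show "norm (\<integral>l. norm (F m l) \<partial>lborel) \<le> coeff_const 0 * real (Suc m) powr (- (real CARD('n) / 2))" by simp
  qed
  have sums: "(\<lambda>m. \<integral>l. F m l \<partial>lborel) sums (\<integral>l. (\<Sum>m. F m l) \<partial>lborel)" by (rule sums_integral[OF int 1 2])
  have Fm: "(\<integral>l. F m l \<partial>lborel) = complex_of_real ((2 * pi) ^ CARD('n) * pw m x)" for m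
    using char_fun_inversion[OF pw_summable, of m x] by (simp add: F_def set_lebesgue_integral_def)
  have "(\<integral>l. (\<Sum>m. F m l) \<partial>lborel) = (LINT l:torus|lborel. exp (- (\<i> * complex_of_real (real_vec x \<bullet> l))) / (1 - char_fun p l))"
    unfolding set_lebesgue_integral_def
  proof (rule integral_cong_AE)
    have m1: "char_fun p \<in> borel_measurable borel"
      by (intro borel_measurable_continuous_onI continuous_on_char_fun_p)
    have m2: "(\<lambda>l :: real ^ 'n. exp (- (\<i> * complex_of_real (real_vec x \<bullet> l)))) \<in> borel_measurable borel"
      by (intro borel_measurable_continuous_onI continuous_intros)
    show "(\<lambda>l. indicat_real torus l *\<^sub>R (exp (- (\<i> * complex_of_real (real_vec x \<bullet> l))) / (1 - char_fun p l))) \<in> borel_measurable lborel"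
      using m1 m2 by measurable
    show "(\<lambda>l. \<Sum>m. F m l) \<in> borel_measurable lborel"
      using int by (intro borel_measurable_suminf) auto
    show "AE l in lborel. (\<Sum>m. F m l) = indicat_real torus l *\<^sub>R (exp (- (\<i> * complex_of_real (real_vec x \<bullet> l))) / (1 - char_fun p l))"
      using AE0
    proof eventually_elim
      case (elim l)
      show ?case
      proof (cases "l \<in> torus")
        case True
        have F: "F m l = char_fun p l ^ m * cis (- (l \<bullet> real_vec x))" for m
          using True by (simp add: F_def char_fun_conv_power[OF p_summable])
        have "(\<lambda>m. char_fun p l ^ m * cis (- (l \<bullet> real_vec x))) sums (1 / (1 - char_fun p l) * cis (- (l \<bullet> real_vec x)))"
          by (intro sums_mult2 geometric_sums small True elim)
        then have "(\<Sum>m. F m l) = 1 / (1 - char_fun p l) * cis (- (l \<bullet> real_vec x))" unfolding F by (rule sums_unique[symmetric])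
        also have "cis (- (l \<bullet> real_vec x)) = exp (- (\<i> * complex_of_real (real_vec x \<bullet> l)))"
          by (simp add: cis_conv_exp inner_commute)
        finally show ?thesis using True by simp
      qed (simp add: F_def)
    qed
  qed
  with sums have S: "(\<lambda>m. complex_of_real ((2 * pi) ^ CARD('n) * pw m x)) sums (LINT l:torus|lborel. exp (- (\<i> * complex_of_real (real_vec x \<bullet> l))) / (1 - char_fun p l))"
    unfolding Fm by simp
  then have "(\<lambda>m. Re (complex_of_real ((2 * pi) ^ CARD('n) * pw m x))) sums Re (LINT l:torus|lborel. exp (- (\<i> * complex_of_real (real_vec x \<bullet> l))) / (1 - char_fun p l))"
    by (rule sums_Re)
  then have "(\<lambda>m. (2 * pi) ^ CARD('n) * pw m x) sums ((2 * pi) ^ CARD('n) * green_function p x)"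
    by (simp only: Re_complex_of_real) (simp add: green_function_def)
  then have "(\<lambda>m. pw m x) sums green_function p x"
    using sums_mult_iff[of "(2 * pi) ^ CARD('n)" "\<lambda>m. pw m x" "green_function p x"] by simp
  then show "green_function p x = (\<Sum>m. pw m x)" "summable (\<lambda>m. pw m x)" by (auto simp: sums_iff)
qed

lemma conv_green_function:
  fixes a :: "int ^ 'n \<Rightarrow> real"
  assumes dim: "CARD('n) \<ge> 3" and a: "a summable_on UNIV"
  shows "lattice_conv a (green_function p) x = (\<Sum>m. lattice_conv a (pw m) x)"
proof -
  define T where "T = (\<Sum>m. coeff_const 0 * real (Suc m) powr (- (real CARD('n) / 2)))"
  have nat_sum: "(f has_sum suminf f) UNIV" if "\<And>m. f m \<ge> 0" "summable f" for f :: "nat \<Rightarrow> real"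
    using that by (intro sums_nonneg_imp_has_sum summable_sums) auto
  have G: "((\<lambda>m. pw m y) has_sum green_function p y) UNIV" for y
    unfolding green_function_eq(1)[OF dim] by (rule nat_sum[OF pw_nonneg green_function_eq(2)[OF dim]])
  have GT: "green_function p y \<le> T" for y
    unfolding green_function_eq(1)[OF dim] T_def
    by (intro suminf_le green_function_eq(2)[OF dim] pw_summable_time[OF dim]) (use pw_bound in simp)
  have "(\<lambda>(y, m). a y * pw m (x - y)) abs_summable_on (UNIV \<times> UNIV)"
    unfolding Infinite_Sum.abs_summable_on_Sigma_iff
  proof (intro conjI ballI)
    fix y
    have "(\<lambda>m. \<bar>a y\<bar> * pw m (x - y)) summable_on UNIV"
      using G[of "x - y"] by (intro summable_on_cmult_right) (auto simp: summable_on_def)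
    then show "(\<lambda>m. case (y, m) of (y, m) \<Rightarrow> a y * pw m (x - y)) abs_summable_on UNIV"
      by (simp add: abs_mult pw_nonneg)
  next
    have "(\<lambda>y. T * \<bar>a y\<bar>) summable_on UNIV" by (intro summable_on_cmult_right summable_on_real_abs a)
    then show "(\<lambda>y. \<Sum>\<^sub>\<infinity>m. norm (case (y, m) of (y, m) \<Rightarrow> a y * pw m (x - y))) abs_summable_on UNIV"
    proof (rule Infinite_Sum.abs_summable_on_comparison_test')
      fix y
      have "(\<Sum>\<^sub>\<infinity>m. norm (case (y, m) of (y, m) \<Rightarrow> a y * pw m (x - y))) = \<bar>a y\<bar> * green_function p (x - y)"
        using infsumI[OF G[of "x - y"]] by (simp add: abs_mult pw_nonneg infsum_cmult_right')
      moreover have "0 \<le> green_function p (x - y)" using has_sum_nonneg[OF G] pw_nonneg by blast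
      ultimately show "norm (\<Sum>\<^sub>\<infinity>m. norm (case (y, m) of (y, m) \<Rightarrow> a y * pw m (x - y))) \<le> T * \<bar>a y\<bar>"
        using mult_right_mono[OF GT[of "x - y"], of "\<bar>a y\<bar>"] by (simp add: mult.commute)
    qed
  qed
  then have ss: "(\<lambda>(y, m). a y * pw m (x - y)) summable_on (UNIV \<times> UNIV)" by (rule abs_summable_summable)
  have "lattice_conv a (green_function p) x = (\<Sum>\<^sub>\<infinity>y. \<Sum>\<^sub>\<infinity>m. a y * pw m (x - y))"
    unfolding lattice_conv_def by (simp add: infsum_cmult_right' infsumI[OF G])
  also have "\<dots> = (\<Sum>\<^sub>\<infinity>m. \<Sum>\<^sub>\<infinity>y. a y * pw m (x - y))" by (rule infsum_swap_banach[OF ss])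
  also have "\<dots> = (\<Sum>\<^sub>\<infinity>m. lattice_conv a (pw m) x)" by (simp add: lattice_conv_def)
  also have "(\<Sum>\<^sub>\<infinity>m. lattice_conv a (pw m) x) = (\<Sum>m. lattice_conv a (pw m) x)"
  proof -
    have "(\<lambda>(m, y). a y * pw m (x - y)) summable_on (UNIV \<times> UNIV)"
      using ss by (subst summable_on_swap) simp
    then have "(\<lambda>m. \<Sum>\<^sub>\<infinity>y. a y * pw m (x - y)) summable_on UNIV"
      using summable_on_Sigma_banach[of "\<lambda>m y. a y * pw m (x - y)" UNIV "\<lambda>_. UNIV"] by simp
    then have "(\<lambda>m. lattice_conv a (pw m) x) summable_on UNIV" by (simp add: lattice_conv_def)
    from has_sum_imp_sums[OF has_sum_infsum[OF this]] show ?thesis by (rule sums_unique)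
  qed
  finally show ?thesis .
qed

end

section \<open>Laws, moments and expectations\<close>

lemma measurable_count_space_binary:
  fixes f :: "'w \<Rightarrow> 'a :: countable" and g :: "'w \<Rightarrow> 'b :: countable"
  assumes f: "f \<in> M \<rightarrow>\<^sub>M count_space UNIV" and g: "g \<in> M \<rightarrow>\<^sub>M count_space UNIV"
  shows "(\<lambda>\<omega>. F (f \<omega>) (g \<omega>)) \<in> M \<rightarrow>\<^sub>M count_space UNIV"
proof (rule measurable_compose_countable[OF _ f, of "\<lambda>i \<omega>. F i (g \<omega>)"])
  show "(\<lambda>\<omega>. F i (g \<omega>)) \<in> M \<rightarrow>\<^sub>M count_space UNIV" for i
    by (rule measurable_compose[OF g]) simp
qed

context prob_space
begin

lemma expectation_partition:
  fixes g :: "'a \<Rightarrow> real" and Z :: "'a \<Rightarrow> 'b :: countable"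
  assumes g: "integrable M g" and Z: "Z \<in> M \<rightarrow>\<^sub>M count_space UNIV"
  shows "((\<lambda>y. \<integral>\<omega>. g \<omega> * indicator (Z -` {y}) \<omega> \<partial>M) has_sum (\<integral>\<omega>. g \<omega> \<partial>M)) UNIV"
proof -
  have set: "Z -` {y} \<inter> space M \<in> sets M" for y
    using measurable_sets[OF Z, of "{y}"] by simp
  have int: "integrable M (\<lambda>\<omega>. g \<omega> * indicator (Z -` {y}) \<omega>)" for y
  proof -
    have "integrable M (\<lambda>\<omega>. indicator (Z -` {y} \<inter> space M) \<omega> *\<^sub>R g \<omega>)"
      using integrable_mult_indicator[OF set g] .
    moreover have "integrable M (\<lambda>\<omega>. indicator (Z -` {y} \<inter> space M) \<omega> *\<^sub>R g \<omega>) \<longleftrightarrow> integrable M (\<lambda>\<omega>. g \<omega> * indicator (Z -` {y}) \<omega>)"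
      by (rule Bochner_Integration.integrable_cong) (auto simp: indicator_def)
    ultimately show ?thesis by blast
  qed
  have int_abs: "integrable M (\<lambda>\<omega>. \<bar>g \<omega>\<bar> * indicator (Z -` {y}) \<omega>)" for y
    using integrable_abs[OF int[of y]] by (simp add: abs_mult)
  have sint: "(\<lambda>y. \<integral>\<omega>. \<bar>g \<omega>\<bar> * indicator (Z -` {y}) \<omega> \<partial>M) summable_on UNIV"
  proof (rule nonneg_bdd_above_summable_on)
    show "0 \<le> (\<integral>\<omega>. \<bar>g \<omega>\<bar> * indicator (Z -` {y}) \<omega> \<partial>M)" for y by (intro integral_nonneg_AE) auto
    show "bdd_above (sum (\<lambda>y. \<integral>\<omega>. \<bar>g \<omega>\<bar> * indicator (Z -` {y}) \<omega> \<partial>M) ` {F. F \<subseteq> UNIV \<and> finite F})"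
    proof (rule bdd_aboveI2)
      fix F :: "'b set" assume "F \<in> {F. F \<subseteq> UNIV \<and> finite F}"
      then have F: "finite F" by simp
      have "(\<Sum>y\<in>F. \<integral>\<omega>. \<bar>g \<omega>\<bar> * indicator (Z -` {y}) \<omega> \<partial>M) = (\<integral>\<omega>. (\<Sum>y\<in>F. \<bar>g \<omega>\<bar> * indicator (Z -` {y}) \<omega>) \<partial>M)"
        by (subst Bochner_Integration.integral_sum) (use int_abs in auto)
      also have "\<dots> \<le> (\<integral>\<omega>. \<bar>g \<omega>\<bar> \<partial>M)"
      proof (rule integral_mono)
        show "integrable M (\<lambda>\<omega>. \<Sum>y\<in>F. \<bar>g \<omega>\<bar> * indicator (Z -` {y}) \<omega>)" using int_abs by auto
        show "integrable M (\<lambda>\<omega>. \<bar>g \<omega>\<bar>)" using g by (rule integrable_abs)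
        show "(\<Sum>y\<in>F. \<bar>g \<omega>\<bar> * indicator (Z -` {y}) \<omega>) \<le> \<bar>g \<omega>\<bar>" for \<omega>
        proof -
          have "(\<Sum>y\<in>F. \<bar>g \<omega>\<bar> * indicator (Z -` {y}) \<omega>) = (\<Sum>y\<in>F. if y = Z \<omega> then \<bar>g \<omega>\<bar> else 0)"
            by (intro sum.cong refl) (auto simp: indicator_def)
          then show ?thesis using F by simp
        qed
      qed
      finally show "(\<Sum>y\<in>F. \<integral>\<omega>. \<bar>g \<omega>\<bar> * indicator (Z -` {y}) \<omega> \<partial>M) \<le> (\<integral>\<omega>. \<bar>g \<omega>\<bar> \<partial>M)" .
    qed
  qed
  define F where "F \<omega> y = complex_of_real (g \<omega> * indicator (Z -` {y}) \<omega>)" for \<omega> y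
  have sf: "sigma_finite_measure M" ..
  have Fi: "integrable M (\<lambda>\<omega>. F \<omega> y)" for y unfolding F_def using int by (simp only: complex_of_real_integrable_eq)
  have Fs: "F \<omega> abs_summable_on UNIV" for \<omega>
  proof (rule finite_nonzero_values_imp_summable_on)
    have "{y \<in> UNIV. norm (F \<omega> y) \<noteq> 0} \<subseteq> {Z \<omega>}" by (auto simp: F_def indicator_def split: if_splits)
    then show "finite {y \<in> UNIV. norm (F \<omega> y) \<noteq> 0}" by (rule finite_subset) simp
  qed
  have nF: "norm (F \<omega> y) = \<bar>g \<omega>\<bar> * indicator (Z -` {y}) \<omega>" for \<omega> y
    unfolding F_def norm_of_real by (simp add: abs_mult)
  have Fsi: "(\<lambda>y. \<integral>\<omega>. norm (F \<omega> y) \<partial>M) summable_on UNIV" unfolding nF by (rule sint)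
  have Fsum: "(\<Sum>\<^sub>\<infinity>y. F \<omega> y) = complex_of_real (g \<omega>)" for \<omega>
  proof -
    have "(\<Sum>\<^sub>\<infinity>y. F \<omega> y) = (\<Sum>\<^sub>\<infinity>y\<in>{Z \<omega>}. complex_of_real (g \<omega>))"
      by (rule infsum_cong_neutral) (auto simp: F_def indicator_def)
    then show ?thesis by simp
  qed
  have "complex_of_real (\<integral>\<omega>. g \<omega> \<partial>M) = (\<Sum>\<^sub>\<infinity>y. \<integral>\<omega>. F \<omega> y \<partial>M)"
    using integral_infsum(1)[OF sf Fi Fs Fsi] unfolding Fsum by simp
  also have "\<dots> = (\<Sum>\<^sub>\<infinity>y. complex_of_real (\<integral>\<omega>. g \<omega> * indicator (Z -` {y}) \<omega> \<partial>M))"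
    unfolding F_def by (simp only: integral_complex_of_real)
  finally have eq: "complex_of_real (\<integral>\<omega>. g \<omega> \<partial>M) = (\<Sum>\<^sub>\<infinity>y. complex_of_real (\<integral>\<omega>. g \<omega> * indicator (Z -` {y}) \<omega> \<partial>M))" .
  have s: "(\<lambda>y. \<integral>\<omega>. g \<omega> * indicator (Z -` {y}) \<omega> \<partial>M) summable_on UNIV"
  proof (rule summable_on_real_comparison[OF sint])
    fix y
    have "\<bar>\<integral>\<omega>. g \<omega> * indicator (Z -` {y}) \<omega> \<partial>M\<bar> \<le> (\<integral>\<omega>. \<bar>g \<omega> * indicator (Z -` {y}) \<omega>\<bar> \<partial>M)" by (rule integral_abs_bound)
    then show "\<bar>\<integral>\<omega>. g \<omega> * indicator (Z -` {y}) \<omega> \<partial>M\<bar> \<le> (\<integral>\<omega>. \<bar>g \<omega>\<bar> * indicator (Z -` {y}) \<omega> \<partial>M)" by (simp add: abs_mult)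
  qed
  have "(\<Sum>\<^sub>\<infinity>y. \<integral>\<omega>. g \<omega> * indicator (Z -` {y}) \<omega> \<partial>M) = (\<integral>\<omega>. g \<omega> \<partial>M)"
    using eq unfolding infsum_of_real_banach[OF s] by (simp only: of_real_eq_iff)
  then show ?thesis using has_sum_infsum[OF s] by simp
qed

lemma law_expectation:
  fixes h :: "'b :: countable \<Rightarrow> real"
  assumes h: "integrable M (\<lambda>\<omega>. h (Z \<omega>))" and Z: "Z \<in> M \<rightarrow>\<^sub>M count_space UNIV"
  shows "((\<lambda>y. law M Z y * h y) has_sum (\<integral>\<omega>. h (Z \<omega>) \<partial>M)) UNIV"
proof -
  have "(\<integral>\<omega>. h (Z \<omega>) * indicator (Z -` {y}) \<omega> \<partial>M) = law M Z y * h y" for y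
  proof -
    have set: "Z -` {y} \<inter> space M \<in> sets M"
      using measurable_sets[OF Z, of "{y}"] by simp
    have "(\<integral>\<omega>. h (Z \<omega>) * indicator (Z -` {y}) \<omega> \<partial>M) = (\<integral>\<omega>. h y * indicator (Z -` {y} \<inter> space M) \<omega> \<partial>M)"
      by (rule Bochner_Integration.integral_cong) (auto simp: indicator_def)
    also have "\<dots> = h y * measure M (Z -` {y} \<inter> space M)" using set by simp
    also have "Z -` {y} \<inter> space M = {\<omega> \<in> space M. Z \<omega> = y}" by auto
    finally show ?thesis by (simp add: law_def mult.commute)
  qed
  then show ?thesis using expectation_partition[OF h Z] by simp
qed

lemma law_has_sum: "((law M Z) has_sum 1) UNIV" if "Z \<in> M \<rightarrow>\<^sub>M count_space (UNIV :: 'b :: countable set)"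
  using law_expectation[of "\<lambda>_. 1" Z] that by (simp add: prob_space)

lemma law_nonneg: "law M Z y \<ge> 0"
  by (simp add: law_def)

lemma prob_partition:
  fixes Z :: "'a \<Rightarrow> 'b :: countable"
  assumes A: "A \<in> sets M" and Z: "Z \<in> M \<rightarrow>\<^sub>M count_space UNIV"
  shows "measure M A = (\<Sum>\<^sub>\<infinity>y. measure M (A \<inter> {\<omega> \<in> space M. Z \<omega> = y}))"
proof -
  have "(\<integral>\<omega>. indicator A \<omega> * indicator (Z -` {y}) \<omega> \<partial>M) = measure M (A \<inter> {\<omega> \<in> space M. Z \<omega> = y})" for y
  proof -
    have "{\<omega> \<in> space M. Z \<omega> = y} = Z -` {y} \<inter> space M" by auto
    then have set: "{\<omega> \<in> space M. Z \<omega> = y} \<in> sets M"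
      using measurable_sets[OF Z, of "{y}"] by simp
    have "(\<integral>\<omega>. indicator A \<omega> * indicator (Z -` {y}) \<omega> \<partial>M) = (\<integral>\<omega>. indicator (A \<inter> {\<omega> \<in> space M. Z \<omega> = y}) \<omega> \<partial>M :: real)"
      by (rule Bochner_Integration.integral_cong) (auto simp: indicator_def)
    then show ?thesis using A set by simp
  qed
  moreover have "integrable M (\<lambda>\<omega>. indicator A \<omega> :: real)" using A by (intro integrable_real_indicator) (auto simp: less_top[symmetric])
  ultimately show ?thesis
    using infsumI[OF expectation_partition[OF _ Z, of "indicator A"]] A by simp
qed

lemma finite_moments_coord:
  fixes Y :: "'a \<Rightarrow> int ^ 'n"
  assumes "finite_moments M Y k"
  shows "integrable M (\<lambda>\<omega>. real_of_int (Y \<omega> $ i) ^ k)"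
proof -
  have "(\<Sum>j\<in>UNIV. if j = i then k else 0) = k" by simp
  then have "integrable M (\<lambda>\<omega>. \<Prod>j\<in>UNIV. real_of_int (Y \<omega> $ j) ^ (if j = i then k else 0))"
    using assms unfolding finite_moments_def by blast
  moreover have "(\<Prod>j\<in>UNIV. real_of_int (Y \<omega> $ j) ^ (if j = i then k else 0)) = real_of_int (Y \<omega> $ i) ^ k" for \<omega>
    by (subst prod.remove[of UNIV i]) auto
  ultimately show ?thesis by simp
qed

lemma finite_moments_norm:
  fixes Y :: "'a \<Rightarrow> int ^ 'n"
  assumes m: "finite_moments M Y k" and Y: "Y \<in> M \<rightarrow>\<^sub>M count_space UNIV"
  shows "integrable M (\<lambda>\<omega>. norm (real_vec (Y \<omega>)) ^ k)"
proof (rule Bochner_Integration.integrable_bound)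
  show "integrable M (\<lambda>\<omega>. \<Sum>i\<in>UNIV. real CARD('n) ^ k * \<bar>real_of_int (Y \<omega> $ i) ^ k\<bar>)"
    by (intro Bochner_Integration.integrable_sum integrable_mult_right integrable_abs finite_moments_coord m)
  show "(\<lambda>\<omega>. norm (real_vec (Y \<omega>)) ^ k) \<in> borel_measurable M"
    by (rule measurable_compose[OF Y]) simp
  have "norm (real_vec y) ^ k \<le> (\<Sum>i\<in>UNIV. real CARD('n) ^ k * \<bar>real_of_int (y $ i) ^ k\<bar>)" for y :: "int ^ 'n"
  proof -
    define m where "m = Max (range (\<lambda>i. \<bar>real_of_int (y $ i)\<bar>))"
    have le: "\<bar>real_of_int (y $ i)\<bar> \<le> m" for i unfolding m_def by (rule Max_ge) auto
    have "m \<in> range (\<lambda>i. \<bar>real_of_int (y $ i)\<bar>)" unfolding m_def by (rule Max_in) auto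
    then obtain i where i: "m = \<bar>real_of_int (y $ i)\<bar>" by auto
    have "norm (real_vec y) \<le> (\<Sum>i\<in>UNIV. \<bar>real_of_int (y $ i)\<bar>)" using norm_le_l1_cart[of "real_vec y"] by simp
    also have "\<dots> \<le> real CARD('n) * m" using sum_bounded_above[of UNIV "\<lambda>i. \<bar>real_of_int (y $ i)\<bar>" m] le by simp
    finally have "norm (real_vec y) ^ k \<le> (real CARD('n) * m) ^ k" by (intro power_mono) auto
    also have "\<dots> = real CARD('n) ^ k * \<bar>real_of_int (y $ i) ^ k\<bar>" by (simp add: i power_mult_distrib power_abs)
    also have "\<dots> \<le> (\<Sum>i\<in>UNIV. real CARD('n) ^ k * \<bar>real_of_int (y $ i) ^ k\<bar>)"
      by (rule member_le_sum[of i UNIV "\<lambda>i. real CARD('n) ^ k * \<bar>real_of_int (y $ i) ^ k\<bar>"]) auto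
    finally show ?thesis .
  qed
  then show "AE \<omega> in M. norm (norm (real_vec (Y \<omega>)) ^ k) \<le> norm (\<Sum>i\<in>UNIV. real CARD('n) ^ k * \<bar>real_of_int (Y \<omega> $ i) ^ k\<bar>)"
    by (intro AE_I2) (simp add: order_trans[OF _ abs_ge_self])
qed

lemma law_has_moment:
  fixes Y :: "'a \<Rightarrow> int ^ 'n"
  assumes m: "finite_moments M Y k" and Y: "Y \<in> M \<rightarrow>\<^sub>M count_space UNIV"
  shows "has_moment k (law M Y)"
  using law_has_sum[OF Y] law_expectation[OF finite_moments_norm[OF m Y] Y]
  by (auto simp: has_moment_def summable_on_def mult.commute)

lemma integrable_norm_power_mono:
  fixes Y :: "'a \<Rightarrow> int ^ 'n"
  assumes m: "integrable M (\<lambda>\<omega>. norm (real_vec (Y \<omega>)) ^ k)" and Y: "Y \<in> M \<rightarrow>\<^sub>M count_space UNIV" and "j \<le> k"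
  shows "integrable M (\<lambda>\<omega>. norm (real_vec (Y \<omega>)) ^ j)"
proof (rule Bochner_Integration.integrable_bound)
  show "integrable M (\<lambda>\<omega>. 1 + norm (real_vec (Y \<omega>)) ^ k)" using m by simp
  show "(\<lambda>\<omega>. norm (real_vec (Y \<omega>)) ^ j) \<in> borel_measurable M"
    by (rule measurable_compose[OF Y]) simp
  have "r ^ j \<le> 1 + r ^ k" if "r \<ge> 0" for r :: real
  proof (cases "r \<le> 1")
    case True
    then show ?thesis using that power_le_one[of r j] zero_le_power[of r k] by linarith
  next
    case False
    then have "r ^ j \<le> r ^ k" using assms(3) by (intro power_increasing) auto
    then show ?thesis by simp
  qed
  then show "AE \<omega> in M. norm (norm (real_vec (Y \<omega>)) ^ j) \<le> norm (1 + norm (real_vec (Y \<omega>)) ^ k)"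
    by (intro AE_I2) (simp add: order_trans[OF _ abs_ge_self])
qed

lemma second_moment_quadratic:
  fixes Y :: "'a \<Rightarrow> int ^ 'n"
  assumes m: "finite_moments M Y 4" and Y: "Y \<in> M \<rightarrow>\<^sub>M count_space UNIV"
  shows "l \<bullet> (second_moment_matrix M Y *v l) = (\<Sum>\<^sub>\<infinity>x. law M Y x * (l \<bullet> real_vec x)\<^sup>2)"
proof -
  have n2: "integrable M (\<lambda>\<omega>. norm (real_vec (Y \<omega>)) ^ 2)"
    by (rule integrable_norm_power_mono[OF finite_moments_norm[OF m Y] Y]) simp
  have ij: "integrable M (\<lambda>\<omega>. real_of_int (Y \<omega> $ i) * real_of_int (Y \<omega> $ j))" for i j
  proof (rule Bochner_Integration.integrable_bound[OF n2])
    show "(\<lambda>\<omega>. real_of_int (Y \<omega> $ i) * real_of_int (Y \<omega> $ j)) \<in> borel_measurable M"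
      by (rule measurable_compose[OF Y]) simp
    have "\<bar>real_of_int (y $ i) * real_of_int (y $ j)\<bar> \<le> norm (real_vec y) ^ 2" for y :: "int ^ 'n"
      unfolding abs_mult power2_eq_square by (intro mult_mono coord_le_norm) auto
    then show "AE \<omega> in M. norm (real_of_int (Y \<omega> $ i) * real_of_int (Y \<omega> $ j)) \<le> norm (norm (real_vec (Y \<omega>)) ^ 2)"
      by (intro AE_I2) simp
  qed
  have sq: "(l \<bullet> real_vec y)\<^sup>2 = (\<Sum>i\<in>UNIV. \<Sum>j\<in>UNIV. l $ i * l $ j * (real_of_int (y $ i) * real_of_int (y $ j)))" for y
    by (simp add: inner_vec_def power2_eq_square sum_product mult_ac)
  have int: "integrable M (\<lambda>\<omega>. (l \<bullet> real_vec (Y \<omega>))\<^sup>2)"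
    unfolding sq by (intro Bochner_Integration.integrable_sum integrable_mult_right ij)
  have "(\<Sum>\<^sub>\<infinity>x. law M Y x * (l \<bullet> real_vec x)\<^sup>2) = (\<integral>\<omega>. (l \<bullet> real_vec (Y \<omega>))\<^sup>2 \<partial>M)"
    by (rule infsumI[OF law_expectation[OF int Y]])
  also have "\<dots> = (\<Sum>i\<in>UNIV. \<Sum>j\<in>UNIV. l $ i * l $ j * (\<integral>\<omega>. real_of_int (Y \<omega> $ i) * real_of_int (Y \<omega> $ j) \<partial>M))"
    unfolding sq by (subst Bochner_Integration.integral_sum, (intro Bochner_Integration.integrable_sum integrable_mult_right ij))
      (simp add: Bochner_Integration.integral_sum ij)
  also have "\<dots> = l \<bullet> (second_moment_matrix M Y *v l)"
    by (simp add: second_moment_matrix_def inner_vec_def matrix_vector_mult_def sum_distrib_left mult_ac)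
  finally show ?thesis by simp
qed

end

section \<open>The transition recursion\<close>

lemma perturbed_walk_factor:
  "perturbed_walk \<xi> \<eta> x0 n \<omega> = perturbed_walk (\<lambda>k f. fst (f k)) (\<lambda>k f. snd (f k)) x0 n (\<lambda>k. (\<xi> k \<omega>, \<eta> k \<omega>))"
  by (induction n) auto

lemma perturbed_walk_restrict:
  "perturbed_walk (\<lambda>k f. fst (f k)) (\<lambda>k f. snd (f k)) x0 n f
    = perturbed_walk (\<lambda>k f. fst (f k)) (\<lambda>k f. snd (f k)) x0 n (restrict f {1..N})" if "n \<le> N"
  using that by (induction n) auto

lemma perturbed_walk_measurable:
  fixes \<xi> \<eta> :: "nat \<Rightarrow> 'w \<Rightarrow> int ^ 'n"
  assumes "\<And>k. k \<in> {1..n} \<Longrightarrow> \<xi> k \<in> M \<rightarrow>\<^sub>M count_space UNIV" "\<And>k. k \<in> {1..n} \<Longrightarrow> \<eta> k \<in> M \<rightarrow>\<^sub>M count_space UNIV"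
  shows "perturbed_walk \<xi> \<eta> x0 n \<in> M \<rightarrow>\<^sub>M count_space UNIV"
  using assms
proof (induction n)
  case 0
  have "perturbed_walk \<xi> \<eta> x0 0 = (\<lambda>_. x0)" by auto
  then show ?case by simp
next
  case (Suc n)
  have Z: "perturbed_walk \<xi> \<eta> x0 n \<in> M \<rightarrow>\<^sub>M count_space UNIV" using Suc by auto
  have W: "(\<lambda>\<omega>. (\<xi> (Suc n) \<omega>, \<eta> (Suc n) \<omega>)) \<in> M \<rightarrow>\<^sub>M count_space UNIV"
    using measurable_count_space_binary[of "\<xi> (Suc n)" M "\<eta> (Suc n)" Pair] Suc.prems by auto
  define F :: "int ^ 'n \<Rightarrow> (int ^ 'n) \<times> (int ^ 'n) \<Rightarrow> int ^ 'n"
    where "F z w = z + fst w + (if z = 0 then snd w - fst w else 0)" for z w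
  have eq: "perturbed_walk \<xi> \<eta> x0 (Suc n) = (\<lambda>\<omega>. F (perturbed_walk \<xi> \<eta> x0 n \<omega>) (\<xi> (Suc n) \<omega>, \<eta> (Suc n) \<omega>))"
    by (rule ext) (simp add: F_def)
  show ?case unfolding eq by (rule measurable_count_space_binary[OF Z W])
qed

lemma free_walk_eq_perturbed: "free_walk \<xi> x0 n = perturbed_walk \<xi> \<xi> x0 n"
proof
  show "free_walk \<xi> x0 n \<omega> = perturbed_walk \<xi> \<xi> x0 n \<omega>" for \<omega>
    by (induction n) (auto simp: free_walk_def add.assoc)
qed

context prob_space
begin

text \<open>The position at time \<open>n\<close> is a function of the first \<open>n\<close> pairs of increments. As a measurable function on
  the space of those pairs it is the perturbed walk driven by the coordinate maps.\<close>

lemma walk_step_indep: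
  fixes \<xi> \<eta> :: "nat \<Rightarrow> 'a \<Rightarrow> int ^ 'n"
  assumes indep: "indep_vars (\<lambda>_. count_space UNIV) (\<lambda>n \<omega>. (\<xi> n \<omega>, \<eta> n \<omega>)) {1..}"
  shows "prob {\<omega> \<in> space M. perturbed_walk \<xi> \<eta> x0 n \<omega> = y \<and> (\<xi> (Suc n) \<omega>, \<eta> (Suc n) \<omega>) \<in> S}
    = prob {\<omega> \<in> space M. perturbed_walk \<xi> \<eta> x0 n \<omega> = y} * prob {\<omega> \<in> space M. (\<xi> (Suc n) \<omega>, \<eta> (Suc n) \<omega>) \<in> S}"
proof -
  define W where "W = (\<lambda>n \<omega>. (\<xi> n \<omega>, \<eta> n \<omega>))"
  define G where "G = perturbed_walk (\<lambda>k (f :: nat \<Rightarrow> (int ^ 'n) \<times> (int ^ 'n)). fst (f k)) (\<lambda>k f. snd (f k)) x0 n"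
  define K where "K b = (if b then {1..n} else {Suc n})" for b
  define N where "N b = PiM (K b) (\<lambda>_. count_space (UNIV :: ((int ^ 'n) \<times> (int ^ 'n)) set))" for b
  have ind: "indep_vars N (\<lambda>b \<omega>. restrict (\<lambda>i. W i \<omega>) (K b)) UNIV"
    unfolding N_def
  proof (rule indep_vars_restrict)
    show "indep_vars (\<lambda>_. count_space UNIV) W {1..}" using indep by (simp add: W_def)
    show "K b \<subseteq> {1..}" for b by (auto simp: K_def)
    show "disjoint_family_on K UNIV" by (auto simp: disjoint_family_on_def K_def)
  qed
  have G_meas: "G \<in> N True \<rightarrow>\<^sub>M count_space UNIV"
    unfolding G_def
  proof (rule perturbed_walk_measurable)
    fix k assume "k \<in> {1..n}"
    then have comp: "(\<lambda>f. f k) \<in> N True \<rightarrow>\<^sub>M count_space UNIV"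
      unfolding N_def by (intro measurable_component_singleton) (simp add: K_def)
    show "(\<lambda>f. fst (f k)) \<in> N True \<rightarrow>\<^sub>M count_space UNIV" by (rule measurable_compose[OF comp]) simp
    show "(\<lambda>f. snd (f k)) \<in> N True \<rightarrow>\<^sub>M count_space UNIV" by (rule measurable_compose[OF comp]) simp
  qed
  have comp: "(\<lambda>f. f (Suc n)) \<in> N False \<rightarrow>\<^sub>M count_space UNIV"
    unfolding N_def by (intro measurable_component_singleton) (simp add: K_def)
  define A where "A b = (if b then G -` {y} \<inter> space (N True) else (\<lambda>f. f (Suc n)) -` S \<inter> space (N False))" for b
  have A: "A b \<in> sets (N b)" for b
    using measurable_sets[OF G_meas, of "{y}"] measurable_sets[OF comp, of S] by (cases b) (auto simp: A_def)
  have "prob (\<Inter>b\<in>UNIV. (\<lambda>\<omega>. restrict (\<lambda>i. W i \<omega>) (K b)) -` A b \<inter> space M) = (\<Prod>b\<in>UNIV. prob ((\<lambda>\<omega>. restrict (\<lambda>i. W i \<omega>) (K b)) -` A b \<inter> space M))"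
    by (rule indep_varsD[OF ind]) (use A in auto)
  also have "\<dots> = prob ((\<lambda>\<omega>. restrict (\<lambda>i. W i \<omega>) (K True)) -` A True \<inter> space M) * prob ((\<lambda>\<omega>. restrict (\<lambda>i. W i \<omega>) (K False)) -` A False \<inter> space M)"
    by (simp add: UNIV_bool mult.commute)
  finally have main: "prob (\<Inter>b\<in>UNIV. (\<lambda>\<omega>. restrict (\<lambda>i. W i \<omega>) (K b)) -` A b \<inter> space M)
    = prob ((\<lambda>\<omega>. restrict (\<lambda>i. W i \<omega>) (K True)) -` A True \<inter> space M) * prob ((\<lambda>\<omega>. restrict (\<lambda>i. W i \<omega>) (K False)) -` A False \<inter> space M)" .
  have sp: "restrict f (K b) \<in> space (N b)" for f b by (simp add: N_def space_PiM)
  have GW: "G (restrict (\<lambda>i. W i \<omega>) (K True)) = perturbed_walk \<xi> \<eta> x0 n \<omega>" for \<omega>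
    unfolding G_def K_def W_def using perturbed_walk_restrict[of n n x0 "\<lambda>k. (\<xi> k \<omega>, \<eta> k \<omega>)"] perturbed_walk_factor[of \<xi> \<eta> x0 n \<omega>] by simp
  have T: "(\<lambda>\<omega>. restrict (\<lambda>i. W i \<omega>) (K True)) -` A True \<inter> space M = {\<omega> \<in> space M. perturbed_walk \<xi> \<eta> x0 n \<omega> = y}"
    using sp GW by (auto simp: A_def)
  have F: "(\<lambda>\<omega>. restrict (\<lambda>i. W i \<omega>) (K False)) -` A False \<inter> space M = {\<omega> \<in> space M. (\<xi> (Suc n) \<omega>, \<eta> (Suc n) \<omega>) \<in> S}"
    using sp[of _ False] by (auto simp: A_def K_def W_def)
  have "(\<Inter>b\<in>UNIV. (\<lambda>\<omega>. restrict (\<lambda>i. W i \<omega>) (K b)) -` A b \<inter> space M)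
    = {\<omega> \<in> space M. perturbed_walk \<xi> \<eta> x0 n \<omega> = y \<and> (\<xi> (Suc n) \<omega>, \<eta> (Suc n) \<omega>) \<in> S}"
    unfolding UNIV_bool INT_insert T F by auto
  then show ?thesis using main unfolding T F by simp
qed

lemma identically_distributed_law:
  assumes "identically_distributed M X {1..}" "\<And>k. k \<in> {1..} \<Longrightarrow> X k \<in> M \<rightarrow>\<^sub>M count_space UNIV" "k \<ge> 1"
  shows "law M (X k) = law M (X 1)"
proof
  fix x
  have m: "law M (X k) x = measure (distr M (count_space UNIV) (X k)) {x}" if "k \<ge> 1" for k
    using assms(2)[of k] that by (subst measure_distr) (auto simp: law_def vimage_def Int_def conj_commute)
  have "distr M (count_space UNIV) (X k) = distr M (count_space UNIV) (X 1)"
  proof -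
    have "k \<in> {1..}" "(1 :: nat) \<in> {1..}" using assms(3) by auto
    then show ?thesis using assms(1) unfolding identically_distributed_def by blast
  qed
  then show "law M (X k) x = law M (X 1) x"
    using m[OF assms(3)] m[of 1] by simp
qed

lemma perturbed_walk_law_Suc:
  fixes \<xi> \<eta> :: "nat \<Rightarrow> 'a \<Rightarrow> int ^ 'n"
  assumes indep: "indep_vars (\<lambda>_. count_space UNIV) (\<lambda>n \<omega>. (\<xi> n \<omega>, \<eta> n \<omega>)) {1..}"
    and idx: "identically_distributed M \<xi> {1..}" and ide: "identically_distributed M \<eta> {1..}"
  shows "law M (perturbed_walk \<xi> \<eta> x0 (Suc n)) x
    = lattice_conv (law M (\<xi> 1)) (law M (perturbed_walk \<xi> \<eta> x0 n)) x
      + law M (perturbed_walk \<xi> \<eta> x0 n) 0 * (law M (\<eta> 1) x - law M (\<xi> 1) x)"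
proof -
  have W: "(\<lambda>\<omega>. (\<xi> k \<omega>, \<eta> k \<omega>)) \<in> M \<rightarrow>\<^sub>M count_space UNIV" if "k \<in> {1..}" for k
    using indep that unfolding indep_vars_def2 by blast
  have mx: "\<xi> k \<in> M \<rightarrow>\<^sub>M count_space UNIV" if "k \<in> {1..}" for k
    using measurable_compose[OF W[OF that], of fst "count_space UNIV"] by simp
  have me: "\<eta> k \<in> M \<rightarrow>\<^sub>M count_space UNIV" if "k \<in> {1..}" for k
    using measurable_compose[OF W[OF that], of snd "count_space UNIV"] by simp
  define Z where "Z = perturbed_walk \<xi> \<eta> x0"
  have Z: "Z n \<in> M \<rightarrow>\<^sub>M count_space UNIV" for n
    unfolding Z_def by (rule perturbed_walk_measurable) (use mx me in auto)
  define p where "p = law M (\<xi> 1)"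
  define q where "q = law M (\<eta> 1)"
  have lx: "law M (\<xi> (Suc n)) = p" unfolding p_def by (rule identically_distributed_law[OF idx mx]) auto
  have le: "law M (\<eta> (Suc n)) = q" unfolding q_def by (rule identically_distributed_law[OF ide me]) auto
  have ps: "p summable_on UNIV" "q summable_on UNIV" "law M (Z n) summable_on UNIV"
    using law_has_sum[OF mx[of 1]] law_has_sum[OF me[of 1]] law_has_sum[OF Z] by (auto simp: p_def q_def summable_on_def)
  have step: "measure M ({\<omega> \<in> space M. Z (Suc n) \<omega> = x} \<inter> {\<omega> \<in> space M. Z n \<omega> = y})
     = law M (Z n) y * (p (x - y) + of_bool (y = 0) * (q x - p x))" for y
  proof -
    define S where "S = {w :: (int ^ 'n) \<times> (int ^ 'n). (if y = 0 then snd w else fst w) = x - y}"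
    have "{\<omega> \<in> space M. Z (Suc n) \<omega> = x} \<inter> {\<omega> \<in> space M. Z n \<omega> = y} = {\<omega> \<in> space M. perturbed_walk \<xi> \<eta> x0 n \<omega> = y \<and> (\<xi> (Suc n) \<omega>, \<eta> (Suc n) \<omega>) \<in> S}"
      by (auto simp: Z_def S_def algebra_simps)
    then have "measure M ({\<omega> \<in> space M. Z (Suc n) \<omega> = x} \<inter> {\<omega> \<in> space M. Z n \<omega> = y})
      = law M (Z n) y * measure M {\<omega> \<in> space M. (\<xi> (Suc n) \<omega>, \<eta> (Suc n) \<omega>) \<in> S}"
      using walk_step_indep[OF indep, of x0 n y S] by (simp add: law_def Z_def)
    also have "measure M {\<omega> \<in> space M. (\<xi> (Suc n) \<omega>, \<eta> (Suc n) \<omega>) \<in> S} = p (x - y) + of_bool (y = 0) * (q x - p x)"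
      unfolding S_def using lx[symmetric] le[symmetric] by (cases "y = 0") (simp_all add: law_def)
    finally show ?thesis .
  qed
  have "law M (Z (Suc n)) x = (\<Sum>\<^sub>\<infinity>y. measure M ({\<omega> \<in> space M. Z (Suc n) \<omega> = x} \<inter> {\<omega> \<in> space M. Z n \<omega> = y}))"
    unfolding law_def
  proof (rule prob_partition[OF _ Z])
    have "{\<omega> \<in> space M. Z (Suc n) \<omega> = x} = Z (Suc n) -` {x} \<inter> space M" by auto
    then show "{\<omega> \<in> space M. Z (Suc n) \<omega> = x} \<in> sets M" using measurable_sets[OF Z, of "{x}" "Suc n"] by simp
  qed
  also have "\<dots> = (\<Sum>\<^sub>\<infinity>y. law M (Z n) y * p (x - y) + of_bool (y = 0) * (law M (Z n) y * (q x - p x)))"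
    unfolding step by (intro infsum_cong) (simp add: algebra_simps)
  also have "\<dots> = lattice_conv (law M (Z n)) p x + (\<Sum>\<^sub>\<infinity>y. of_bool (y = 0) * (law M (Z n) y * (q x - p x)))"
    unfolding lattice_conv_def
    by (intro infsum_add lattice_conv_summand ps finite_nonzero_values_imp_summable_on) auto
  also have "(\<Sum>\<^sub>\<infinity>y. of_bool (y = 0) * (law M (Z n) y * (q x - p x))) = (\<Sum>\<^sub>\<infinity>y\<in>{0}. law M (Z n) y * (q x - p x))"
    by (rule infsum_cong_neutral) auto
  also have "\<dots> = law M (Z n) 0 * (q x - p x)" by simp
  also have "lattice_conv (law M (Z n)) p = lattice_conv p (law M (Z n))" by (rule lattice_conv_commute[OF ps(3,1)])
  finally show ?thesis unfolding Z_def p_def q_def .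
qed

lemma perturbed_walk_law_0: "law M (perturbed_walk \<xi> \<eta> x0 0) = (\<lambda>x. of_bool (x = x0))"
  by (auto simp: law_def fun_eq_iff prob_space)

end

section \<open>Aperiodicity of the walk and its characteristic function\<close>

text \<open>If the modulus is \<open>1\<close> then \<open>char_fun p l = e\<close> with \<open>e = \<plusminus>1\<close>, because \<open>p\<close> is symmetric. Then \<open>cos (l \<bullet> x) = e ^ n\<close>
  wherever \<open>p\<^sub>n(x) > 0\<close>. The value \<open>e = -1\<close> would make all return times even, against aperiodicity; for \<open>e = 1\<close>
  irreducibility gives \<open>cos (l \<bullet> x) = 1\<close> for every lattice point, so that \<open>l\<close> is \<open>0\<close> on the torus.\<close>

lemma char_fun_less_1_of_aperiodic:
  fixes p :: "int ^ 'n \<Rightarrow> real"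
  assumes nn: "\<And>x. p x \<ge> 0" and sum: "(p has_sum 1) UNIV" and sym: "\<And>x. p (- x) = p x"
    and irr: "\<And>x. \<exists>n. conv_power p n x > 0"
    and aper: "Gcd {n. n \<ge> 1 \<and> conv_power p n 0 > 0} = 1"
    and l: "l \<in> torus" "l \<noteq> 0"
  shows "norm (char_fun p l) < 1"
proof (rule ccontr)
  assume "\<not> norm (char_fun p l) < 1"
  have ps: "p summable_on UNIV" using sum by (auto simp: summable_on_def)
  note pws = conv_power_summable[OF ps]
  have pw_nn: "conv_power p m x \<ge> 0" for m x
    by (induction m arbitrary: x) (auto simp: lattice_conv_def intro!: infsum_nonneg mult_nonneg_nonneg nn)
  have Re_eq: "Re (char_fun f v) = (\<Sum>\<^sub>\<infinity>x. f x * cos (v \<bullet> real_vec x))" "Im (char_fun f v) = (\<Sum>\<^sub>\<infinity>x. f x * sin (v \<bullet> real_vec x))"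
    if "f summable_on UNIV" for f :: "int ^ 'n \<Rightarrow> real" and v
    unfolding char_fun_cis using abs_summable_summable[OF char_fun_summable[OF that, of v]]
    by (subst infsum_Re[symmetric] infsum_Im[symmetric]; simp)+
  have "Im (char_fun p l) = 0"
    unfolding Re_eq(2)[OF ps] by (rule infsum_odd_zero) (simp add: sym)
  define e where "e = Re (char_fun p l)"
  have pe: "char_fun p l = of_real e" using \<open>Im (char_fun p l) = 0\<close> by (simp add: e_def complex_eq_iff)
  have "norm (char_fun p l) \<le> 1" using char_fun_bound[OF ps, of l] infsumI[OF sum] nn by simp
  with \<open>\<not> norm (char_fun p l) < 1\<close> have "\<bar>e\<bar> = 1" by (simp add: pe)
  then have e: "e = 1 \<or> e = - 1" by linarith
  have p0: "char_fun p 0 = 1"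
    using infsumI[OF sum] by (simp add: complex_eq_iff Re_eq[OF ps])
  \<comment> \<open>The average of \<open>e\<^sup>n cos (l \<bullet> x)\<close> under \<open>p\<^sub>n\<close> is \<open>1\<close> and no value exceeds \<open>1\<close>, so all values on the support are \<open>1\<close>.\<close>
  have key: "e ^ n * cos (l \<bullet> real_vec x) = 1" if "conv_power p n x > 0" for n x
  proof -
    have en: "e ^ n * e ^ n = 1" using e by (auto simp flip: power_mult_distrib)
    have s1: "(\<lambda>x. conv_power p n x * cos (l \<bullet> real_vec x)) summable_on UNIV"
      by (rule summable_on_real_comparison[OF pws[of n]]) (use pw_nn in \<open>auto simp: abs_mult intro: mult_left_le\<close>)
    have a: "(\<Sum>\<^sub>\<infinity>x. conv_power p n x * cos (l \<bullet> real_vec x)) = e ^ n"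
      using Re_eq(1)[OF pws, of n l] by (simp add: char_fun_conv_power[OF ps] pe flip: of_real_power)
    have b: "(\<Sum>\<^sub>\<infinity>x. conv_power p n x) = 1"
      using Re_eq(1)[OF pws, of n 0] by (simp add: char_fun_conv_power[OF ps] p0)
    have eq: "conv_power p n x * (1 - e ^ n * cos (l \<bullet> real_vec x)) = conv_power p n x - e ^ n * (conv_power p n x * cos (l \<bullet> real_vec x))" for x
      by (simp add: algebra_simps)
    have z: "(\<Sum>\<^sub>\<infinity>x. conv_power p n x * (1 - e ^ n * cos (l \<bullet> real_vec x))) = 0"
      unfolding eq infsum_difference(1)[OF pws summable_on_cmult_right[OF s1]] infsum_cmult_right' a b using en by simp
    have s: "(\<lambda>x. conv_power p n x * (1 - e ^ n * cos (l \<bullet> real_vec x))) summable_on UNIV"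
      unfolding eq by (rule infsum_difference(2)[OF pws summable_on_cmult_right[OF s1]])
    have nn': "conv_power p n x * (1 - e ^ n * cos (l \<bullet> real_vec x)) \<ge> 0" for x
    proof (rule mult_nonneg_nonneg[OF pw_nn])
      have "\<bar>e ^ n\<bar> = 1" using \<open>\<bar>e\<bar> = 1\<close> by (simp add: power_abs)
      then have "\<bar>e ^ n * cos (l \<bullet> real_vec x)\<bar> \<le> 1" by (simp add: abs_mult)
      then show "0 \<le> 1 - e ^ n * cos (l \<bullet> real_vec x)" by linarith
    qed
    have "conv_power p n x * (1 - e ^ n * cos (l \<bullet> real_vec x)) = 0"
      by (rule nonneg_infsum_le_0D[OF _ s nn']) (use z in auto)
    then show ?thesis using that by simp
  qed
  have e1: "e = 1"
  proof (rule ccontr)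
    assume "e \<noteq> 1"
    then have em: "e = - 1" using e by simp
    have "even n" if "conv_power p n 0 > 0" for n
      using key[OF that] by (cases "even n") (auto simp: em)
    then have "2 dvd Gcd {n. n \<ge> 1 \<and> conv_power p n 0 > 0}"
      by (intro Gcd_greatest) auto
    then show False using aper by simp
  qed
  have "l $ i = 0" for i
  proof -
    obtain n where n: "conv_power p n (axis i 1) > 0" using irr by blast
    have "l \<bullet> real_vec (axis i 1) = l $ i"
    proof -
      have "real_vec (axis i 1) = (axis i 1 :: real ^ 'n)" by (simp add: vec_eq_iff axis_def)
      then show ?thesis by (simp add: inner_axis)
    qed
    then have "cos (l $ i) = 1" using key[OF n] by (simp add: e1)
    then obtain k :: int where k: "l $ i = real_of_int k * 2 * pi" using cos_one_2pi_int[of "l $ i"] by auto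
    have "\<bar>l $ i\<bar> \<le> pi" using l(1) by (simp add: mem_torus)
    then have "\<bar>real_of_int k\<bar> * 2 \<le> 1" unfolding k by (simp add: abs_mult)
    then have "k = 0" by linarith
    then show ?thesis using k by simp
  qed
  then show False using l(2) by (simp add: vec_eq_iff)
qed

section \<open>The expansion of the perturbed walk\<close>

lemma uniform_smallo_of_uniform_limit:
  assumes L: "uniform_limit UNIV L (\<lambda>_. 0) sequentially"
    and eq: "\<And>n x. n > 0 \<Longrightarrow> real n powr r * R n x = L n x"
  shows "uniform_smallo A R r"
proof -
  have "uniform_limit UNIV (\<lambda>n x. real n powr r * R n x) (\<lambda>_. 0) sequentially"
  proof (rule uniform_limit_cong[THEN iffD1, OF _ _ L])
    show "\<forall>\<^sub>F n in sequentially. \<forall>x\<in>UNIV. L n x = real n powr r * R n x"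
      using eventually_gt_at_top[of 0] by eventually_elim (simp add: eq)
  qed simp
  then show ?thesis unfolding uniform_smallo_def by (rule uniform_limit_on_subset) simp
qed

theorem theorem1p1:
  fixes M :: "'w measure"
    and \<xi> \<eta> :: "nat \<Rightarrow> 'w \<Rightarrow> int ^ 'n"
    and p q a :: "int ^ 'n \<Rightarrow> real"
    and B :: "real ^ 'n ^ 'n" and d :: "real ^ 'n" and absB :: real
    and P :: "nat \<Rightarrow> int ^ 'n \<Rightarrow> real"
  assumes "prob_space M"
    and indep: "prob_space.indep_vars M (\<lambda>_. count_space UNIV) (\<lambda>n \<omega>. (\<xi> n \<omega>, \<eta> n \<omega>)) {1..}"
    and "identically_distributed M \<xi> {1..}"
    and "identically_distributed M \<eta> {1..}"
    and p_def: "p = law M (\<xi> 1)"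
    and q_def: "q = law M (\<eta> 1)"
    and a_def: "a = (\<lambda>x. q x - p x)"
    and B_def: "B = second_moment_matrix M (\<xi> 1)"
    and absB_def: "absB = sqrt (det B)"
    and d_def: "d = mean_vec M (\<eta> 1)"
    and P_def: "P = (\<lambda>n x. n_step_prob M (perturbed_walk \<xi> \<eta>) n 0 x)"
    and "\<forall>x. p x = p (- x)"
    and "finite_moments M (\<xi> 1) 4"
    and "mean_vec M (\<xi> 1) = 0"
    and "positive_definite B"
    and "irreducible_chain M (free_walk \<xi>)"
    and "aperiodic_chain M (free_walk \<xi>)"
    and "finite_moments M (\<eta> 1) 3"
    and "positive_definite (second_moment_matrix M (\<eta> 1))"
    and "d \<noteq> 0"
    and "irreducible_chain M (perturbed_walk \<xi> \<eta>)"
    and "aperiodic_chain M (perturbed_walk \<xi> \<eta>)"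
    and "\<forall>x. a x = - a (- x)"
  shows
    "(\<lambda>n. P n 0 - 1 / ((2 * pi * real n) powr (real CARD('n) / 2) * absB))
        \<in> o(\<lambda>n. 1 / real n powr (real CARD('n) / 2))
     \<and> (CARD('n) = 1 \<longrightarrow> (\<forall>k :: 'n. \<exists>\<psi>1 :: int ^ 'n \<Rightarrow> real.
          odd_fun \<psi>1
        \<and> (\<exists>C. \<forall>x. \<bar>\<psi>1 x\<bar> \<le> C)
        \<and> (\<exists>C. \<forall>\<epsilon>>0. \<forall>n\<ge>1. \<forall>x. x \<noteq> 0 \<longrightarrow>
             \<bar>\<psi>1 x\<bar> \<le> C * real n powr \<epsilon> / \<bar>real_of_int (x $ k)\<bar>)
        \<and> uniform_smallo (- {0})
            (\<lambda>n x. P n x -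
               (exp (- (real_of_int (x $ k))\<^sup>2 / (2 * B $ k $ k * real n))
                   / sqrt (2 * pi * B $ k $ k * real n)
                   * (1 + d $ k / B $ k $ k * sgn (real_of_int (x $ k)))
                 + \<psi>1 x / sqrt (real n))) (1 / 2)))
     \<and> (CARD('n) = 2 \<longrightarrow> (\<exists>\<psi>2 :: int ^ 'n \<Rightarrow> real.
          odd_fun \<psi>2
        \<and> (\<exists>C. \<forall>x. \<bar>\<psi>2 x\<bar> \<le> C)
        \<and> (\<exists>C. \<forall>x. x \<noteq> 0 \<longrightarrow> \<bar>\<psi>2 x\<bar> \<le> C / norm (real_vec x))
        \<and> uniform_smallo (- {0})
            (\<lambda>n x. P n x -
               (exp (- (real_vec x \<bullet> (matrix_inv B *v real_vec x)) / (2 * real n))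
                   / (2 * pi * absB * real n)
                 + \<psi>2 x / real n)) 1))
     \<and> (CARD('n) \<ge> 3 \<longrightarrow>
          uniform_smallo (- {0})
            (\<lambda>n x. P n x -
               (exp (- (real_vec x \<bullet> (matrix_inv B *v real_vec x)) / (2 * real n))
                   / ((2 * pi * real n) powr (real CARD('n) / 2) * absB)
                 + lattice_conv (antisym_part q) (green_function p) x
                   / ((2 * pi * real n) powr (real CARD('n) / 2) * absB)))
            (real CARD('n) / 2))"
proof -
  interpret prob_space M by fact
  let ?\<nu> = "real CARD('n) / 2"
  have W: "(\<lambda>\<omega>. (\<xi> k \<omega>, \<eta> k \<omega>)) \<in> M \<rightarrow>\<^sub>M count_space UNIV" if "k \<in> {1..}" for k
    using indep that unfolding indep_vars_def2 by blast
  have mx: "\<xi> 1 \<in> M \<rightarrow>\<^sub>M count_space UNIV"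
    using measurable_compose[OF W[of 1], of fst "count_space UNIV"] by simp
  have me: "\<eta> 1 \<in> M \<rightarrow>\<^sub>M count_space UNIV"
    using measurable_compose[OF W[of 1], of snd "count_space UNIV"] by simp
  have p_nn: "p x \<ge> 0" for x by (simp add: p_def law_nonneg)
  have p_sum: "(p has_sum 1) UNIV" unfolding p_def by (rule law_has_sum[OF mx])
  have ps: "p summable_on UNIV" using p_sum by (auto simp: summable_on_def)
  have p_sym: "p (- x) = p x" for x using \<open>\<forall>x. p x = p (- x)\<close> by simp
  have p4: "has_moment 4 p" unfolding p_def by (rule law_has_moment[OF \<open>finite_moments M (\<xi> 1) 4\<close> mx])
  have q3: "has_moment 3 q" unfolding q_def by (rule law_has_moment[OF \<open>finite_moments M (\<eta> 1) 3\<close> me])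
  have a3: "has_moment 3 a"
  proof -
    have "has_moment 3 (\<lambda>x. q x + (- 1) * p x)"
      by (intro has_moment_add has_moment_cmult q3 has_moment_mono[OF p4]) simp
    then show ?thesis by (simp add: a_def)
  qed
  have a_odd: "odd_fun a" using \<open>\<forall>x. a x = - a (- x)\<close> unfolding odd_fun_def by (metis minus_minus)
  have as: "a summable_on UNIV" by (rule has_moment_summable[OF a3])
  have free: "law M (free_walk \<xi> 0 n) = conv_power p n" for n
  proof (induction n)
    case 0
    show ?case unfolding free_walk_eq_perturbed conv_power.simps by (rule perturbed_walk_law_0)
  next
    case (Suc n)
    have ind: "indep_vars (\<lambda>_. count_space UNIV) (\<lambda>n \<omega>. (\<xi> n \<omega>, \<xi> n \<omega>)) {1..}"
      using indep_vars_compose2[OF indep, of "\<lambda>_ w. (fst w, fst w)" "\<lambda>_. count_space UNIV"] by simp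
    have "law M (free_walk \<xi> 0 (Suc n)) x = lattice_conv p (law M (free_walk \<xi> 0 n)) x" for x
      using perturbed_walk_law_Suc[OF ind \<open>identically_distributed M \<xi> {1..}\<close> \<open>identically_distributed M \<xi> {1..}\<close>, of 0 n x]
      unfolding free_walk_eq_perturbed p_def by simp
    then show ?case unfolding Suc.IH by (simp add: fun_eq_iff)
  qed
  have irr: "\<exists>n. conv_power p n x > 0" for x
    using \<open>irreducible_chain M (free_walk \<xi>)\<close> unfolding irreducible_chain_def n_step_prob_def free[symmetric] by blast
  have aper: "Gcd {n. n \<ge> 1 \<and> conv_power p n 0 > 0} = 1"
    using \<open>aperiodic_chain M (free_walk \<xi>)\<close> unfolding aperiodic_chain_def n_step_prob_def free[symmetric] by blast
  interpret symmetric_walk p B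
  proof
    show "l \<bullet> (B *v l) = (\<Sum>\<^sub>\<infinity>x. p x * (l \<bullet> real_vec x)\<^sup>2)" for l
      unfolding B_def p_def by (rule second_moment_quadratic[OF \<open>finite_moments M (\<xi> 1) 4\<close> mx])
    show "norm (char_fun p l) < 1" if "l \<in> torus" "l \<noteq> 0" for l
      by (rule char_fun_less_1_of_aperiodic[OF p_nn p_sum p_sym irr aper that])
  qed (use p_nn p_sum p_sym p4 \<open>positive_definite B\<close> in auto)
  have P_law: "P n = law M (perturbed_walk \<xi> \<eta> 0 n)" for n
    by (simp add: P_def n_step_prob_def)
  have P_eq: "P n x = pw n x + drift_sum a n x" for n x
  proof (rule perturbed_recursion_solution[OF as a_odd])
    show "P 0 = (\<lambda>x. of_bool (x = 0))" unfolding P_law by (rule perturbed_walk_law_0)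
    show "P (Suc n) x = lattice_conv p (P n) x + P n 0 * a x" for n x
      unfolding P_law a_def p_def q_def
      by (rule perturbed_walk_law_Suc[OF indep \<open>identically_distributed M \<xi> {1..}\<close> \<open>identically_distributed M \<eta> {1..}\<close>])
  qed
  have lc: "limit_const = 1 / ((2 * pi) powr ?\<nu> * absB)" by (simp add: limit_const_def absB_def)
  have split: "(2 * pi * real n) powr ?\<nu> = (2 * pi) powr ?\<nu> * real n powr ?\<nu>" for n
    by (rule powr_mult)
  have P0: "P n 0 = pw n 0" for n
    unfolding P_eq using odd_fun_0[OF drift_sum_odd[OF a_odd]] by simp
  have part0: "(\<lambda>n. P n 0 - 1 / ((2 * pi * real n) powr ?\<nu> * absB)) \<in> o(\<lambda>n. 1 / real n powr ?\<nu>)"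
  proof (rule smalloI_tendsto)
    have "(\<lambda>n. real n powr ?\<nu> * pw n 0 - limit_const) \<longlonglongrightarrow> 0"
      using pw_0_limit by (rule LIM_zero)
    moreover have "\<forall>\<^sub>F n in sequentially. real n powr ?\<nu> * pw n 0 - limit_const
        = (P n 0 - 1 / ((2 * pi * real n) powr ?\<nu> * absB)) / (1 / real n powr ?\<nu>)"
      using eventually_gt_at_top[of 0]
    proof eventually_elim
      case (elim n)
      then show ?case unfolding P0 split lc by (simp add: left_diff_distrib right_diff_distrib mult.commute[of "real n powr _"])
    qed
    ultimately show "(\<lambda>n. (P n 0 - 1 / ((2 * pi * real n) powr ?\<nu> * absB)) / (1 / real n powr ?\<nu>)) \<longlonglongrightarrow> 0"
      by (rule Lim_transform_eventually)
    show "\<forall>\<^sub>F n in sequentially. 1 / real n powr ?\<nu> \<noteq> 0"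
      using eventually_gt_at_top[of 0] by eventually_elim simp
  qed
  have part1: "\<exists>\<psi>1 :: int ^ 'n \<Rightarrow> real.
          odd_fun \<psi>1
        \<and> (\<exists>C. \<forall>x. \<bar>\<psi>1 x\<bar> \<le> C)
        \<and> (\<exists>C. \<forall>\<epsilon>>0. \<forall>n\<ge>1. \<forall>x. x \<noteq> 0 \<longrightarrow>
             \<bar>\<psi>1 x\<bar> \<le> C * real n powr \<epsilon> / \<bar>real_of_int (x $ k)\<bar>)
        \<and> uniform_smallo (- {0})
            (\<lambda>n x. P n x -
               (exp (- (real_of_int (x $ k))\<^sup>2 / (2 * B $ k $ k * real n))
                   / sqrt (2 * pi * B $ k $ k * real n)
                   * (1 + d $ k / B $ k $ k * sgn (real_of_int (x $ k)))
                 + \<psi>1 x / sqrt (real n))) (1 / 2)" if dim: "CARD('n) = 1" for k :: 'n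
  proof -
    interpret D1: symmetric_walk_1d p B k
      by unfold_locales (rule dim)
    have dk: "d $ k = (\<Sum>\<^sub>\<infinity>x. a x * D1.X x)"
    proof -
      have e1: "integrable M (\<lambda>\<omega>. norm (real_vec (\<eta> 1 \<omega>)) ^ 1)"
        by (rule integrable_norm_power_mono[OF finite_moments_norm[OF \<open>finite_moments M (\<eta> 1) 3\<close> me] me]) simp
      have e: "integrable M (\<lambda>\<omega>. real_of_int (\<eta> 1 \<omega> $ k))"
      proof (rule Bochner_Integration.integrable_bound[OF e1])
        show "(\<lambda>\<omega>. real_of_int (\<eta> 1 \<omega> $ k)) \<in> borel_measurable M"
          by (rule measurable_compose[OF me]) simp
      qed (simp add: coord_le_norm)
      have q: "((\<lambda>x. q x * D1.X x) has_sum d $ k) UNIV"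
        using law_expectation[OF e me] unfolding q_def d_def mean_vec_def D1.X_def by simp
      have pX: "(\<lambda>x. p x * D1.X x) summable_on UNIV"
        using coord_p(1)[of k] by (simp add: coord_mult_def[abs_def] D1.X_def mult.commute)
      have "(\<Sum>\<^sub>\<infinity>x. p x * D1.X x) = 0" by (rule infsum_odd_zero) (simp add: p_sym)
      moreover have "(\<Sum>\<^sub>\<infinity>x. q x * D1.X x - p x * D1.X x) = d $ k - (\<Sum>\<^sub>\<infinity>x. p x * D1.X x)"
        by (subst infsum_difference(1)[OF _ pX]) (use q in \<open>auto simp: summable_on_def infsumI\<close>)
      ultimately show ?thesis by (simp add: a_def left_diff_distrib)
    qed
    obtain \<psi> C where \<psi>: "odd_fun \<psi>" "\<exists>C. \<forall>x. \<bar>\<psi> x\<bar> \<le> C" "\<And>x. \<bar>D1.X x\<bar> * \<bar>\<psi> x\<bar> \<le> C"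
      and lim: "uniform_limit UNIV (\<lambda>n x. real n powr (1 / 2) * P n x - (gauss n x * (1 + d $ k / D1.variance * D1.sg x) + \<psi> x)) (\<lambda>_. 0) sequentially"
      using D1.one_dim_expansion[OF a3 a_odd dk P_eq] by blast
    have C: "C \<ge> 0" using \<psi>(3)[of 0] by simp
    have "\<bar>\<psi> x\<bar> \<le> C * real n powr \<epsilon> / \<bar>real_of_int (x $ k)\<bar>" if "\<epsilon> > 0" "n \<ge> 1" "x \<noteq> 0" for \<epsilon> n x
    proof -
      have X: "\<bar>real_of_int (x $ k)\<bar> > 0" using D1.X_0_iff[of x] that by (simp add: D1.X_def)
      have "real n powr \<epsilon> \<ge> 1" using that by (intro ge_one_powr_ge_zero) auto
      then have "C * 1 \<le> C * real n powr \<epsilon>" using C by (intro mult_left_mono)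
      then have "\<bar>\<psi> x\<bar> * \<bar>real_of_int (x $ k)\<bar> \<le> C * real n powr \<epsilon>"
        using \<psi>(3)[of x] by (simp add: D1.X_def mult.commute)
      then show ?thesis using X by (simp add: pos_le_divide_eq)
    qed
    moreover have "uniform_smallo (- {0})
            (\<lambda>n x. P n x -
               (exp (- (real_of_int (x $ k))\<^sup>2 / (2 * B $ k $ k * real n))
                   / sqrt (2 * pi * B $ k $ k * real n)
                   * (1 + d $ k / B $ k $ k * sgn (real_of_int (x $ k)))
                 + \<psi> x / sqrt (real n))) (1 / 2)"
    proof (rule uniform_smallo_of_uniform_limit[OF lim])
      fix n :: nat and x :: "int ^ 'n" assume n: "n > 0"
      have s: "real n powr (1 / 2) = sqrt (real n)" by (simp add: powr_half_sqrt)
      have g: "sqrt (real n) * (exp (- (real_of_int (x $ k))\<^sup>2 / (2 * B $ k $ k * real n)) / sqrt (2 * pi * B $ k $ k * real n)) = gauss n x"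
        using n unfolding D1.gauss_1d D1.variance_def D1.X_def real_sqrt_mult[of _ "real n"] by simp
      show "real n powr (1 / 2) * (P n x -
               (exp (- (real_of_int (x $ k))\<^sup>2 / (2 * B $ k $ k * real n))
                   / sqrt (2 * pi * B $ k $ k * real n)
                   * (1 + d $ k / B $ k $ k * sgn (real_of_int (x $ k)))
                 + \<psi> x / sqrt (real n)))
        = real n powr (1 / 2) * P n x - (gauss n x * (1 + d $ k / D1.variance * D1.sg x) + \<psi> x)"
        unfolding g[symmetric] s D1.variance_def D1.sg_def D1.X_def using n
        by (simp add: right_diff_distrib distrib_left)
    qed
    ultimately show ?thesis using \<psi>(1,2) by blast
  qed
  have part2: "\<exists>\<psi>2 :: int ^ 'n \<Rightarrow> real.
          odd_fun \<psi>2
        \<and> (\<exists>C. \<forall>x. \<bar>\<psi>2 x\<bar> \<le> C)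
        \<and> (\<exists>C. \<forall>x. x \<noteq> 0 \<longrightarrow> \<bar>\<psi>2 x\<bar> \<le> C / norm (real_vec x))
        \<and> uniform_smallo (- {0})
            (\<lambda>n x. P n x -
               (exp (- (real_vec x \<bullet> (matrix_inv B *v real_vec x)) / (2 * real n))
                   / (2 * pi * absB * real n)
                 + \<psi>2 x / real n)) 1" if dim: "CARD('n) = 2"
  proof -
    obtain \<psi> where \<psi>: "odd_fun \<psi>" "\<exists>C. \<forall>x. \<bar>\<psi> x\<bar> \<le> C" "\<exists>C. \<forall>x. x \<noteq> 0 \<longrightarrow> \<bar>\<psi> x\<bar> \<le> C / norm (real_vec x)"
      and lim: "uniform_limit UNIV (\<lambda>n x. real n * P n x - (gauss n x + \<psi> x)) (\<lambda>_. 0) sequentially"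
      using two_dim_expansion[OF a3 a_odd dim P_eq] by blast
    have "uniform_smallo (- {0})
            (\<lambda>n x. P n x -
               (exp (- (real_vec x \<bullet> (matrix_inv B *v real_vec x)) / (2 * real n))
                   / (2 * pi * absB * real n)
                 + \<psi> x / real n)) 1"
      by (rule uniform_smallo_of_uniform_limit[OF lim])
         (simp add: gauss_def lc dim right_diff_distrib distrib_left)
    with \<psi> show ?thesis by blast
  qed
  have part3: "uniform_smallo (- {0})
            (\<lambda>n x. P n x -
               (exp (- (real_vec x \<bullet> (matrix_inv B *v real_vec x)) / (2 * real n))
                   / ((2 * pi * real n) powr (real CARD('n) / 2) * absB)
                 + lattice_conv (antisym_part q) (green_function p) x
                   / ((2 * pi * real n) powr (real CARD('n) / 2) * absB)))
            (real CARD('n) / 2)" if dim: "CARD('n) \<ge> 3"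
  proof -
    have dim2: "CARD('n) \<ge> 2" using dim by simp
    have anti: "antisym_part q = a"
    proof
      fix x
      have "a (- x) = - a x" using a_odd unfolding odd_fun_def by blast
      then have "q (- x) = p x - a x" using p_sym[of x] unfolding a_def by linarith
      moreover have "q x = p x + a x" by (simp add: a_def)
      ultimately show "antisym_part q x = a x" by (simp add: antisym_part_def)
    qed
    show ?thesis
    proof (rule uniform_smallo_of_uniform_limit[OF drift_expansion(1)[OF a3 a_odd dim2 P_eq]])
      fix n :: nat and x :: "int ^ 'n" assume n: "n > 0"
      then show "real n powr ?\<nu> * (P n x -
               (exp (- (real_vec x \<bullet> (matrix_inv B *v real_vec x)) / (2 * real n))
                   / ((2 * pi * real n) powr ?\<nu> * absB)
                 + lattice_conv (antisym_part q) (green_function p) x / ((2 * pi * real n) powr ?\<nu> * absB)))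
        = real n powr ?\<nu> * P n x - (gauss n x + limit_const * (\<Sum>m. lattice_conv a (pw m) x))"
        unfolding anti conv_green_function[OF dim as] split gauss_def lc
        by (simp add: right_diff_distrib distrib_left)
    qed
  qed
  show ?thesis
    by (intro conjI impI allI) ((rule part0 | rule part1 | rule part2 | rule part3); assumption?)+
qed

end
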